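(* Consider a smooth discrete-time system $x^{i,+}=f^i(x,u)$, $i=1,\ldots,n$, with $\dim(x)=n$, $\dim(u)=m$ and $\mathrm{rank}(\partial_u f)=m$. There exists a (local) coordinate transformation $$(\bar x_1,\bar x_2)=\Phi_x(x),\qquad (\bar u_1,\bar u_2)=\Phi_u(x,u)$$ with $\dim(\bar u_2)=\dim(\bar x_2)=m_2$ such that in transformed coordinates the system has the form $$\begin{array}{rcl}\bar x_1^+&=&\bar f_1(\bar x_1,\bar x_2,\bar u_1)\\ \bar x_2^+&=&\bar f_2(\bar x_1,\bar x_2,\bar u_1,\bar u_2)\end{array}$$ if and only if on $\mathcal X\times\mathcal U$ there exists (locally) an $m_2$-dimensional projectable and involutive subdistribution $D\subset\mathrm{span}\{\partial_u\}$.
   Context: A discrete-time system $x^{+}=f(x,u)$ is a smooth map $f:\mathcal X\times\mathcal U\to\mathcal X^+$, where $\mathcal X\times\mathcal U$ has coordinates $(x,u)$, $\dim x=n$, $\dim u=m$, and $\mathcal X^+$ has coordinates $x^+$. Standing assumptions: all functions are smooth, $\mathrm{rank}(\partial_{(x,u)}f)=n$ (so $f$ is a submersion), and all statements are local, in a suitable neighborhood of an equilibrium $(x_0,u_0)$, i.e. a point with $x_0=f(x_0,u_0)$. The rank conditions hold on the considered neighborhood. State and input transformations: $\bar x=\Phi_x(x)$ and $\bar u=\Phi_u(x,u)$, where $\Phi_x$ and $(x,u)\mapsto(\Phi_x(x),\Phi_u(x,u))$ are local diffeomorphisms; the variables $x^+$ are transformed in the same way as $x$, i.e. $\bar x^+=\Phi_x(x^+)$.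 The transformed system is $\bar x^{+}=\bar f(\bar x,\bar u)$ with $\bar f=\Phi_x\circ f\circ\hat\Phi$, where $(x,u)=\hat\Phi(\bar x,\bar u)$ is the inverse of the transformation. $\mathrm{span}\{\partial_u\}$ is the distribution on $\mathcal X\times\mathcal U$ spanned by $\partial_{u^1},\ldots,\partial_{u^m}$. A vector field $v$ on $\mathcal X\times\mathcal U$ is called projectable if there is a vector field $w$ on $\mathcal X^+$ such that $f_{*p}(v_p)=w_q$ for all $q\in\mathcal X^+$ and $p\in f^{-1}(q)$ ($v$ and $w$ are $f$-related). A distribution $D$ on $\mathcal X\times\mathcal U$ is called projectable if it admits a basis consisting of projectable vector fields. *)

theory Defs
  imports "HOL-Analysis.Analysis"
begin

text \<open>
  \<open>Ck_on\<close> and \<open>smooth_on\<close> are meant for open sets \<open>S\<close>; then \<open>Ck_on k S f\<close> says that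
  \<open>f\<close> is \<open>k\<close> times continuously differentiable on \<open>S\<close>.
\<close>

primrec Ck_on ::
  "nat \<Rightarrow> 'a::euclidean_space set \<Rightarrow> ('a \<Rightarrow> 'b::real_normed_vector) \<Rightarrow> bool" where
  "Ck_on 0 S f \<longleftrightarrow> continuous_on S f"
| "Ck_on (Suc k) S f \<longleftrightarrow>
     (\<forall>p\<in>S. f differentiable (at p)) \<and>
     (\<forall>v. Ck_on k S (\<lambda>p. frechet_derivative f (at p) v))"

definition smooth_on ::
  "'a::euclidean_space set \<Rightarrow> ('a \<Rightarrow> 'b::real_normed_vector) \<Rightarrow> bool" where
  "smooth_on S f \<longleftrightarrow> (\<forall>k. Ck_on k S f)"

definition diffeomorphism ::
  "'a::euclidean_space set \<Rightarrow> 'b::euclidean_space set \<Rightarrow> ('a \<Rightarrow> 'b) \<Rightarrow> ('b \<Rightarrow> 'a) \<Rightarrow> bool" where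
  "diffeomorphism S T \<phi> \<psi> \<longleftrightarrow>
     open S \<and> open T \<and> homeomorphism S T \<phi> \<psi> \<and> smooth_on S \<phi> \<and> smooth_on T \<psi>"

text \<open>
  A vector field is given by its coordinate representation \<open>'a \<Rightarrow> 'a\<close>, and a distribution by the
  family of its fibres. \<open>frame_on W r v D\<close>: the vector fields \<open>v 0, \<dots>, v (r - 1)\<close> form a basis of
  \<open>D\<close> on \<open>W\<close>.
\<close>

definition frame_on ::
  "'a::euclidean_space set \<Rightarrow> nat \<Rightarrow> (nat \<Rightarrow> 'a \<Rightarrow> 'a) \<Rightarrow> ('a \<Rightarrow> 'a set) \<Rightarrow> bool" where
  "frame_on W r v D \<longleftrightarrow>
     (\<forall>i<r. smooth_on W (v i)) \<and>
     (\<forall>p\<in>W. inj_on (\<lambda>i. v i p) {..<r} \<and>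
            independent ((\<lambda>i. v i p) ` {..<r}) \<and>
            span ((\<lambda>i. v i p) ` {..<r}) = D p)"

definition distribution_on :: "'a::euclidean_space set \<Rightarrow> nat \<Rightarrow> ('a \<Rightarrow> 'a set) \<Rightarrow> bool" where
  "distribution_on W r D \<longleftrightarrow>
     (\<forall>p\<in>W. subspace (D p) \<and> dim (D p) = r) \<and>
     (\<forall>p\<in>W. \<exists>W' v. open W' \<and> p \<in> W' \<and> W' \<subseteq> W \<and> frame_on W' r v D)"

definition lie_bracket :: "('a::euclidean_space \<Rightarrow> 'a) \<Rightarrow> ('a \<Rightarrow> 'a) \<Rightarrow> 'a \<Rightarrow> 'a" where
  "lie_bracket v w p =
     frechet_derivative w (at p) (v p) - frechet_derivative v (at p) (w p)"

definition involutive_on :: "'a::euclidean_space set \<Rightarrow> ('a \<Rightarrow> 'a set) \<Rightarrow> bool" where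
  "involutive_on W D \<longleftrightarrow>
     (\<forall>W' v w. open W' \<and> W' \<subseteq> W \<and> smooth_on W' v \<and> smooth_on W' w \<and>
        (\<forall>p\<in>W'. v p \<in> D p \<and> w p \<in> D p) \<longrightarrow> (\<forall>p\<in>W'. lie_bracket v w p \<in> D p))"

text \<open>
  Here \<open>W\<close> and \<open>V\<close> are the open sets playing the roles of \<open>\<X> \<times> \<U>\<close> and \<open>\<X>\<^sup>+\<close>.
\<close>

definition projectable_field ::
  "('a::euclidean_space \<Rightarrow> 'b::euclidean_space) \<Rightarrow> 'a set \<Rightarrow> 'b set \<Rightarrow> ('a \<Rightarrow> 'a) \<Rightarrow> bool" where
  "projectable_field f W V v \<longleftrightarrow>
     smooth_on W v \<and>
     (\<exists>w. smooth_on V w \<and>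
        (\<forall>q\<in>V. \<forall>p\<in>W. f p = q \<longrightarrow> frechet_derivative f (at p) (v p) = w q))"

definition projectable_distribution ::
  "('a::euclidean_space \<Rightarrow> 'b::euclidean_space) \<Rightarrow> 'a set \<Rightarrow> 'b set \<Rightarrow> nat \<Rightarrow> ('a \<Rightarrow> 'a set) \<Rightarrow> bool"
  where
  "projectable_distribution f W V r D \<longleftrightarrow>
     (\<exists>v. frame_on W r v D \<and> (\<forall>i<r. projectable_field f W V (v i)))"

definition map_rank :: "('a::euclidean_space \<Rightarrow> 'b::euclidean_space) \<Rightarrow> nat" where
  "map_rank L = dim (range L)"

definition span_du :: "((real^'n) \<times> (real^'m)) set" where
  "span_du = span (range (\<lambda>j. (0, axis j 1)))"

definition extended_map ::
  "(real^'n \<Rightarrow> real^'n) \<Rightarrow> ((real^'n) \<times> (real^'m) \<Rightarrow> real^'m) \<Rightarrow>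
     (real^'n) \<times> (real^'m) \<Rightarrow> (real^'n) \<times> (real^'m)" where
  "extended_map \<Phi>x \<Phi>u = (\<lambda>(x, u). (\<Phi>x x, \<Phi>u (x, u)))"

text \<open>
  The same \<open>\<Phi>x\<close> transforms \<open>x\<close> and \<open>x\<^sup>+ = f (x, u)\<close>, so its domain \<open>A\<close> has to contain both.
\<close>

definition state_input_transformation ::
  "((real^'n) \<times> (real^'m) \<Rightarrow> real^'n) \<Rightarrow> (real^'n) set \<Rightarrow> ((real^'n) \<times> (real^'m)) set \<Rightarrow>
     (real^'n \<Rightarrow> real^'n) \<Rightarrow> ((real^'n) \<times> (real^'m) \<Rightarrow> real^'m) \<Rightarrow>
     ((real^'n) \<times> (real^'m) \<Rightarrow> (real^'n) \<times> (real^'m)) \<Rightarrow> bool" where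
  "state_input_transformation f A W \<Phi>x \<Phi>u \<Phi>hat \<longleftrightarrow>
     fst ` W \<subseteq> A \<and> f ` W \<subseteq> A \<and>
     (\<exists>\<Psi>x. diffeomorphism A (\<Phi>x ` A) \<Phi>x \<Psi>x) \<and>
     diffeomorphism W (extended_map \<Phi>x \<Phi>u ` W) (extended_map \<Phi>x \<Phi>u) \<Phi>hat"

definition transformed_system ::
  "((real^'n) \<times> (real^'m) \<Rightarrow> real^'n) \<Rightarrow> (real^'n \<Rightarrow> real^'n) \<Rightarrow>
     ((real^'n) \<times> (real^'m) \<Rightarrow> (real^'n) \<times> (real^'m)) \<Rightarrow> (real^'n) \<times> (real^'m) \<Rightarrow> real^'n" where
  "transformed_system f \<Phi>x \<Phi>hat = \<Phi>x \<circ> f \<circ> \<Phi>hat"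

text \<open>
  \<open>block I x\<close> is the subvector of \<open>x\<close> with the components in \<open>I\<close>. A splitting of the coordinates
  \<open>x = (x1, x2)\<close>, \<open>u = (u1, u2)\<close> is described by the index sets \<open>I2\<close>, \<open>J2\<close> of \<open>x2\<close>, \<open>u2\<close>;
  this also covers empty blocks.
  In \<open>triangular_form\<close> smoothness of \<open>f1\<close>, \<open>f2\<close> is inherited from \<open>g\<close> if \<open>W\<close> is open: locally
  \<open>f1\<close> is obtained from components of \<open>g\<close> by freezing \<open>u2\<close>.
\<close>

definition block :: "'n set \<Rightarrow> real^'n \<Rightarrow> 'n \<Rightarrow> real" where
  "block I x = restrict (\<lambda>i. x $ i) I"

definition triangular_form ::
  "'n set \<Rightarrow> 'm set \<Rightarrow> ((real^'n) \<times> (real^'m)) set \<Rightarrow> ((real^'n) \<times> (real^'m) \<Rightarrow> real^'n) \<Rightarrow> bool"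
  where
  "triangular_form I2 J2 W g \<longleftrightarrow>
     (\<exists>f1 f2. \<forall>(x, u)\<in>W.
        block (- I2) (g (x, u)) = f1 (block (- I2) x) (block I2 x) (block (- J2) u) \<and>
        block I2 (g (x, u)) = f2 (block (- I2) x) (block I2 x) (block (- J2) u) (block J2 u))"

end

theory Submission
  imports Defs
begin

text \<open>
  Write \<open>g = \<Phi>x \<circ> f\<close> for the map \<open>f\<close> read in new coordinates of the successor state. The theorem
  rests on the observation that, locally, a system is in triangular form iff \<open>dg\<close> maps the directions
  of \<open>u2\<close> into the directions of \<open>x2\<close>. Since \<open>\<partial>\<^sub>u f\<close> is injective and both blocks have dimension
  \<open>m2\<close>, it then maps them isomorphically. So the distribution \<open>D\<close> has to be the preimage, under the
  restriction of \<open>df\<close> to \<open>span {\<partial>\<^sub>u}\<close>, of the distribution on the state space that \<open>\<Phi>x\<close> straightens.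

  From the normal form to \<open>D\<close> (\<open>normal_form_imp_distribution\<close>): take for \<open>D\<close> the vectors \<open>(0, v)\<close>
  that \<open>dg\<close> maps into the coordinate subspace of \<open>x2\<close>. It is spanned by the fields \<open>v\<^sub>i\<close> with
  \<open>dg v\<^sub>i = e\<^sub>i\<close>, which are smooth because the inverse of a smooth family of matrices is smooth, and
  projectable because they are \<open>f\<close>-related to the coordinate fields of \<open>\<Phi>x\<close>. Involutivity follows
  from the symmetry of the second derivative of \<open>g\<close>: \<open>dg\<close> of a bracket is a combination of
  derivatives of functions with values in a fixed subspace.

  From \<open>D\<close> to the normal form (\<open>distribution_imp_normal_form\<close>): the projected fields span an
  involutive distribution near \<open>x0\<close>, of dimension \<open>m2\<close> because \<open>df\<close> is injective on \<open>span {\<partial>\<^sub>u}\<close>.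
  Frobenius' theorem (\<open>frobenius_chart\<close>) gives a chart \<open>\<Phi>x\<close> that straightens it. The new input is
  then a linear image \<open>S (g (x, u))\<close> of the new successor state, where \<open>S\<close> inverts \<open>\<partial>\<^sub>u g\<close> at the
  equilibrium up to coordinates of the input space adapted to \<open>D\<close>. With this choice the vectors in
  the directions of \<open>u2\<close> are exactly those of \<open>D\<close>, at every point near the equilibrium, and \<open>dg\<close>
  maps them into the directions of \<open>x2\<close>.

  Frobenius' theorem itself is proved by flows. The given frame is normalised so that a fixed
  linear projection maps it to constant fields; the normalised fields then commute. The joint flow
  \<open>G (y, z)\<close> of the linear family \<open>w\<^sub>y\<close> of commuting fields (\<open>commuting_frame_flow\<close>), started on a
  transversal, is the inverse of the chart.

  The analytic core is smooth dependence of flows on parameters. The flow satisfies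
  \<open>G (y, z) = x0 + z + \<integral> w\<^sub>y (G (s y, z)) ds\<close> with the integral over \<open>s\<close> from \<open>0\<close> to \<open>1\<close>. Such
  equations, in which the right-hand side evaluates \<open>G\<close> only at points scaled towards the origin and
  is a contraction for small \<open>y\<close>, form a class that is closed under differentiation: each partial
  derivative of \<open>G\<close> solves an equation of the same class, whose integrand is as smooth as \<open>G\<close> and
  the derivative of the original integrand. Hence all solutions are smooth
  (\<open>averaged_fixed_point_Ck\<close>). Without scaling and averaging the same lemma is the implicit function
  theorem, which yields smooth inverse functions and smooth inverse matrices.
\<close>

section \<open>Calculus of \<open>C\<^sup>k\<close> maps\<close>

lemma Ck_on_subset: "Ck_on k S f \<Longrightarrow> T \<subseteq> S \<Longrightarrow> Ck_on k T f"
  by (induction k arbitrary: f) (auto intro: continuous_on_subset)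

lemma frechet_derivative_cong_open:
  assumes "open S" "p \<in> S" "\<And>x. x \<in> S \<Longrightarrow> f x = g x"
  shows "frechet_derivative f (at p) = frechet_derivative g (at p)"
proof -
  have "(f has_derivative D) (at p) \<longleftrightarrow> (g has_derivative D) (at p)" for D
    using assms has_derivative_transform_within_open[OF _ assms(1,2)] by metis
  then show ?thesis unfolding frechet_derivative_def by simp
qed

lemma Ck_on_cong:
  assumes "open S" "\<And>x. x \<in> S \<Longrightarrow> f x = g x" "Ck_on k S f"
  shows "Ck_on k S g"
  using assms(2,3)
proof (induction k arbitrary: f g)
  case 0
  then show ?case by (metis Ck_on.simps(1) continuous_on_cong)
next
  case (Suc k)
  have "g differentiable (at p)" if "p \<in> S" for p
  proof -
    have "f differentiable (at p)" using Suc.prems(2) that by simp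
    then obtain D where "(f has_derivative D) (at p)" unfolding differentiable_def by blast
    then have "(g has_derivative D) (at p)"
      by (rule has_derivative_transform_within_open[OF _ assms(1) that Suc.prems(1)])
    then show ?thesis by (rule differentiableI)
  qed
  moreover have "Ck_on k S (\<lambda>p. frechet_derivative g (at p) v)" for v
    using Suc.IH[of "\<lambda>p. frechet_derivative f (at p) v" "\<lambda>p. frechet_derivative g (at p) v"]
      frechet_derivative_cong_open[OF assms(1), of _ f g] Suc.prems by auto
  ultimately show ?case by auto
qed

lemma Ck_on_SucD: "Ck_on (Suc k) S f \<Longrightarrow> Ck_on k S f"
proof (induction k arbitrary: f)
  case 0
  then show ?case
    by (auto intro!: continuous_at_imp_continuous_on differentiable_imp_continuous_within)
next
  case (Suc k)
  then show ?case by (metis Ck_on.simps(2))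
qed

lemma Ck_on_le: "Ck_on k S f \<Longrightarrow> j \<le> k \<Longrightarrow> Ck_on j S f"
  by (induction k) (use Ck_on_SucD le_Suc_eq in blast)+

lemma Ck_on_imp_continuous_on: "Ck_on k S f \<Longrightarrow> continuous_on S f"
  using Ck_on_le[of k S f 0] by simp

lemma frechet_derivative_apply_eq:
  "(f has_derivative D) (at x) \<Longrightarrow> frechet_derivative f (at x) h = D h"
  by (simp add: frechet_derivative_at[symmetric])

lemma Ck_on_has_derivative:
  "Ck_on (Suc k) S f \<Longrightarrow> p \<in> S \<Longrightarrow> (f has_derivative frechet_derivative f (at p)) (at p)"
  by (simp add: frechet_derivative_works[symmetric])

text \<open>
  Membership in \<open>C\<^sup>k\<close> is defined through the operator \<open>frechet_derivative\<close>; this rule allows any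
  derivative that has been computed by other means.
\<close>

lemma Ck_on_SucI:
  assumes "\<And>p. p \<in> S \<Longrightarrow> (f has_derivative f' p) (at p)"
    and "open S" "\<And>v. Ck_on k S (\<lambda>p. f' p v)"
  shows "Ck_on (Suc k) S f"
  unfolding Ck_on.simps
proof (intro conjI ballI allI)
  show "f differentiable at p" if "p \<in> S" for p using assms(1)[OF that] differentiableI by blast
  show "Ck_on k S (\<lambda>p. frechet_derivative f (at p) v)" for v
    by (rule Ck_on_cong[OF assms(2) _ assms(3)[of v]])
      (metis assms(1) frechet_derivative_at)
qed

lemma Ck_on_const: "Ck_on k S (\<lambda>x. c)"
  by (induction k arbitrary: c) auto

lemma Ck_on_bounded_linear:
  assumes "bounded_linear h" "open S" "Ck_on k S f"
  shows "Ck_on k S (\<lambda>x. h (f x))"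
  using assms(3)
proof (induction k arbitrary: f)
  case 0
  then show ?case using assms(1) by (simp add: bounded_linear.continuous_on)
next
  case (Suc k)
  show ?case
  proof (rule Ck_on_SucI[OF _ \<open>open S\<close>])
    show "((\<lambda>x. h (f x)) has_derivative (\<lambda>v. h (frechet_derivative f (at p) v))) (at p)" if "p \<in> S" for p
      using bounded_linear.has_derivative[OF assms(1) Ck_on_has_derivative[OF Suc.prems that]] .
    show "Ck_on k S (\<lambda>p. h (frechet_derivative f (at p) v))" for v
      using Suc by auto
  qed
qed

lemma Ck_on_id: "open S \<Longrightarrow> Ck_on k S (\<lambda>x. x)"
  by (cases k) (auto simp: Ck_on_const intro!: Ck_on_SucI has_derivative_ident)

lemma Ck_on_linear: "linear h \<Longrightarrow> open S \<Longrightarrow> Ck_on k S h"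
  using Ck_on_bounded_linear[OF _ _ Ck_on_id] linear_conv_bounded_linear by blast

lemma Ck_on_add:
  assumes "open S" "Ck_on k S f" "Ck_on k S g"
  shows "Ck_on k S (\<lambda>x. f x + g x)"
  using assms(2,3)
proof (induction k arbitrary: f g)
  case 0
  then show ?case by (simp add: continuous_on_add)
next
  case (Suc k)
  show ?case
    by (rule Ck_on_SucI[OF has_derivative_add[OF Ck_on_has_derivative[OF Suc.prems(1)] Ck_on_has_derivative[OF Suc.prems(2)]]])
      (use Suc assms(1) in auto)
qed

lemma Ck_on_sum:
  assumes "open S" "\<And>i. i \<in> I \<Longrightarrow> Ck_on k S (f i)"
  shows "Ck_on k S (\<lambda>x. \<Sum>i\<in>I. f i x)"
  using assms(2) by (induction I rule: infinite_finite_induct) (auto simp: Ck_on_const Ck_on_add assms(1))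

lemma Ck_on_minus: "open S \<Longrightarrow> Ck_on k S f \<Longrightarrow> Ck_on k S (\<lambda>x. - f x)"
  using Ck_on_bounded_linear[OF bounded_linear_minus[OF bounded_linear_ident]] by blast

lemma Ck_on_diff:
  assumes "open S" "Ck_on k S f" "Ck_on k S g"
  shows "Ck_on k S (\<lambda>x. f x - g x)"
  using Ck_on_add[OF assms(1,2) Ck_on_minus[OF assms(1,3)]] by simp

lemma Ck_on_bilinear:
  assumes "bounded_bilinear m" "open S" "Ck_on k S f" "Ck_on k S g"
  shows "Ck_on k S (\<lambda>x. m (f x) (g x))"
  using assms(3,4)
proof (induction k arbitrary: f g)
  case 0
  then show ?case by (simp add: bounded_bilinear.continuous_on[OF assms(1)])
next
  case (Suc k)
  have d: "Ck_on k S (\<lambda>p. frechet_derivative f (at p) v)" "Ck_on k S (\<lambda>p. frechet_derivative g (at p) v)" for v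
    using Suc.prems by simp_all
  show ?case
    by (rule Ck_on_SucI[OF bounded_bilinear.FDERIV[OF assms(1) Ck_on_has_derivative[OF Suc.prems(1)]
          Ck_on_has_derivative[OF Suc.prems(2)]]])
      (assumption | rule Ck_on_add Suc.IH assms d Suc.prems[THEN Ck_on_SucD])+
qed

lemmas Ck_on_scaleR = Ck_on_bilinear[OF bounded_bilinear_scaleR]
lemmas Ck_on_mult = Ck_on_bilinear[OF bounded_bilinear_mult]
lemmas Ck_on_inner = Ck_on_bilinear[OF bounded_bilinear_inner]
lemmas Ck_on_fst = Ck_on_bounded_linear[OF bounded_linear_fst]
lemmas Ck_on_snd = Ck_on_bounded_linear[OF bounded_linear_snd]

lemma Ck_on_Pair:
  assumes "open S" "Ck_on k S f" "Ck_on k S g"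
  shows "Ck_on k S (\<lambda>x. (f x, g x))"
proof -
  have "Ck_on k S (\<lambda>x. (f x, 0) + (0, g x))"
    by (intro Ck_on_add assms Ck_on_bounded_linear[of "\<lambda>y. (y, 0)"] Ck_on_bounded_linear[of "\<lambda>y. (0, y)"]
        bounded_linear_Pair bounded_linear_ident bounded_linear_zero)
  then show ?thesis by simp
qed

lemma linear_basis_expansion:
  fixes h :: "'a::euclidean_space \<Rightarrow> 'b::real_vector"
  assumes "linear h"
  shows "h x = (\<Sum>b\<in>Basis. (x \<bullet> b) *\<^sub>R h b)"
  by (metis (no_types, lifting) assms euclidean_representation linear_scale linear_sum sum.cong)

text \<open>
  By the chain rule the derivative of \<open>f \<circ> g\<close> in a direction is a combination of the partial
  derivatives of \<open>f\<close>, evaluated at \<open>g\<close>, with coefficients that are derivatives of \<open>g\<close>. Expanding in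
  a basis makes the induction hypothesis, which speaks of functions composed with \<open>g\<close>, applicable.
\<close>

lemma Ck_on_compose:
  fixes g :: "'a::euclidean_space \<Rightarrow> 'b::euclidean_space" and f :: "'b \<Rightarrow> 'c::real_normed_vector"
  assumes "open S" "open T" "Ck_on k S g" "Ck_on k T f" "g ` S \<subseteq> T"
  shows "Ck_on k S (\<lambda>x. f (g x))"
  using assms(3,4)
proof (induction k arbitrary: f)
  case 0
  then show ?case using assms(5) by (auto intro: continuous_on_compose2)
next
  case (Suc k)
  show ?case
  proof (rule Ck_on_SucI[OF _ \<open>open S\<close>])
    fix p assume p: "p \<in> S"
    then have f': "(f has_derivative frechet_derivative f (at (g p))) (at (g p))"
      using Ck_on_has_derivative[OF Suc.prems(2)] assms(5) by auto
    have lin: "frechet_derivative f (at (g p)) v =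
        (\<Sum>b\<in>Basis. (v \<bullet> b) *\<^sub>R frechet_derivative f (at (g p)) b)" for v
      by (rule linear_basis_expansion[OF has_derivative_linear[OF f']])
    show "((\<lambda>x. f (g x)) has_derivative
       (\<lambda>v. \<Sum>b\<in>Basis. (frechet_derivative g (at p) v \<bullet> b) *\<^sub>R frechet_derivative f (at (g p)) b)) (at p)"
      using has_derivative_compose[OF Ck_on_has_derivative[OF Suc.prems(1) p] f']
      by (subst (asm) lin)
  next
    fix v
    have "Ck_on k S (\<lambda>p. frechet_derivative g (at p) v)" using Suc.prems by simp
    moreover have "Ck_on k S (\<lambda>p. frechet_derivative f (at (g p)) b)" for b
      using Suc.IH[of "\<lambda>q. frechet_derivative f (at q) b"] Suc.prems Ck_on_SucD by auto
    ultimately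
    show "Ck_on k S (\<lambda>p. \<Sum>b\<in>Basis. (frechet_derivative g (at p) v \<bullet> b) *\<^sub>R frechet_derivative f (at (g p)) b)"
      by (intro Ck_on_sum Ck_on_scaleR Ck_on_inner assms(1) Ck_on_const)
  qed
qed

lemma Ck_on_sin_cos:
  fixes a :: real
  shows "Ck_on k UNIV (\<lambda>t. sin (a * t)) \<and> Ck_on k UNIV (\<lambda>t. cos (a * t))"
proof (induction k)
  case 0
  show ?case by (auto intro!: continuous_intros)
next
  case (Suc k)
  have "Ck_on (Suc k) UNIV (\<lambda>t. sin (a * t))"
    by (rule Ck_on_SucI[where f' = "\<lambda>t h. (a * cos (a * t)) * h"])
      (auto intro!: derivative_eq_intros Ck_on_mult Ck_on_const Suc.IH[THEN conjunct2])
  moreover have "Ck_on (Suc k) UNIV (\<lambda>t. cos (a * t))"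
    by (rule Ck_on_SucI[where f' = "\<lambda>t h. (- a * sin (a * t)) * h"])
      (auto intro!: derivative_eq_intros Ck_on_mult Ck_on_const Ck_on_minus Suc.IH[THEN conjunct1])
  ultimately show ?case ..
qed

lemma smooth_on_Ck: "smooth_on S f \<Longrightarrow> Ck_on k S f" by (simp add: smooth_on_def)

lemma smooth_on_subset: "smooth_on S f \<Longrightarrow> T \<subseteq> S \<Longrightarrow> smooth_on T f"
  by (auto simp: smooth_on_def intro: Ck_on_subset)

lemma smooth_on_compose:
  fixes g :: "'a::euclidean_space \<Rightarrow> 'b::euclidean_space" and f :: "'b \<Rightarrow> 'c::real_normed_vector"
  assumes "smooth_on S g" "smooth_on T f" "open S" "open T" "g ` S \<subseteq> T"
  shows "smooth_on S (\<lambda>x. f (g x))"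
  using Ck_on_compose[OF assms(3,4) assms(1,2)[unfolded smooth_on_def, rule_format] assms(5)]
  unfolding smooth_on_def by (rule allI)

lemma smooth_on_has_derivative:
  "smooth_on S f \<Longrightarrow> p \<in> S \<Longrightarrow> (f has_derivative frechet_derivative f (at p)) (at p)"
  using Ck_on_has_derivative smooth_on_def by blast

lemma smooth_on_frechet_derivative:
  "smooth_on S f \<Longrightarrow> smooth_on S (\<lambda>p. frechet_derivative f (at p) v)"
  unfolding smooth_on_def using Ck_on.simps(2) by blast

lemma smooth_on_const: "smooth_on S (\<lambda>x. c)"
  by (simp add: smooth_on_def Ck_on_const)

section \<open>Averaged fixed-point equations\<close>

text \<open>
  Any bound can be replaced by its half plus a constant; iterating this, the bounds converge to
  twice the constant. All contraction estimates below are obtained in this way, so that no suprema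
  occur in them. The weight \<open>\<psi>\<close> allows estimates that are homogeneous in an increment.
\<close>

lemma halving_bound:
  fixes \<phi> \<psi> :: "'x \<Rightarrow> real"
  assumes "0 \<le> B0" "0 \<le> c" "\<And>x. x \<in> X \<Longrightarrow> \<phi> x \<le> B0 * \<psi> x"
    and step: "\<And>B x. 0 \<le> B \<Longrightarrow> (\<And>y. y \<in> X \<Longrightarrow> \<phi> y \<le> B * \<psi> y) \<Longrightarrow> x \<in> X \<Longrightarrow> \<phi> x \<le> (B / 2 + c) * \<psi> x"
    and "x \<in> X"
  shows "\<phi> x \<le> 2 * c * \<psi> x"
proof -
  define B where "B n = 2 * c + (B0 - 2 * c) * (1 / 2) ^ n" for n
  have "0 \<le> B n \<and> (\<forall>x\<in>X. \<phi> x \<le> B n * \<psi> x)" for n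
  proof (induction n)
    case 0
    then show ?case using assms by (simp add: B_def)
  next
    case (Suc n)
    have eq: "B (Suc n) = B n / 2 + c" by (simp add: B_def field_simps)
    then show ?case using Suc step[of "B n"] assms(2) by auto
  qed
  then have le: "\<phi> x \<le> B n * \<psi> x" for n using assms(5) by auto
  have "B \<longlonglongrightarrow> 2 * c + (B0 - 2 * c) * 0"
    unfolding B_def by (intro tendsto_intros LIMSEQ_power_zero) auto
  then have "(\<lambda>n. B n * \<psi> x) \<longlonglongrightarrow> 2 * c * \<psi> x" by (intro tendsto_mult) auto
  then show ?thesis using le LIMSEQ_le_const by blast
qed

lemma Ck_on_blinfun_derivative:
  fixes F :: "'a::euclidean_space \<Rightarrow> 'b::euclidean_space"
  assumes "Ck_on (Suc 0) S F"
  obtains F' where "continuous_on S F'"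
    "\<And>x. x \<in> S \<Longrightarrow> (F has_derivative blinfun_apply (F' x)) (at x)"
    "\<And>x. x \<in> S \<Longrightarrow> blinfun_apply (F' x) = frechet_derivative F (at x)"
proof
  let ?F' = "\<lambda>x. Blinfun (frechet_derivative F (at x))"
  have D: "(F has_derivative frechet_derivative F (at x)) (at x)" if "x \<in> S" for x
    using Ck_on_has_derivative[OF assms that] .
  then show eq: "\<And>x. x \<in> S \<Longrightarrow> blinfun_apply (?F' x) = frechet_derivative F (at x)"
    by (intro bounded_linear_Blinfun_apply has_derivative_bounded_linear)
  then show "\<And>x. x \<in> S \<Longrightarrow> (F has_derivative blinfun_apply (?F' x)) (at x)"
    using D by simp
  have "continuous_on S (\<lambda>x. blinfun_apply (?F' x) i)" for i
    using assms eq by (simp cong: continuous_on_cong)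
  then show "continuous_on S ?F'" by (rule continuous_on_blinfun_componentwise)
qed

text \<open>
  The derivative is uniformly continuous on a compact neighbourhood of \<open>M\<close>, so the mean value
  inequality gives the same remainder estimate at all points of \<open>M\<close>.
\<close>

lemma uniformly_differentiable_on_compact:
  fixes F :: "'a::euclidean_space \<Rightarrow> 'b::euclidean_space"
  assumes "open S" "compact M" "M \<subseteq> S" "continuous_on S F'" "0 < e"
    and F': "\<And>x. x \<in> S \<Longrightarrow> (F has_derivative blinfun_apply (F' x)) (at x)"
  obtains d where "0 < d"
    "\<And>x h. x \<in> M \<Longrightarrow> norm h \<le> d \<Longrightarrow> norm (F (x + h) - F x - blinfun_apply (F' x) h) \<le> e * norm h"
proof (cases "M = {}")
  case True
  then show ?thesis using that[of 1] by auto
next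
  case False
  obtain d0 where d0: "0 < d0" "(\<Union>x\<in>M. cball x d0) \<subseteq> S"
    using compact_subset_open_imp_cball_epsilon_subset[OF assms(2,1,3)] by blast
  define M' where "M' = (\<Union>x\<in>M. \<Union>h\<in>cball 0 d0. {x + h})"
  have "compact M'" unfolding M'_def
    by (rule compact_sums'[OF assms(2)]) simp
  have "M' \<subseteq> S" using d0 unfolding M'_def by (fastforce simp: dist_norm)
  then have "uniformly_continuous_on M' F'"
    using \<open>compact M'\<close> assms(4) compact_uniformly_continuous continuous_on_subset by blast
  then obtain d1 where d1: "0 < d1" "\<And>x y. x \<in> M' \<Longrightarrow> y \<in> M' \<Longrightarrow> dist y x < d1 \<Longrightarrow> dist (F' y) (F' x) < e"
    unfolding uniformly_continuous_on_def using \<open>0 < e\<close> by metis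
  define d where "d = min d0 (d1 / 2)"
  show ?thesis
  proof (rule that)
    show "0 < d" using d0 d1 by (simp add: d_def)
    fix x h :: 'a assume x: "x \<in> M" and h: "norm h \<le> d"
    have inM: "y \<in> M'" if "y \<in> cball x d" for y
    proof -
      have "y - x \<in> cball 0 d0" using that by (simp add: d_def dist_norm norm_minus_commute)
      moreover have "y = x + (y - x)" by simp
      ultimately show ?thesis unfolding M'_def using x by blast
    qed
    have "norm (F (x + h) - F x - blinfun_apply (F' x) ((x + h) - x)) \<le> norm ((x + h) - x) * e"
    proof (rule differentiable_bound_linearization[where S = "cball x d"])
      show "x + t *\<^sub>R ((x + h) - x) \<in> cball x d" if "t \<in> {0..1}" for t
        using that h mult_left_le_one_le[of "norm h" t] by (auto simp: dist_norm)
      show "(F has_derivative blinfun_apply (F' y)) (at y within cball x d)" if "y \<in> cball x d" for y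
        by (rule has_derivative_at_withinI[OF F'[OF subsetD[OF \<open>M' \<subseteq> S\<close> inM[OF that]]]])
      show "onorm (blinfun_apply (F' y) - blinfun_apply (F' x)) \<le> e" if "y \<in> cball x d" for y
      proof -
        have "dist y x < d1" using that d1(1) by (simp add: d_def dist_commute)
        then have "norm (F' y - F' x) \<le> e"
          using d1(2)[of x y] inM[OF that] inM[of x] \<open>0 < d\<close> by (simp add: dist_norm)
        then show ?thesis
          by (simp add: norm_blinfun.rep_eq minus_blinfun.rep_eq fun_diff_def)
      qed
      show "x \<in> cball x d" using \<open>0 < d\<close> by simp
    qed
    then show "norm (F (x + h) - F x - blinfun_apply (F' x) h) \<le> e * norm h"
      by (simp add: mult.commute)
  qed
qed

lemma lipschitz_imp_derivative_bound:
  fixes f :: "'a::real_normed_vector \<Rightarrow> 'b::real_normed_vector"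
  assumes D: "(f has_derivative f') (at x)" and "open S" "x \<in> S"
    and L: "\<And>y. y \<in> S \<Longrightarrow> norm (f y - f x) \<le> L * norm (y - x)"
  shows "norm (f' v) \<le> L * norm v"
proof (cases "v = 0")
  case True
  then show ?thesis using linear_0[OF has_derivative_linear[OF D]] by simp
next
  case False
  have lin: "linear f'" using has_derivative_linear[OF D] .
  have "norm (f' v) \<le> L * norm v + \<epsilon>" if "0 < \<epsilon>" for \<epsilon>
  proof -
    define \<epsilon>' where "\<epsilon>' = \<epsilon> / norm v"
    have "0 < \<epsilon>'" using that False by (simp add: \<epsilon>'_def)
    then obtain d where d: "0 < d"
      "\<And>y. norm (y - x) < d \<Longrightarrow> norm (f y - f x - f' (y - x)) \<le> \<epsilon>' * norm (y - x)"
      using D unfolding has_derivative_at_alt by blast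
    obtain d' where d': "0 < d'" "ball x d' \<subseteq> S" using assms(2,3) openE by blast
    define s where "s = min d d' / (2 * norm v)"
    have s: "0 < s" using d d' False by (simp add: s_def)
    have n: "norm ((x + s *\<^sub>R v) - x) = min d d' / 2" using s False d d' by (simp add: s_def)
    then have "x + s *\<^sub>R v \<in> S" using d' d by (auto simp: dist_norm subset_iff)
    have "norm (f' (s *\<^sub>R v)) \<le> norm (f (x + s *\<^sub>R v) - f x) + norm (f (x + s *\<^sub>R v) - f x - f' (s *\<^sub>R v))"
      by (metis norm_minus_commute norm_triangle_sub)
    also have "\<dots> \<le> L * norm (s *\<^sub>R v) + \<epsilon>' * norm (s *\<^sub>R v)"
      using L[OF \<open>x + s *\<^sub>R v \<in> S\<close>] d(2)[of "x + s *\<^sub>R v"] n d(1) d'(1) by (intro add_mono) auto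
    finally have "s * norm (f' v) \<le> s * (L * norm v + \<epsilon>)"
      using s False by (simp add: linear_scale[OF lin] \<epsilon>'_def algebra_simps)
    then show ?thesis using s by simp
  qed
  then show ?thesis by (rule field_le_epsilon)
qed

lemma integral_unit_bound:
  fixes f :: "real \<Rightarrow> 'b::euclidean_space"
  assumes "continuous_on {0..1} f" "\<And>t. t \<in> {0..1} \<Longrightarrow> norm (f t) \<le> B"
  shows "norm (integral {0..1} f) \<le> B"
  using integral_bound[of 0 1 f B] assms by simp

text \<open>
  The family of maps through which an unknown function may enter its own fixed-point equation. They
  are diagonal, so that a partial derivative of \<open>p \<mapsto> G (\<sigma> t p)\<close> is a multiple of the same partial
  derivative of \<open>G\<close> and the equations for the partial derivatives decouple. They do not increase
  the norm, so balls around the origin are mapped into themselves. The time parameter ranges over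
  all reals, so that \<open>(t, p) \<mapsto> G (\<sigma> t p)\<close> lives on an open set and falls under the calculus above.
\<close>

locale diagonal_contraction =
  fixes c :: "'p::euclidean_space \<Rightarrow> real \<Rightarrow> real"
  assumes c_smooth: "b \<in> Basis \<Longrightarrow> smooth_on UNIV (c b)"
    and c_le_1: "b \<in> Basis \<Longrightarrow> \<bar>c b t\<bar> \<le> 1"
begin

definition \<sigma> :: "real \<Rightarrow> 'p \<Rightarrow> 'p" where
  "\<sigma> t p = (\<Sum>b\<in>Basis. (c b t * (p \<bullet> b)) *\<^sub>R b)"

lemma \<sigma>_inner: "b \<in> Basis \<Longrightarrow> \<sigma> t p \<bullet> b = c b t * (p \<bullet> b)"
  unfolding \<sigma>_def by simp

lemma norm_\<sigma>_le: "norm (\<sigma> t p) \<le> norm p"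
  by (rule norm_le_componentwise)
    (auto simp: \<sigma>_inner abs_mult intro!: mult_left_le_one_le c_le_1)

lemma \<sigma>_add: "\<sigma> t (p + q) = \<sigma> t p + \<sigma> t q"
  unfolding \<sigma>_def by (simp add: inner_add_left distrib_left scaleR_add_left sum.distrib)

lemma Ck_on_\<sigma>: "Ck_on k UNIV (\<lambda>X. \<sigma> (fst X) (snd X))"
  unfolding \<sigma>_def
proof (intro Ck_on_sum Ck_on_scaleR Ck_on_mult Ck_on_inner Ck_on_const Ck_on_snd Ck_on_id open_UNIV)
  fix b :: 'p assume "b \<in> Basis"
  then show "Ck_on k UNIV (\<lambda>x::real \<times> 'p. c b (fst x))"
    using Ck_on_compose[OF open_UNIV open_UNIV Ck_on_fst[OF open_UNIV Ck_on_id[OF open_UNIV]] smooth_on_Ck[OF c_smooth]]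
    by simp
qed

lemma continuous_on_\<sigma> [continuous_intros]:
  assumes "continuous_on S f" "continuous_on S g"
  shows "continuous_on S (\<lambda>x. \<sigma> (f x) (g x))"
  using continuous_on_compose2[OF Ck_on_imp_continuous_on[OF Ck_on_\<sigma>] continuous_on_Pair[OF assms]]
  by simp

lemma \<sigma>_in_cball: "p \<in> cball 0 r \<Longrightarrow> \<sigma> t p \<in> cball 0 r"
  using norm_\<sigma>_le[of t p] by simp

lemma \<sigma>_in_ball: "p \<in> ball 0 r \<Longrightarrow> \<sigma> t p \<in> ball 0 r"
  using norm_\<sigma>_le[of t p] by simp

text \<open>
  Banach's fixed-point theorem in the space of bounded continuous functions on the whole space; the
  closest-point projection onto the ball extends the equation to all arguments.
\<close>

lemma averaged_fixed_point_exists: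
  fixes F :: "real \<times> 'p \<times> 'e \<Rightarrow> 'e::euclidean_space"
  assumes "0 \<le> r" "0 \<le> \<rho>"
    and F: "continuous_on ({0..1} \<times> cball 0 r \<times> cball e0 \<rho>) F"
    and lip: "\<And>t p e e'. t \<in> {0..1} \<Longrightarrow> p \<in> cball 0 r \<Longrightarrow> e \<in> cball e0 \<rho> \<Longrightarrow> e' \<in> cball e0 \<rho> \<Longrightarrow>
      norm (F (t, p, e) - F (t, p, e')) \<le> norm (e - e') / 2"
    and bound: "\<And>t p e. t \<in> {0..1} \<Longrightarrow> p \<in> cball 0 r \<Longrightarrow> e \<in> cball e0 \<rho> \<Longrightarrow> F (t, p, e) \<in> cball e0 \<rho>"
  obtains G where "continuous_on (cball 0 r) G" "G ` cball 0 r \<subseteq> cball e0 \<rho>"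
    "\<And>p. p \<in> cball 0 r \<Longrightarrow> G p = integral {0..1} (\<lambda>t. F (t, p, G (\<sigma> t p)))"
proof -
  define cp :: "'p \<Rightarrow> 'p" where "cp = closest_point (cball 0 r)"
  have cp: "cp p \<in> cball 0 r" "p \<in> cball 0 r \<Longrightarrow> cp p = p" for p
    unfolding cp_def
    using closest_point_in_set[OF closed_cball, of 0 r p] closest_point_self[of p "cball 0 r"] \<open>0 \<le> r\<close>
    by (simp_all only: cball_eq_empty not_less simp_thms)
  have cp_cont: "continuous_on UNIV cp"
    unfolding cp_def using \<open>0 \<le> r\<close> by (intro continuous_on_closest_point) auto
  define S where "S = (PiC UNIV (\<lambda>_. cball e0 \<rho>) :: ('p \<Rightarrow>\<^sub>C 'e) set)"
  define Q where "Q g t p = F (t, cp p, apply_bcontfun g (\<sigma> t (cp p)))" for g t p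
  define T where "T g = Bcontfun (\<lambda>p. integral {0..1} (\<lambda>t. Q g t p))" for g
  have S_iff: "g \<in> S \<longleftrightarrow> (\<forall>x. apply_bcontfun g x \<in> cball e0 \<rho>)" for g
    unfolding S_def mem_PiC_iff by (auto simp del: mem_cball)
  then have gS: "apply_bcontfun g x \<in> cball e0 \<rho>" if "g \<in> S" for g x
    using that by blast
  have contQ: "continuous_on (UNIV \<times> {0..1}) (\<lambda>(p, t). Q g t p)" if "g \<in> S" for g
    unfolding Q_def case_prod_beta
    by (intro continuous_on_compose2[OF F] continuous_intros
        continuous_on_compose2[OF cp_cont] continuous_on_compose2[OF continuous_on_apply_bcontfun[of UNIV]])
      (use gS[OF that] cp(1) in \<open>auto simp del: mem_cball\<close>)
  have contQ': "continuous_on {0..1} (\<lambda>t. Q g t p)" if "g \<in> S" for g p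
  proof -
    have "continuous_on {0..1} (\<lambda>t. (case (p, t) of (p, t) \<Rightarrow> Q g t p))"
      by (rule continuous_on_compose2[OF contQ[OF that]]) (auto intro!: continuous_intros)
    then show ?thesis by simp
  qed
  have QS: "Q g t p \<in> cball e0 \<rho>" if "g \<in> S" "t \<in> {0..1}" for g t p
    unfolding Q_def by (intro bound gS that cp)
  have intQ: "integral {0..1} (\<lambda>t. Q g t p) \<in> cball e0 \<rho>" if "g \<in> S" for g p
  proof -
    have "norm (integral {0..1} (\<lambda>t. Q g t p - e0)) \<le> \<rho>"
      using QS[OF that]
      by (intro integral_unit_bound continuous_intros contQ' that) (auto simp: dist_norm norm_minus_commute)
    moreover have "integral {0..1} (\<lambda>t. Q g t p - e0) = integral {0..1} (\<lambda>t. Q g t p) - e0"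
      using integral_diff[OF integrable_continuous_interval[OF contQ'[OF that]] integrable_const_ivl, of p e0]
      by simp
    ultimately show ?thesis by (simp add: dist_norm norm_minus_commute)
  qed
  have T_apply: "apply_bcontfun (T g) p = integral {0..1} (\<lambda>t. Q g t p)" if "g \<in> S" for g p
  proof -
    have "continuous_on UNIV (\<lambda>p. integral (cbox 0 1) (\<lambda>t. Q g t p))"
      by (rule integral_continuous_on_param) (use contQ[OF that] in simp)
    moreover have "bounded (range (\<lambda>p. integral {0..1} (\<lambda>t. Q g t p)))"
      using intQ[OF that] by (meson bounded_cball bounded_subset image_subsetI)
    ultimately have "(\<lambda>p. integral {0..1} (\<lambda>t. Q g t p)) \<in> bcontfun"
      unfolding bcontfun_def by simp
    then show ?thesis unfolding T_def by (simp add: Bcontfun_inverse)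
  qed
  have "\<exists>!g\<in>S. T g = g"
  proof (rule Banach_fix[where c = "1/2"])
    show "complete S" unfolding S_def
      by (intro complete_eq_closed[THEN iffD2] closed_PiC) simp
    have "const_bcontfun e0 \<in> S" unfolding S_iff using \<open>0 \<le> \<rho>\<close>
      by (auto simp: const_bcontfun.rep_eq)
    then show "S \<noteq> {}" by auto
    show "T ` S \<subseteq> S"
    proof safe
      fix g assume "g \<in> S"
      then show "T g \<in> S" unfolding S_iff[of "T g"] using intQ T_apply by metis
    qed
    fix g h assume gh: "g \<in> S" "h \<in> S"
    show "dist (T g) (T h) \<le> 1/2 * dist g h"
    proof (rule dist_bound)
      fix p
      have "apply_bcontfun (T g) p - apply_bcontfun (T h) p = integral {0..1} (\<lambda>t. Q g t p - Q h t p)"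
        unfolding T_apply[OF gh(1)] T_apply[OF gh(2)]
        by (intro integral_diff[symmetric] integrable_continuous_interval contQ' gh)
      also have "norm \<dots> \<le> 1/2 * dist g h"
      proof (intro integral_unit_bound continuous_intros contQ' gh)
        fix t :: real assume t: "t \<in> {0..1}"
        have "norm (Q g t p - Q h t p) \<le> norm (apply_bcontfun g (\<sigma> t (cp p)) - apply_bcontfun h (\<sigma> t (cp p))) / 2"
          unfolding Q_def by (intro lip t cp gS gh)
        also have "\<dots> \<le> 1/2 * dist g h" using dist_bounded[of g _ h] by (simp add: dist_norm)
        finally show "norm (Q g t p - Q h t p) \<le> 1/2 * dist g h" .
      qed
      finally show "dist (apply_bcontfun (T g) p) (apply_bcontfun (T h) p) \<le> 1/2 * dist g h"
        by (simp add: dist_norm)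
    qed
  qed auto
  then obtain g where g: "g \<in> S" "T g = g" by blast
  show ?thesis
  proof
    show "continuous_on (cball 0 r) (apply_bcontfun g)" by simp
    show "apply_bcontfun g ` cball 0 r \<subseteq> cball e0 \<rho>" using gS[OF g(1)] by (auto simp del: mem_cball)
    show "apply_bcontfun g p = integral {0..1} (\<lambda>t. F (t, p, apply_bcontfun g (\<sigma> t p)))" if "p \<in> cball 0 r" for p
      using T_apply[OF g(1), of p] cp(2)[OF that] g(2) unfolding Q_def by simp
  qed
qed

text \<open>
  Formal differentiation of the equation gives linear equations of the same kind for the partial
  derivatives, and these have continuous solutions \<open>\<eta> b\<close>. To see that they are indeed the
  derivatives of \<open>G\<close>, both the increment of \<open>G\<close> and its remainder after subtraction of the candidate
  are estimated by the equations themselves: half of each estimate comes back through the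
  contraction, and \<open>halving_bound\<close> removes it.
\<close>

lemma averaged_fixed_point_C1:
  fixes F :: "real \<times> 'p \<times> 'e \<Rightarrow> 'e::euclidean_space"
  assumes "0 \<le> r" "r < R" "open E"
    and F: "Ck_on (Suc 0) (UNIV \<times> ball 0 R \<times> E) F"
    and lip: "\<And>t p e e'. t \<in> {0..1} \<Longrightarrow> p \<in> ball 0 R \<Longrightarrow> e \<in> E \<Longrightarrow> e' \<in> E \<Longrightarrow>
      norm (F (t, p, e) - F (t, p, e')) \<le> norm (e - e') / 2"
    and G: "continuous_on (ball 0 R) G" "G ` ball 0 R \<subseteq> E"
    and fixed: "\<And>p. p \<in> ball 0 R \<Longrightarrow> G p = integral {0..1} (\<lambda>t. F (t, p, G (\<sigma> t p)))"
  obtains \<eta> where "\<And>b. b \<in> Basis \<Longrightarrow> continuous_on (cball 0 r) (\<eta> b)"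
    "\<And>p. p \<in> ball 0 r \<Longrightarrow> (G has_derivative (\<lambda>h. \<Sum>b\<in>Basis. (h \<bullet> b) *\<^sub>R \<eta> b p)) (at p)"
    "\<And>b p. b \<in> Basis \<Longrightarrow> p \<in> cball 0 r \<Longrightarrow> \<eta> b p = integral {0..1} (\<lambda>t.
        frechet_derivative F (at (t, p, G (\<sigma> t p))) (0, b, c b t *\<^sub>R \<eta> b (\<sigma> t p)))"
proof -
  define K where "K = cball (0::'p) r"
  define S where "S = (UNIV :: real set) \<times> ball (0::'p) R \<times> E"
  have "open S" unfolding S_def using \<open>open E\<close> by (intro open_Times) auto
  have K: "compact K" "convex K" "K \<subseteq> ball 0 R" "0 \<in> K"
    using assms(1,2) unfolding K_def by (auto simp: cball_subset_ball_iff)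
  have \<sigma>K: "\<sigma> t p \<in> K" if "p \<in> K" for t p
    using that unfolding K_def by (rule \<sigma>_in_cball)
  have GK: "continuous_on K G" "G ` K \<subseteq> E" using G K(3) continuous_on_subset by blast+
  obtain F' where F'_cont: "continuous_on S F'"
    and F': "\<And>x. x \<in> S \<Longrightarrow> (F has_derivative blinfun_apply (F' x)) (at x)"
      "\<And>x. x \<in> S \<Longrightarrow> blinfun_apply (F' x) = frechet_derivative F (at x)"
    using Ck_on_blinfun_derivative[OF F[folded S_def]] by blast
  define M where "M = {0..1::real} \<times> K \<times> G ` K"
  have M: "compact M" "M \<subseteq> S"
    unfolding M_def S_def using K GK by (auto intro!: compact_Times compact_continuous_image)
  define X where "X t p = (t, p, G (\<sigma> t p))" for t p
  have XM: "X t p \<in> M" if "t \<in> {0..1}" "p \<in> K" for t p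
    unfolding X_def M_def using that \<sigma>K by auto
  have XS: "X t p \<in> S" if "t \<in> {0..1}" "p \<in> K" for t p
    using XM[OF that] M by auto
  have contG: "continuous_on ({0..1} \<times> K) (\<lambda>x. G (\<sigma> (fst x) (snd x)))"
    by (rule continuous_on_compose2[OF GK(1)]) (auto intro!: continuous_intros \<sigma>K)
  have contX: "continuous_on ({0..1} \<times> K) (\<lambda>x. X (fst x) (snd x))"
    unfolding X_def by (intro continuous_intros contG)
  have contX': "continuous_on ({0..1} \<times> K) (\<lambda>x. F' (X (fst x) (snd x)))"
    by (rule continuous_on_compose2[OF F'_cont contX]) (use XS in auto)
  have contF: "continuous_on S F" using Ck_on_imp_continuous_on[OF F] by (simp add: S_def)
  have contXt: "continuous_on {0..1} (\<lambda>t. X t p)" "continuous_on {0..1} (\<lambda>t. F' (X t p))"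
    "continuous_on {0..1} (\<lambda>t. F (X t p))" if "p \<in> K" for p
  proof -
    show *: "continuous_on {0..1} (\<lambda>t. X t p)"
    proof -
      have "continuous_on {0..1} (\<lambda>t. X (fst (t, p)) (snd (t, p)))"
        by (rule continuous_on_compose2[OF contX]) (use that in \<open>auto intro!: continuous_intros\<close>)
      then show ?thesis by simp
    qed
    show "continuous_on {0..1} (\<lambda>t. F' (X t p))" "continuous_on {0..1} (\<lambda>t. F (X t p))"
      using XS that by (auto intro!: continuous_on_compose2[OF F'_cont *] continuous_on_compose2[OF contF *])
  qed
  have De: "norm (F' (X t p) (0, 0, e)) \<le> norm e / 2" if tp: "t \<in> {0..1}" "p \<in> K" for t p e
  proof -
    have GE: "G (\<sigma> t p) \<in> E" using GK(2) \<sigma>K[OF tp(2)] by auto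
    have "((\<lambda>e. (t, p, e)) has_derivative (\<lambda>h. (0, 0, h))) (at (G (\<sigma> t p)))"
      by (intro has_derivative_Pair has_derivative_const has_derivative_ident)
    then have "((\<lambda>e. F (t, p, e)) has_derivative (\<lambda>h. F' (X t p) (0, 0, h))) (at (G (\<sigma> t p)))"
      by (rule has_derivative_compose) (use F'(1)[OF XS[OF tp]] in \<open>simp add: X_def\<close>)
    then show ?thesis
      using lipschitz_imp_derivative_bound[OF _ \<open>open E\<close> GE, of "\<lambda>e. F (t, p, e)" _ "1/2" e]
        lip[OF tp(1), of p _ "G (\<sigma> t p)"] K(3) tp(2) GE by (auto simp: subset_iff)
  qed
  \<comment> \<open>the candidates for the partial derivatives\<close>
  have "\<exists>\<eta>. continuous_on K \<eta> \<and> (\<forall>p\<in>K. \<eta> p = integral {0..1} (\<lambda>t. F' (X t p) (0, b, c b t *\<^sub>R \<eta> (\<sigma> t p))))"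
    if b: "b \<in> Basis" for b
  proof -
    have "compact ((\<lambda>x. F' (X (fst x) (snd x)) (0, b, 0)) ` ({0..1} \<times> K))"
      by (intro compact_continuous_image compact_Times K(1) compact_Icc blinfun.continuous_on contX' continuous_on_const)
    then obtain B where B: "0 < B" "\<And>t p. t \<in> {0..1} \<Longrightarrow> p \<in> K \<Longrightarrow> norm (F' (X t p) (0, b, 0)) \<le> B"
      using compact_imp_bounded[THEN bounded_pos[THEN iffD1]] by force
    define H where "H = (\<lambda>(t, p, e). F' (X t p) (0, b, c b t *\<^sub>R e))"
    have split: "F' Y (0, b, e) = F' Y (0, b, 0) + F' Y (0, 0, e)" for Y and e :: 'e
      by (simp flip: blinfun.add_right)
    have ce: "norm (F' (X t p) (0, 0, c b t *\<^sub>R e)) \<le> norm e / 2" if "t \<in> {0..1}" "p \<in> K" for t p e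
      using De[OF that, of "c b t *\<^sub>R e"] mult_left_le_one_le[of "norm e" "\<bar>c b t\<bar>"] c_le_1[OF b, of t] by simp
    show ?thesis
    proof (rule averaged_fixed_point_exists[where F = H and r = r and ?e0.0 = 0 and \<rho> = "2 * B"])
      have "continuous_on ({0..1} \<times> K \<times> cball (0::'e) (2 * B)) (\<lambda>x. F' (X (fst x) (fst (snd x))))"
      proof -
        have "continuous_on ({0..1} \<times> K \<times> cball (0::'e) (2 * B))
            (\<lambda>x. F' (X (fst (fst x, fst (snd x))) (snd (fst x, fst (snd x)))))"
          by (rule continuous_on_compose2[OF contX']) (auto intro!: continuous_intros)
        then show ?thesis by simp
      qed
      moreover have "continuous_on ({0..1} \<times> K \<times> cball (0::'e) (2 * B)) (\<lambda>x. c b (fst x))"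
        using continuous_on_compose2[OF Ck_on_imp_continuous_on[OF smooth_on_Ck[OF c_smooth[OF b]]]]
          continuous_on_fst[OF continuous_on_id] by blast
      ultimately show "continuous_on ({0..1} \<times> cball 0 r \<times> cball 0 (2 * B)) H"
        unfolding H_def case_prod_beta K_def[symmetric]
        by (intro blinfun.continuous_on continuous_intros) auto
    next
      fix t and p :: 'p and e e' :: 'e assume tp: "t \<in> {0..1::real}" "p \<in> cball 0 r"
      have "H (t, p, e) - H (t, p, e') = F' (X t p) (0, 0, c b t *\<^sub>R (e - e'))"
        unfolding H_def by (simp flip: blinfun.diff_right add: scaleR_diff_right)
      then show "norm (H (t, p, e) - H (t, p, e')) \<le> norm (e - e') / 2"
        using ce tp by (simp add: K_def)
    next
      fix t and p :: 'p and e :: 'e assume tp: "t \<in> {0..1::real}" "p \<in> cball 0 r" and e: "e \<in> cball 0 (2 * B)"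
      have "norm (H (t, p, e)) \<le> norm (F' (X t p) (0, b, 0)) + norm (F' (X t p) (0, 0, c b t *\<^sub>R e))"
        unfolding H_def prod.case by (subst split) (rule norm_triangle_ineq)
      also have "\<dots> \<le> B + norm e / 2" using B(2)[OF tp(1)] ce[OF tp(1)] tp(2) by (intro add_mono) (auto simp: K_def)
      also have "\<dots> \<le> 2 * B" using e by simp
      finally show "H (t, p, e) \<in> cball 0 (2 * B)" by simp
    next
      fix \<eta> assume "continuous_on (cball 0 r) \<eta>"
        "\<And>p. p \<in> cball 0 r \<Longrightarrow> \<eta> p = integral {0..1} (\<lambda>t. H (t, p, \<eta> (\<sigma> t p)))"
      then show ?thesis unfolding K_def H_def by auto
    qed (use assms(1) B in auto)
  qed
  then have "\<exists>\<eta>. \<forall>b\<in>Basis. continuous_on K (\<eta> b) \<and>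
      (\<forall>p\<in>K. \<eta> b p = integral {0..1} (\<lambda>t. F' (X t p) (0, b, c b t *\<^sub>R \<eta> b (\<sigma> t p))))"
    by (intro bchoice ballI)
  then obtain \<eta> where "\<forall>b\<in>Basis. continuous_on K (\<eta> b) \<and>
      (\<forall>p\<in>K. \<eta> b p = integral {0..1} (\<lambda>t. F' (X t p) (0, b, c b t *\<^sub>R \<eta> b (\<sigma> t p))))" ..
  then have \<eta>_cont: "\<And>b. b \<in> Basis \<Longrightarrow> continuous_on K (\<eta> b)"
    and \<eta>: "\<And>b p. b \<in> Basis \<Longrightarrow> p \<in> K \<Longrightarrow>
      \<eta> b p = integral {0..1} (\<lambda>t. F' (X t p) (0, b, c b t *\<^sub>R \<eta> b (\<sigma> t p)))"
    by (auto dest: bspec)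
  define P where "P p h = (\<Sum>b\<in>Basis. (h \<bullet> b) *\<^sub>R \<eta> b p)" for p h
  have \<eta>\<sigma>_cont: "continuous_on {0..1} (\<lambda>t. \<eta> b (\<sigma> t p))" if "b \<in> Basis" "p \<in> K" for b p
    by (rule continuous_on_compose2[OF \<eta>_cont[OF that(1)]]) (auto intro!: continuous_intros \<sigma>K that)
  have P\<sigma>_cont: "continuous_on {0..1} (\<lambda>t. P (\<sigma> t p) (\<sigma> t h))" if "p \<in> K" for p h
    unfolding P_def by (intro continuous_intros \<eta>\<sigma>_cont that) auto
  have c_cont: "continuous_on {0..1} (c b)" if "b \<in> Basis" for b
    using Ck_on_imp_continuous_on[OF smooth_on_Ck[OF c_smooth[OF that]]] continuous_on_subset by blast
  have P_eq: "P p h = integral {0..1} (\<lambda>t. F' (X t p) (0, h, P (\<sigma> t p) (\<sigma> t h)))" if p: "p \<in> K" for p h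
  proof -
    let ?f = "\<lambda>b t. F' (X t p) (0, b, c b t *\<^sub>R \<eta> b (\<sigma> t p))"
    have int: "?f b integrable_on {0..1}" if "b \<in> Basis" for b
      by (intro integrable_continuous_interval blinfun.continuous_on contXt p continuous_on_Pair
          continuous_on_const continuous_on_scaleR c_cont \<eta>\<sigma>_cont that)
    have h_eq: "(0, h, P (\<sigma> t p) (\<sigma> t h)) =
        (\<Sum>b\<in>Basis. (h \<bullet> b) *\<^sub>R (0::real, b, c b t *\<^sub>R \<eta> b (\<sigma> t p)))" for t
    proof -
      have "P (\<sigma> t p) (\<sigma> t h) = (\<Sum>b\<in>Basis. (h \<bullet> b) *\<^sub>R (c b t *\<^sub>R \<eta> b (\<sigma> t p)))"
        unfolding P_def by (rule sum.cong) (simp_all add: \<sigma>_inner mult.commute)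
      then show ?thesis by (simp add: prod_eq_iff fst_sum snd_sum euclidean_representation)
    qed
    have "P p h = (\<Sum>b\<in>Basis. integral {0..1} (\<lambda>t. (h \<bullet> b) *\<^sub>R ?f b t))"
      unfolding P_def using \<eta>[OF _ p] by simp
    also have "\<dots> = integral {0..1} (\<lambda>t. \<Sum>b\<in>Basis. (h \<bullet> b) *\<^sub>R ?f b t)"
      using int by (intro integral_sum[symmetric] integrable_cmul) auto
    also have "\<dots> = integral {0..1} (\<lambda>t. F' (X t p) (0, h, P (\<sigma> t p) (\<sigma> t h)))"
      unfolding h_eq blinfun.sum_right blinfun.scaleR_right ..
    finally show ?thesis .
  qed
  have "compact (F' ` M)" using F'_cont M compact_continuous_image continuous_on_subset by metis
  then obtain C where C: "0 < C" "\<And>x. x \<in> M \<Longrightarrow> norm (F' x) \<le> C"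
    using compact_imp_bounded[THEN bounded_pos[THEN iffD1]] by (metis imageI)
  have Fp: "norm (F (t, q, e) - F (t, p, e)) \<le> C * norm (q - p)"
    if t: "t \<in> {0..1}" and "p \<in> K" "q \<in> K" "e \<in> G ` K" for t p q e
  proof (rule differentiable_bound[OF K(2)])
    fix x assume x: "x \<in> K"
    have xM: "(t, x, e) \<in> M" unfolding M_def using t x that by auto
    have "((\<lambda>p. (t, p, e)) has_derivative (\<lambda>h. (0, h, 0))) (at x)"
      by (intro has_derivative_Pair has_derivative_const has_derivative_ident)
    then have "((\<lambda>p. F (t, p, e)) has_derivative (\<lambda>h. F' (t, x, e) (0, h, 0))) (at x)"
      by (rule has_derivative_compose) (use F'(1) xM M in auto)
    then show "((\<lambda>p. F (t, p, e)) has_derivative (\<lambda>h. F' (t, x, e) (0, h, 0))) (at x within K)"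
      by (rule has_derivative_at_withinI)
    show "onorm (\<lambda>h. F' (t, x, e) (0, h, 0)) \<le> C"
    proof (rule onorm_bound)
      show "norm (F' (t, x, e) (0, h, 0)) \<le> C * norm h" for h
        using norm_blinfun[of "F' (t, x, e)" "(0, h, 0)"] C(2)[OF xM] mult_right_mono[of _ C "norm h"]
        by (simp add: norm_Pair) (meson order_trans mult_right_mono norm_ge_zero)
    qed (use C in simp)
  qed (use that in auto)
  have \<sigma>add: "\<sigma> t q + \<sigma> t k = \<sigma> t (q + k)" for t q k by (simp add: \<sigma>_add)
  define \<Delta> where "\<Delta> q k = G (q + k) - G q" for q k
  have \<Delta>_eq: "\<Delta> q k = integral {0..1} (\<lambda>t. F (X t (q + k)) - F (X t q))" if "q \<in> K" "q + k \<in> K" for q k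
  proof -
    have "G q = integral {0..1} (\<lambda>t. F (X t q))" if "q \<in> K" for q
      using fixed[OF subsetD[OF K(3) that]] unfolding X_def .
    then show ?thesis
      using integral_diff[OF integrable_continuous_interval[OF contXt(3)[OF that(2)]]
          integrable_continuous_interval[OF contXt(3)[OF that(1)]]] that
      unfolding \<Delta>_def by simp
  qed
  have lipG: "norm (\<Delta> q k) \<le> 2 * C * norm k" if qk: "q \<in> K" "q + k \<in> K" for q k
  proof -
    have "compact (G ` K)" using GK K compact_continuous_image by blast
    then obtain B where B: "0 < B" "\<And>x. x \<in> K \<Longrightarrow> norm (G x) \<le> B"
      using compact_imp_bounded[THEN bounded_pos[THEN iffD1]] by (metis imageI)
    let ?X = "{(p, h). p \<in> K \<and> p + h \<in> K \<and> norm h \<le> norm k}"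
    have "(\<lambda>(p, h). norm (\<Delta> p h)) (q, k) \<le> 2 * (C * norm k) * (\<lambda>_. 1) (q, k)"
    proof (rule halving_bound[where X = ?X and ?B0.0 = "2 * B"])
      have "norm (\<Delta> p h) \<le> 2 * B" if "p \<in> K" "p + h \<in> K" for p h
        using norm_triangle_ineq4[of "G (p + h)" "G p"] B(2)[OF that(1)] B(2)[OF that(2)]
        by (simp add: \<Delta>_def)
      then show "(\<lambda>(p, h). norm (\<Delta> p h)) x \<le> 2 * B * (\<lambda>_. 1) x" if "x \<in> ?X" for x
        using that by auto
    next
      fix B' x assume B': "\<And>y. y \<in> ?X \<Longrightarrow> (\<lambda>(p, h). norm (\<Delta> p h)) y \<le> B' * (\<lambda>_. 1) y" and x: "x \<in> ?X"
      obtain p h where [simp]: "x = (p, h)" by fastforce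
      have ph: "p \<in> K" "p + h \<in> K" "norm h \<le> norm k" using x by auto
      have "norm (\<Delta> p h) \<le> B' / 2 + C * norm k"
        unfolding \<Delta>_eq[OF ph(1,2)]
      proof (intro integral_unit_bound continuous_intros contXt ph)
        fix t :: real assume t: "t \<in> {0..1}"
        have s: "\<sigma> t p \<in> K" "\<sigma> t (p + h) \<in> K" using ph \<sigma>K by auto
        have "F (X t (p + h)) - F (X t p) =
          (F (t, p + h, G (\<sigma> t (p + h))) - F (t, p + h, G (\<sigma> t p))) + (F (t, p + h, G (\<sigma> t p)) - F (t, p, G (\<sigma> t p)))"
          unfolding X_def by simp
        also have "norm \<dots> \<le> norm (\<Delta> (\<sigma> t p) (\<sigma> t h)) / 2 + C * norm h"
        proof (intro norm_triangle_le add_mono)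
          show "norm (F (t, p + h, G (\<sigma> t (p + h))) - F (t, p + h, G (\<sigma> t p))) \<le> norm (\<Delta> (\<sigma> t p) (\<sigma> t h)) / 2"
            unfolding \<Delta>_def \<sigma>add using s GK(2) ph K(3) by (intro lip t) auto
          show "norm (F (t, p + h, G (\<sigma> t p)) - F (t, p, G (\<sigma> t p))) \<le> C * norm h"
            using Fp[OF t ph(1,2), of "G (\<sigma> t p)"] s by simp
        qed
        also have "\<dots> \<le> B' / 2 + C * norm k"
          using B'[of "(\<sigma> t p, \<sigma> t h)"] s norm_\<sigma>_le[of t h] ph(3) C(1)
          by (intro add_mono mult_left_mono) (auto simp: \<sigma>add)
        finally show "norm (F (X t (p + h)) - F (X t p)) \<le> B' / 2 + C * norm k" .
      qed
      then show "(\<lambda>(p, h). norm (\<Delta> p h)) x \<le> (B' / 2 + C * norm k) * (\<lambda>_. 1) x" by simp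
    qed (use B C qk in auto)
    then show ?thesis by simp
  qed
  have P_bound: "\<exists>B\<ge>0. \<forall>p\<in>K. \<forall>h. norm (P p h) \<le> B * norm h"
  proof -
    have "\<exists>B\<ge>0. \<forall>p\<in>K. norm (\<eta> b p) \<le> B" if "b \<in> Basis" for b
      using compact_imp_bounded[OF compact_continuous_image[OF \<eta>_cont[OF that] K(1)], THEN bounded_pos[THEN iffD1]]
      by (metis imageI less_imp_le)
    then obtain B where B: "\<And>b. b \<in> Basis \<Longrightarrow> 0 \<le> B b" "\<And>b p. b \<in> Basis \<Longrightarrow> p \<in> K \<Longrightarrow> norm (\<eta> b p) \<le> B b"
      by metis
    have "norm (P p h) \<le> (\<Sum>b\<in>Basis. B b) * norm h" if "p \<in> K" for p h
      unfolding P_def sum_distrib_right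
      by (rule sum_norm_le) (use B that in \<open>auto simp: mult.commute[of "B _"] intro!: mult_mono Basis_le_norm\<close>)
    then show ?thesis using B by (intro exI[of _ "\<Sum>b\<in>Basis. B b"]) (auto intro: sum_nonneg)
  qed
  then obtain B1 where B1: "0 \<le> B1" "\<And>p h. p \<in> K \<Longrightarrow> norm (P p h) \<le> B1 * norm h" by blast
  have rem: "\<exists>\<delta>>0. \<forall>q k. q \<in> K \<and> q + k \<in> K \<and> norm k \<le> \<delta> \<longrightarrow> norm (\<Delta> q k - P q k) \<le> \<epsilon> * norm k"
    if "0 < \<epsilon>" for \<epsilon>
  proof -
    \<comment> \<open>by \<open>lipG\<close> an increment \<open>h\<close> of \<open>p\<close> changes the argument of \<open>F\<close> by at most \<open>(1 + 2 C) |h|\<close>\<close>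
    define \<epsilon>' where "\<epsilon>' = \<epsilon> / (2 * (1 + 2 * C))"
    have \<epsilon>': "0 < \<epsilon>'" "2 * (\<epsilon>' * (1 + 2 * C)) = \<epsilon>"
      using that C(1) by (auto simp: \<epsilon>'_def field_simps)
    obtain d where d: "0 < d" "\<And>x h. x \<in> M \<Longrightarrow> norm h \<le> d \<Longrightarrow>
        norm (F (x + h) - F x - F' x h) \<le> \<epsilon>' * norm h"
      using uniformly_differentiable_on_compact[OF \<open>open S\<close> M F'_cont \<epsilon>'(1) F'(1)] by blast
    define \<delta> where "\<delta> = d / (1 + 2 * C)"
    have \<delta>: "0 < \<delta>" "\<delta> * (1 + 2 * C) = d" using d C by (auto simp: \<delta>_def)
    let ?X = "{(p, h). p \<in> K \<and> p + h \<in> K \<and> norm h \<le> \<delta>}"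
    have main: "(\<lambda>(p, h). norm (\<Delta> p h - P p h)) y \<le> 2 * (\<epsilon>' * (1 + 2 * C)) * (\<lambda>(p, h). norm h) y" if "y \<in> ?X" for y
    proof (rule halving_bound[where X = ?X and ?B0.0 = "2 * C + B1"])
      fix x assume "x \<in> ?X"
      moreover have "norm (\<Delta> p h - P p h) \<le> (2 * C + B1) * norm h" if "p \<in> K" "p + h \<in> K" for p h
        using norm_triangle_ineq4[of "\<Delta> p h" "P p h"] lipG[OF that] B1(2)[OF that(1), of h]
        by (simp add: distrib_right)
      ultimately show "(\<lambda>(p, h). norm (\<Delta> p h - P p h)) x \<le> (2 * C + B1) * (\<lambda>(p, h). norm h) x"
        by auto
    next
      fix B' x assume "0 \<le> B'"
        and B': "\<And>y. y \<in> ?X \<Longrightarrow> (\<lambda>(p, h). norm (\<Delta> p h - P p h)) y \<le> B' * (\<lambda>(p, h). norm h) y" and x: "x \<in> ?X"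
      obtain p h where [simp]: "x = (p, h)" by fastforce
      have ph: "p \<in> K" "p + h \<in> K" "norm h \<le> \<delta>" using x by auto
      have "norm (\<Delta> p h - P p h) \<le> (B' / 2 + \<epsilon>' * (1 + 2 * C)) * norm h"
      proof -
        have "\<Delta> p h - P p h = integral {0..1} (\<lambda>t. F (X t (p + h)) - F (X t p) - F' (X t p) (0, h, P (\<sigma> t p) (\<sigma> t h)))"
          unfolding \<Delta>_eq[OF ph(1,2)] P_eq[OF ph(1), of h]
          by (intro integral_diff[symmetric] integrable_continuous_interval continuous_intros blinfun.continuous_on contXt P\<sigma>_cont ph)
        also have "norm \<dots> \<le> (B' / 2 + \<epsilon>' * (1 + 2 * C)) * norm h"
        proof (intro integral_unit_bound continuous_intros blinfun.continuous_on contXt P\<sigma>_cont ph)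
          fix t :: real assume t: "t \<in> {0..1}"
          have s: "\<sigma> t p \<in> K" "\<sigma> t p + \<sigma> t h \<in> K" using ph \<sigma>K \<sigma>add by auto
          define H where "H = (0::real, h, \<Delta> (\<sigma> t p) (\<sigma> t h))"
          have XH: "X t (p + h) = X t p + H" unfolding X_def H_def \<Delta>_def \<sigma>add by simp
          have n\<sigma>: "norm (\<sigma> t h) \<le> norm h" by (rule norm_\<sigma>_le)
          have "norm H \<le> norm h + norm (\<Delta> (\<sigma> t p) (\<sigma> t h))"
            unfolding H_def using norm_Pair_le[of h "\<Delta> (\<sigma> t p) (\<sigma> t h)"] by (simp add: norm_Pair)
          also have "\<dots> \<le> norm h + 2 * C * norm h"
            using lipG[OF s] n\<sigma> C(1) by (meson add_left_mono mult_left_mono order_trans less_imp_le zero_le_mult_iff zero_le_numeral)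
          finally have nH: "norm H \<le> (1 + 2 * C) * norm h" by (simp add: distrib_right)
          also have "\<dots> \<le> d" using ph(3) \<delta> C(1) by (metis add_pos_pos mult.commute mult_left_mono less_imp_le zero_less_one mult_pos_pos zero_less_numeral)
          finally have Hd: "norm H \<le> d" .
          have "F (X t (p + h)) - F (X t p) - F' (X t p) (0, h, P (\<sigma> t p) (\<sigma> t h)) =
            (F (X t p + H) - F (X t p) - F' (X t p) H) + F' (X t p) (0, 0, \<Delta> (\<sigma> t p) (\<sigma> t h) - P (\<sigma> t p) (\<sigma> t h))"
            unfolding XH H_def by (simp add: algebra_simps flip: blinfun.add_right blinfun.diff_right)
          also have "norm \<dots> \<le> \<epsilon>' * norm H + norm (\<Delta> (\<sigma> t p) (\<sigma> t h) - P (\<sigma> t p) (\<sigma> t h)) / 2"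
            by (intro norm_triangle_le add_mono d(2) XM t ph Hd De)
          also have "\<dots> \<le> \<epsilon>' * ((1 + 2 * C) * norm h) + B' * norm h / 2"
          proof (intro add_mono mult_left_mono nH divide_right_mono)
            have "norm (\<Delta> (\<sigma> t p) (\<sigma> t h) - P (\<sigma> t p) (\<sigma> t h)) \<le> B' * norm (\<sigma> t h)"
              using B'[of "(\<sigma> t p, \<sigma> t h)"] s n\<sigma> ph(3) by auto
            also have "\<dots> \<le> B' * norm h" using n\<sigma> \<open>0 \<le> B'\<close> by (rule mult_left_mono)
            finally show "norm (\<Delta> (\<sigma> t p) (\<sigma> t h) - P (\<sigma> t p) (\<sigma> t h)) \<le> B' * norm h" .
          qed (use \<epsilon>' in auto)
          also have "\<dots> = (B' / 2 + \<epsilon>' * (1 + 2 * C)) * norm h" by (simp add: algebra_simps)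
          finally show "norm (F (X t (p + h)) - F (X t p) - F' (X t p) (0, h, P (\<sigma> t p) (\<sigma> t h)))
            \<le> (B' / 2 + \<epsilon>' * (1 + 2 * C)) * norm h" .
        qed
        finally show ?thesis .
      qed
      then show "(\<lambda>(p, h). norm (\<Delta> p h - P p h)) x \<le> (B' / 2 + \<epsilon>' * (1 + 2 * C)) * (\<lambda>(p, h). norm h) x" by simp
    qed (use that C B1 \<epsilon>' in auto)
    show ?thesis
    proof (intro exI[of _ \<delta>] conjI allI impI)
      show "norm (\<Delta> q k - P q k) \<le> \<epsilon> * norm k" if "q \<in> K \<and> q + k \<in> K \<and> norm k \<le> \<delta>" for q k
        using main[of "(q, k)"] that \<epsilon>'(2) by simp
    qed (rule \<delta>(1))
  qed
  show ?thesis
  proof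
    show "continuous_on (cball 0 r) (\<eta> b)" if "b \<in> Basis" for b using \<eta>_cont[OF that] by (simp add: K_def)
    show "\<eta> b p = integral {0..1} (\<lambda>t. frechet_derivative F (at (t, p, G (\<sigma> t p))) (0, b, c b t *\<^sub>R \<eta> b (\<sigma> t p)))"
      if "b \<in> Basis" "p \<in> cball 0 r" for b p
    proof -
      have p: "p \<in> K" using that(2) by (simp add: K_def)
      show ?thesis
        unfolding \<eta>[OF that(1) p]
        by (rule integral_cong) (use F'(2) XS p in \<open>simp add: X_def\<close>)
    qed
    show "(G has_derivative (\<lambda>h. \<Sum>b\<in>Basis. (h \<bullet> b) *\<^sub>R \<eta> b p)) (at p)" if p: "p \<in> ball 0 r" for p
      unfolding has_derivative_at_alt P_def[symmetric]
    proof (intro conjI allI impI)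
      show "bounded_linear (P p)"
        unfolding P_def
        by (intro bounded_linear_sum bounded_linear_scaleR_left[THEN bounded_linear_compose] bounded_linear_inner_left)
      fix \<epsilon> :: real assume "0 < \<epsilon>"
      then obtain \<delta> where \<delta>: "\<delta> > 0" "\<And>q k. q \<in> K \<Longrightarrow> q + k \<in> K \<Longrightarrow> norm k \<le> \<delta> \<Longrightarrow> norm (\<Delta> q k - P q k) \<le> \<epsilon> * norm k"
        using rem by metis
      obtain d where d: "0 < d" "ball p d \<subseteq> ball 0 r" using p openE[OF open_ball] by metis
      show "\<exists>d>0. \<forall>y. norm (y - p) < d \<longrightarrow> norm (G y - G p - P p (y - p)) \<le> \<epsilon> * norm (y - p)"
      proof (intro exI[of _ "min d \<delta>"] conjI allI impI)
        fix y assume y: "norm (y - p) < min d \<delta>"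
        then have "y \<in> ball p d" by (simp add: dist_norm norm_minus_commute)
        then have "y \<in> K" using subsetD[OF d(2), of y] by (simp add: K_def)
        moreover have "p \<in> K" using p by (simp add: K_def)
        ultimately
        show "norm (G y - G p - P p (y - p)) \<le> \<epsilon> * norm (y - p)"
          using \<delta>(2)[of p "y - p"] y by (simp add: \<Delta>_def)
      qed (use d \<delta> in auto)
    qed
  qed
qed

text \<open>
  The solutions \<open>\<eta> b\<close> on the smaller balls are determined by \<open>G\<close>, so they fit together to partial
  derivatives on the whole open ball.
\<close>

lemma averaged_fixed_point_derivative:
  fixes F :: "real \<times> 'p \<times> 'e \<Rightarrow> 'e::euclidean_space"
  assumes openE: "open E"
    and F1: "Ck_on (Suc 0) (UNIV \<times> ball 0 R \<times> E) F"
    and lip: "\<And>t p e e'. t \<in> {0..1} \<Longrightarrow> p \<in> ball 0 R \<Longrightarrow> e \<in> E \<Longrightarrow> e' \<in> E \<Longrightarrow>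
      norm (F (t, p, e) - F (t, p, e')) \<le> norm (e - e') / 2"
    and G: "continuous_on (ball 0 R) G" "G ` ball 0 R \<subseteq> E"
    and fixed: "\<And>p. p \<in> ball 0 R \<Longrightarrow> G p = integral {0..1} (\<lambda>t. F (t, p, G (\<sigma> t p)))"
    and p: "p \<in> ball 0 R"
  shows "(G has_derivative (\<lambda>h. \<Sum>b\<in>Basis. (h \<bullet> b) *\<^sub>R frechet_derivative G (at p) b)) (at p)"
    "\<And>b. b \<in> Basis \<Longrightarrow> isCont (\<lambda>p. frechet_derivative G (at p) b) p"
    "\<And>b. b \<in> Basis \<Longrightarrow> frechet_derivative G (at p) b = integral {0..1} (\<lambda>t.
        frechet_derivative F (at (t, p, G (\<sigma> t p))) (0, b, c b t *\<^sub>R frechet_derivative G (at (\<sigma> t p)) b))"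
proof -
  define \<eta> where "\<eta> b p = frechet_derivative G (at p) b" for b p
  obtain r where r: "norm p < r" "r < R" using p dense[of "norm p" R] by auto
  then have "0 \<le> r" by (metis norm_ge_zero order.trans less_imp_le)
  obtain \<eta>' where \<eta>': "\<And>b. b \<in> Basis \<Longrightarrow> continuous_on (cball 0 r) (\<eta>' b)"
    "\<And>p. p \<in> ball 0 r \<Longrightarrow> (G has_derivative (\<lambda>h. \<Sum>b\<in>Basis. (h \<bullet> b) *\<^sub>R \<eta>' b p)) (at p)"
    "\<And>b p. b \<in> Basis \<Longrightarrow> p \<in> cball 0 r \<Longrightarrow> \<eta>' b p = integral {0..1} (\<lambda>t.
      frechet_derivative F (at (t, p, G (\<sigma> t p))) (0, b, c b t *\<^sub>R \<eta>' b (\<sigma> t p)))"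
    by (rule averaged_fixed_point_C1[OF \<open>0 \<le> r\<close> r(2) openE F1 lip G fixed]) blast+
  have eq: "\<eta> b p = \<eta>' b p" if "p \<in> ball 0 r" "b \<in> Basis" for p b
  proof -
    have "\<eta> b p = (\<Sum>b'\<in>Basis. (b \<bullet> b') *\<^sub>R \<eta>' b' p)"
      unfolding \<eta>_def frechet_derivative_at[OF \<eta>'(2)[OF that(1)], symmetric] ..
    also have "\<dots> = (\<Sum>b'\<in>Basis. if b' = b then \<eta>' b' p else 0)"
      by (rule sum.cong) (auto simp: inner_Basis that)
    finally show ?thesis using that by simp
  qed
  have pr: "p \<in> ball 0 r" using r by simp
  show "(G has_derivative (\<lambda>h. \<Sum>b\<in>Basis. (h \<bullet> b) *\<^sub>R frechet_derivative G (at p) b)) (at p)"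
    unfolding \<eta>_def[symmetric]
    using \<eta>'(2)[OF pr] eq[OF pr] by (simp cong: sum.cong)
  fix b :: 'p assume b: "b \<in> Basis"
  have "continuous_on (ball 0 r) (\<eta>' b)" using \<eta>'(1)[OF b] by (rule continuous_on_subset) auto
  then have "continuous_on (ball 0 r) (\<eta> b)" using eq b by (metis continuous_on_cong)
  then show "isCont (\<lambda>p. frechet_derivative G (at p) b) p"
    unfolding \<eta>_def[symmetric] using pr continuous_on_eq_continuous_at open_ball by blast
  show "frechet_derivative G (at p) b = integral {0..1} (\<lambda>t.
        frechet_derivative F (at (t, p, G (\<sigma> t p))) (0, b, c b t *\<^sub>R frechet_derivative G (at (\<sigma> t p)) b))"
    unfolding \<eta>_def[symmetric]
    using \<eta>'(3)[OF b, of p] pr eq[OF _ b] \<sigma>_in_ball[OF pr] by simp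
qed

text \<open>
  Induction on \<open>k\<close>. If \<open>F\<close> is \<open>C\<close>-\<open>(k + 1)\<close>, then \<open>G\<close> is \<open>C\<^sup>k\<close> by induction hypothesis, so the
  integrand of the linear equation for \<open>\<partial>\<^sub>b G\<close>, which involves \<open>dF\<close> along \<open>G\<close>, is \<open>C\<^sup>k\<close>.
  The induction hypothesis, applied to that equation, shows that \<open>\<partial>\<^sub>b G\<close> is \<open>C\<^sup>k\<close>. The induction
  stays within one type because the unknown of the differentiated equation has the type of \<open>G\<close>.
\<close>

lemma averaged_fixed_point_Ck:
  fixes F :: "real \<times> 'p \<times> 'e \<Rightarrow> 'e::euclidean_space"
  assumes "open E"
    and "Ck_on k (UNIV \<times> ball 0 R \<times> E) F"
    and "\<And>t p e e'. t \<in> {0..1} \<Longrightarrow> p \<in> ball 0 R \<Longrightarrow> e \<in> E \<Longrightarrow> e' \<in> E \<Longrightarrow>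
      norm (F (t, p, e) - F (t, p, e')) \<le> norm (e - e') / 2"
    and "continuous_on (ball 0 R) G" "G ` ball 0 R \<subseteq> E"
    and "\<And>p. p \<in> ball 0 R \<Longrightarrow> G p = integral {0..1} (\<lambda>t. F (t, p, G (\<sigma> t p)))"
  shows "Ck_on k (ball 0 R) G"
  using assms
proof (induction k arbitrary: F G E)
  case 0
  then show ?case by simp
next
  case (Suc k)
  note openE = Suc.prems(1) and F = Suc.prems(2) and lip = Suc.prems(3) and G = Suc.prems(4,5)
    and fixed = Suc.prems(6)
  define D where "D = frechet_derivative F"
  define S where "S = (UNIV :: real set) \<times> ball (0::'p) R \<times> E"
  have "open S" unfolding S_def using openE by (intro open_Times) auto
  have F1: "Ck_on (Suc 0) (UNIV \<times> ball 0 R \<times> E) F" by (rule Ck_on_le[OF F]) simp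
  define \<eta> where "\<eta> b p = frechet_derivative G (at p) b" for b p
  have C1: "(G has_derivative (\<lambda>h. \<Sum>b\<in>Basis. (h \<bullet> b) *\<^sub>R \<eta> b p)) (at p)"
    "\<And>b. b \<in> Basis \<Longrightarrow> isCont (\<eta> b) p"
    "\<And>b. b \<in> Basis \<Longrightarrow> \<eta> b p = integral {0..1} (\<lambda>t. D (at (t, p, G (\<sigma> t p))) (0, b, c b t *\<^sub>R \<eta> b (\<sigma> t p)))"
    if p: "p \<in> ball 0 R" for p
    unfolding \<eta>_def D_def
    by (rule averaged_fixed_point_derivative[OF openE F1 lip G fixed p]; assumption)+
  have GCk: "Ck_on k (ball 0 R) G"
    by (rule Suc.IH[OF openE Ck_on_SucD[OF F] lip G fixed])
  have D: "linear (D (at X))" if "X \<in> S" for X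
    unfolding D_def using has_derivative_linear[OF Ck_on_has_derivative[OF F]] that by (simp add: S_def)
  have GE: "G (\<sigma> t p) \<in> E" if "p \<in> ball 0 R" for t p
    using G(2) \<sigma>_in_ball[OF that] by auto
  have \<eta>Ck: "Ck_on k (ball 0 R) (\<eta> b)" if b: "b \<in> Basis" for b
  proof -
    define H where "H = (\<lambda>(t, p, e::'e). D (at (t, p, G (\<sigma> t p))) (0, b, c b t *\<^sub>R e))"
    let ?O = "(UNIV :: real set) \<times> ball (0::'p) R \<times> (UNIV :: 'e set)"
    have "open ?O" by (intro open_Times) auto
    have comp: "Ck_on k ?O (\<lambda>x. D (at (fst x, fst (snd x), G (\<sigma> (fst x) (fst (snd x))))) w)" for w
    proof -
      have "Ck_on k ?O (\<lambda>x. \<sigma> (fst x) (fst (snd x)))"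
        using Ck_on_compose[OF \<open>open ?O\<close> open_UNIV _ Ck_on_\<sigma>, of k "\<lambda>x. (fst x, fst (snd x))"]
        by (simp add: Ck_on_Pair Ck_on_fst Ck_on_snd Ck_on_id \<open>open ?O\<close>)
      then have "Ck_on k ?O (\<lambda>x. G (\<sigma> (fst x) (fst (snd x))))"
        by (rule Ck_on_compose[OF \<open>open ?O\<close> open_ball _ GCk]) (auto intro: \<sigma>_in_ball simp del: mem_ball)
      then have X: "Ck_on k ?O (\<lambda>x. (fst x, fst (snd x), G (\<sigma> (fst x) (fst (snd x)))))"
        by (intro Ck_on_Pair Ck_on_fst Ck_on_snd Ck_on_id \<open>open ?O\<close>)
      have "Ck_on k S (\<lambda>X. D (at X) w)" using F unfolding D_def S_def Ck_on.simps by blast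
      then show ?thesis
        by (rule Ck_on_compose[OF \<open>open ?O\<close> \<open>open S\<close> X]) (use GE in \<open>auto simp: S_def simp del: mem_ball\<close>)
    qed
    have H_eq: "H x = D (at (fst x, fst (snd x), G (\<sigma> (fst x) (fst (snd x))))) (0, b, 0) +
        (\<Sum>i\<in>Basis. (c b (fst x) * (snd (snd x) \<bullet> i)) *\<^sub>R
          D (at (fst x, fst (snd x), G (\<sigma> (fst x) (fst (snd x))))) (0, 0, i))" if "x \<in> ?O" for x
    proof -
      obtain t p e where [simp]: "x = (t, p, e)" using prod_cases3 by blast
      have XS: "(t, p, G (\<sigma> t p)) \<in> S" unfolding S_def using that GE by auto
      have "(0, b, c b t *\<^sub>R e) = (0::real, b, 0::'e) + (\<Sum>i\<in>Basis. (c b t * (e \<bullet> i)) *\<^sub>R (0, 0, i))"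
        by (simp add: prod_eq_iff fst_sum snd_sum euclidean_representation
            flip: scaleR_scaleR scaleR_sum_right)
      then show ?thesis
        unfolding H_def
        by (simp add: linear_add[OF D[OF XS]] linear_sum[OF D[OF XS]] linear_scale[OF D[OF XS]]
            del: scaleR_Pair add_Pair)
    qed
    have HCk: "Ck_on k ?O H"
    proof (rule Ck_on_cong[OF \<open>open ?O\<close> H_eq[symmetric]])
      have "Ck_on k ?O (\<lambda>x. c b (fst x))"
        by (rule Ck_on_compose[OF \<open>open ?O\<close> open_UNIV _ smooth_on_Ck[OF c_smooth[OF b]]])
          (auto intro!: Ck_on_fst Ck_on_id \<open>open ?O\<close>)
      then show "Ck_on k ?O (\<lambda>x. D (at (fst x, fst (snd x), G (\<sigma> (fst x) (fst (snd x))))) (0, b, 0) +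
        (\<Sum>i\<in>Basis. (c b (fst x) * (snd (snd x) \<bullet> i)) *\<^sub>R
          D (at (fst x, fst (snd x), G (\<sigma> (fst x) (fst (snd x))))) (0, 0, i)))"
        by (intro Ck_on_add Ck_on_sum Ck_on_scaleR Ck_on_mult Ck_on_inner Ck_on_snd Ck_on_id Ck_on_const
            comp \<open>open ?O\<close>)
    qed
    show ?thesis
    proof (rule Suc.IH[of UNIV H])
      fix t p and e e' :: 'e assume t: "t \<in> {0..1::real}" and p: "p \<in> ball (0::'p) R"
      let ?X = "(t, p, G (\<sigma> t p))"
      have XS: "?X \<in> S" unfolding S_def using p GE by auto
      have "((\<lambda>e. (t, p, e)) has_derivative (\<lambda>h. (0, 0, h))) (at (G (\<sigma> t p)))"
        by (intro has_derivative_Pair has_derivative_const has_derivative_ident)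
      then have "((\<lambda>e. F (t, p, e)) has_derivative (\<lambda>h. D (at ?X) (0, 0, h))) (at (G (\<sigma> t p)))"
        by (rule has_derivative_compose)
          (use Ck_on_has_derivative[OF F] XS in \<open>auto simp: S_def D_def\<close>)
      from lipschitz_imp_derivative_bound[OF this openE GE[OF p], of "1/2"]
      have De: "norm (D (at ?X) (0, 0, h)) \<le> 1/2 * norm h" for h
        using lip[OF t p _ GE[OF p]] by simp
      have "H (t, p, e) - H (t, p, e') = D (at ?X) (0, 0, c b t *\<^sub>R (e - e'))"
        unfolding H_def by (simp add: linear_diff[OF D[OF XS], symmetric] scaleR_diff_right)
      also have "norm \<dots> \<le> 1/2 * (\<bar>c b t\<bar> * norm (e - e'))" using De[of "c b t *\<^sub>R (e - e')"] by simp
      also have "\<dots> \<le> norm (e - e') / 2"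
        using mult_left_le_one_le[of "norm (e - e')" "\<bar>c b t\<bar>"] c_le_1[OF b, of t] by simp
      finally show "norm (H (t, p, e) - H (t, p, e')) \<le> norm (e - e') / 2" .
    next
      show "continuous_on (ball 0 R) (\<eta> b)" using C1(2) b continuous_at_imp_continuous_on by blast
      show "\<eta> b p = integral {0..1} (\<lambda>t. H (t, p, \<eta> b (\<sigma> t p)))" if "p \<in> ball 0 R" for p
        using C1(3)[OF that b] unfolding H_def by simp
    qed (use HCk in auto)
  qed
  show ?case
    by (rule Ck_on_SucI[OF C1(1) open_ball])
      (assumption | rule Ck_on_sum Ck_on_scaleR Ck_on_const \<eta>Ck open_ball)+
qed

lemma averaged_fixed_point_smooth:
  fixes F :: "real \<times> 'p \<times> 'e \<Rightarrow> 'e::euclidean_space"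
  assumes "open E"
    and "smooth_on (UNIV \<times> ball 0 R \<times> E) F"
    and "\<And>t p e e'. t \<in> {0..1} \<Longrightarrow> p \<in> ball 0 R \<Longrightarrow> e \<in> E \<Longrightarrow> e' \<in> E \<Longrightarrow>
      norm (F (t, p, e) - F (t, p, e')) \<le> norm (e - e') / 2"
    and "continuous_on (ball 0 R) G" "G ` ball 0 R \<subseteq> E"
    and "\<And>p. p \<in> ball 0 R \<Longrightarrow> G p = integral {0..1} (\<lambda>t. F (t, p, G (\<sigma> t p)))"
  shows "smooth_on (ball 0 R) G"
  unfolding smooth_on_def using averaged_fixed_point_Ck[OF assms(1) smooth_on_Ck[OF assms(2)] assms(3-6)]
  by (rule allI)

end

section \<open>Implicit functions, inverse functions and diffeomorphisms\<close>

text \<open>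
  The case of the trivial scaling \<open>\<sigma> t p = p\<close> and of an integrand that does not depend on time.
\<close>

lemma smooth_implicit_fixed_point:
  fixes F :: "'p::euclidean_space \<times> 'e \<Rightarrow> 'e::euclidean_space"
  assumes "open E" "smooth_on (ball p0 R \<times> E) F"
    and lip: "\<And>p e e'. p \<in> ball p0 R \<Longrightarrow> e \<in> E \<Longrightarrow> e' \<in> E \<Longrightarrow> norm (F (p, e) - F (p, e')) \<le> norm (e - e') / 2"
    and G: "continuous_on (ball p0 R) G" "G ` ball p0 R \<subseteq> E" "\<And>p. p \<in> ball p0 R \<Longrightarrow> G p = F (p, G p)"
  shows "smooth_on (ball p0 R) G"
proof -
  interpret diagonal_contraction "\<lambda>b::'p. \<lambda>t::real. 1::real"
    by unfold_locales (auto simp: smooth_on_const)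
  have [simp]: "\<sigma> t p = p" for t p unfolding \<sigma>_def by (simp add: euclidean_representation)
  have shift: "(+) p0 ` ball 0 R = ball p0 R" by simp
  have memb: "p0 + p \<in> ball p0 R" if "p \<in> ball 0 R" for p using that by (simp add: dist_norm)
  let ?O = "(UNIV :: real set) \<times> ball (0::'p) R \<times> E"
  have O: "open ?O" using assms(1) by (intro open_Times) auto
  have "smooth_on (ball 0 R) (\<lambda>p. G (p0 + p))"
  proof (rule averaged_fixed_point_smooth[OF assms(1), of _ "\<lambda>(t, p, e). F (p0 + p, e)"])
    have "smooth_on ?O (\<lambda>x. F (p0 + fst (snd x), snd (snd x)))"
    proof (rule smooth_on_compose[OF _ assms(2) O open_Times[OF open_ball assms(1)]])
      show "smooth_on ?O (\<lambda>x. (p0 + fst (snd x), snd (snd x)))"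
        unfolding smooth_on_def
        by (intro allI Ck_on_Pair Ck_on_add Ck_on_const Ck_on_fst Ck_on_snd Ck_on_id O)
    qed (auto simp: dist_norm)
    then show "smooth_on ?O (\<lambda>(t, p, e). F (p0 + p, e))" unfolding case_prod_beta .
    show "continuous_on (ball 0 R) (\<lambda>p. G (p0 + p))"
      by (rule continuous_on_compose2[OF G(1)]) (auto intro!: continuous_intros simp: dist_norm)
    show "G (p0 + p) = integral {0..1} (\<lambda>t. case (t, p, G (p0 + \<sigma> t p)) of (t, p, e) \<Rightarrow> F (p0 + p, e))"
      if "p \<in> ball 0 R" for p using G(3)[OF memb[OF that]] by simp
  qed (use lip memb G(2) in auto)
  then have "smooth_on (ball p0 R) (\<lambda>p. G (p0 + (p - p0)))"
  proof (rule smooth_on_compose[rotated])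
    show "smooth_on (ball p0 R) (\<lambda>p. p - p0)"
      unfolding smooth_on_def by (intro allI Ck_on_diff Ck_on_const Ck_on_id open_ball)
  qed (auto simp: dist_norm norm_minus_commute)
  then show ?thesis by simp
qed

text \<open>
  Near \<open>p0\<close> the family is close to the identity, and \<open>N p v\<close> is the fixed point of the contraction
  \<open>e \<mapsto> v + e - M p e\<close>.
\<close>

lemma smooth_linear_inverse:
  fixes M :: "'p::euclidean_space \<Rightarrow> 'e::euclidean_space \<Rightarrow> 'e"
  assumes "open U" "p0 \<in> U" and lin: "\<And>p. p \<in> U \<Longrightarrow> linear (M p)"
    and sm: "\<And>v. smooth_on U (\<lambda>p. M p v)" and id: "\<And>v. M p0 v = v"
  obtains R N where "0 < R" "ball p0 R \<subseteq> U" "\<And>p. p \<in> ball p0 R \<Longrightarrow> linear (N p)"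
    "\<And>p v. p \<in> ball p0 R \<Longrightarrow> M p (N p v) = v" "\<And>p v. p \<in> ball p0 R \<Longrightarrow> N p (M p v) = v"
    "\<And>v. smooth_on (ball p0 R) (\<lambda>p. N p v)"
proof -
  define n where "n = real DIM('e)"
  have n: "0 < n" by (simp add: n_def)
  have "\<exists>d>0. ball p0 d \<subseteq> U \<and> (\<forall>p\<in>ball p0 d. norm (M p b - b) \<le> 1 / (2 * n))" for b
  proof -
    have "continuous_on U (\<lambda>p. M p b)" using sm Ck_on_imp_continuous_on smooth_on_Ck by blast
    then have "isCont (\<lambda>p. M p b) p0" using assms(1,2) continuous_on_eq_continuous_at by blast
    then obtain d where d: "0 < d" "\<And>p. dist p p0 < d \<Longrightarrow> dist (M p b) (M p0 b) < 1 / (2 * n)"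
      unfolding continuous_at_eps_delta using n by (metis divide_pos_pos mult_pos_pos zero_less_numeral zero_less_one)
    obtain d' where "0 < d'" "ball p0 d' \<subseteq> U" using assms(1,2) openE by blast
    then show ?thesis using d id
      by (intro exI[of _ "min d d'"]) (auto simp: dist_commute dist_norm norm_minus_commute[of b] less_imp_le subset_iff)
  qed
  then obtain d where d: "\<And>b. 0 < d b" "\<And>b. ball p0 (d b) \<subseteq> U"
    "\<And>b p. p \<in> ball p0 (d b) \<Longrightarrow> norm (M p b - b) \<le> 1 / (2 * n)" by metis
  define R where "R = Min (d ` (Basis :: 'e set))"
  have R: "0 < R" "\<And>b. b \<in> Basis \<Longrightarrow> R \<le> d b" unfolding R_def using d(1) by auto
  have RU: "ball p0 R \<subseteq> U"
    using R(2) d(2) by (meson SOME_Basis subset_ball subset_trans)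
  have close: "norm (M p v - v) \<le> norm v / 2" if p: "p \<in> ball p0 R" for p v
  proof -
    have lp: "linear (M p)" using lin RU p by auto
    have "M p v - v = (\<Sum>b\<in>Basis. (v \<bullet> b) *\<^sub>R (M p b - b))"
      using linear_basis_expansion[OF lp, of v] euclidean_representation[of v]
      by (simp add: scaleR_diff_right sum_subtractf)
    also have "norm \<dots> \<le> (\<Sum>b\<in>(Basis::'e set). norm v * (1 / (2 * n)))"
    proof (rule sum_norm_le)
      fix b :: 'e assume b: "b \<in> Basis"
      have "p \<in> ball p0 (d b)" using p R(2)[OF b] by auto
      then show "norm ((v \<bullet> b) *\<^sub>R (M p b - b)) \<le> norm v * (1 / (2 * n))"
        using d(3) Basis_le_norm[OF b] unfolding norm_scaleR by (intro mult_mono) auto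
    qed
    also have "\<dots> = norm v / 2" using n by (simp add: n_def)
    finally show ?thesis .
  qed
  define N where "N p = inv (M p)" for p
  have bij: "bij (M p)" if p: "p \<in> ball p0 R" for p
  proof -
    have lp: "linear (M p)" using lin RU p by auto
    have "v = 0" if "M p v = 0" for v using close[OF p, of v] that by simp
    then have "inj (M p)" using linear_injective_0[OF lp] by blast
    then show ?thesis using linear_injective_imp_surjective[OF lp] by (simp add: bij_def)
  qed
  have MN: "M p (N p v) = v" "N p (M p v) = v" if "p \<in> ball p0 R" for p v
    unfolding N_def using bij[OF that] by (auto simp: bij_def surj_f_inv_f)
  have linN: "linear (N p)" if p: "p \<in> ball p0 R" for p
  proof -
    have lp: "linear (M p)" using lin RU p by auto
    show ?thesis
      by (rule linearI) (metis MN(1,2)[OF p] linear_add[OF lp] linear_scale[OF lp])+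
  qed
  have normN: "norm (N p v) \<le> 2 * norm v" if p: "p \<in> ball p0 R" for p v
  proof -
    have "norm (N p v) \<le> norm (M p (N p v)) + norm (M p (N p v) - N p v)"
      by (metis norm_minus_commute norm_triangle_sub)
    then show ?thesis using close[OF p, of "N p v"] MN(1)[OF p] by simp
  qed
  have contN: "continuous_on (ball p0 R) (\<lambda>p. N p v)" for v
    unfolding continuous_on_def
  proof
    fix q assume q: "q \<in> ball p0 R"
    let ?F = "at q within ball p0 R"
    have "continuous_on (ball p0 R) (\<lambda>p. M p (N q v))"
      using sm Ck_on_imp_continuous_on smooth_on_Ck RU continuous_on_subset by metis
    then have "((\<lambda>p. M p (N q v)) \<longlongrightarrow> M q (N q v)) ?F" using q unfolding continuous_on_def by blast
    then have "((\<lambda>p. norm (M q (N q v) - M p (N q v)) * 2) \<longlongrightarrow> norm (M q (N q v) - M q (N q v)) * 2) ?F"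
      by (intro tendsto_intros)
    moreover have "\<forall>\<^sub>F p in ?F. norm (N p v - N q v) \<le> norm (M q (N q v) - M p (N q v)) * 2"
      unfolding eventually_at_filter
    proof (intro always_eventually allI impI)
      fix p assume p: "p \<in> ball p0 R"
      have "N p v - N q v = N p (M q (N q v) - M p (N q v))"
        by (simp add: linear_diff[OF linN[OF p]] MN[OF p] MN[OF q])
      then show "norm (N p v - N q v) \<le> norm (M q (N q v) - M p (N q v)) * 2"
        using normN[OF p, of "M q (N q v) - M p (N q v)"] by simp
    qed
    ultimately have "((\<lambda>p. N p v - N q v) \<longlongrightarrow> 0) ?F" by (auto intro: Lim_null_comparison)
    then show "((\<lambda>p. N p v) \<longlongrightarrow> N q v) ?F" by (simp add: LIM_zero_iff)
  qed
  have "smooth_on (ball p0 R) (\<lambda>p. N p v)" for v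
  proof (rule smooth_implicit_fixed_point[where F = "\<lambda>(p, e). v + e - M p e" and E = UNIV])
    let ?O = "ball p0 R \<times> (UNIV::'e set)"
    have O: "open ?O" by (intro open_Times) auto
    have 1: "Ck_on k ?O (\<lambda>x. v + snd x - (\<Sum>b\<in>Basis. (snd x \<bullet> b) *\<^sub>R M (fst x) b))" for k
    proof -
      have "Ck_on k ?O (\<lambda>x. M (fst x) b)" for b
        by (rule Ck_on_compose[OF O assms(1) _ smooth_on_Ck[OF sm]])
          (use RU in \<open>auto intro!: Ck_on_fst Ck_on_id O simp del: mem_ball\<close>)
      then show ?thesis
        by (intro Ck_on_diff Ck_on_add Ck_on_sum Ck_on_scaleR Ck_on_inner Ck_on_const Ck_on_snd Ck_on_id O)
    qed
    have 2: "v + snd x - (\<Sum>b\<in>Basis. (snd x \<bullet> b) *\<^sub>R M (fst x) b) = (case x of (p, e) \<Rightarrow> v + e - M p e)"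
      if "x \<in> ?O" for x
      using linear_basis_expansion[OF lin, of "fst x" "snd x"] that RU by (auto simp: case_prod_beta simp del: mem_ball)
    show "smooth_on ?O (\<lambda>(p, e). v + e - M p e)"
      unfolding smooth_on_def using Ck_on_cong[OF O 2 1] by (rule allI)
    show "norm ((case (p, e) of (p, e) \<Rightarrow> v + e - M p e) - (case (p, e') of (p, e) \<Rightarrow> v + e - M p e)) \<le> norm (e - e') / 2"
      if p: "p \<in> ball p0 R" for p e e'
    proof -
      have lp: "linear (M p)" using lin RU p by auto
      show ?thesis using close[OF p, of "e - e'"]
        by (simp add: linear_diff[OF lp] norm_minus_commute algebra_simps)
    qed
    show "N p v = (case (p, N p v) of (p, e) \<Rightarrow> v + e - M p e)" if "p \<in> ball p0 R" for p
      using MN(1)[OF that] by simp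
  qed (use contN in auto)
  then show ?thesis using that R(1) RU linN MN by blast
qed

text \<open>
  The inverse function theorem for \<open>C\<^sup>1\<close> maps gives a continuous local inverse. At \<open>p\<close> it is the fixed
  point of Newton's map \<open>e \<mapsto> e - A (\<phi> e - p)\<close> with \<open>A\<close> the inverse derivative at \<open>x0\<close>, hence smooth.
  The image is a ball; its convexity is used where functions are shown to be constant along
  coordinate directions.
\<close>

lemma smooth_inverse_function:
  fixes \<phi> :: "'a::euclidean_space \<Rightarrow> 'a"
  assumes "open U" "x0 \<in> U" and sm: "smooth_on U \<phi>" and inj: "inj (frechet_derivative \<phi> (at x0))"
  obtains S R \<psi> where "x0 \<in> S" "S \<subseteq> U" "0 < R" "diffeomorphism S (ball (\<phi> x0) R) \<phi> \<psi>"
proof -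
  obtain D where D_cont: "continuous_on U D"
    and D: "\<And>x. x \<in> U \<Longrightarrow> (\<phi> has_derivative blinfun_apply (D x)) (at x)"
      "\<And>x. x \<in> U \<Longrightarrow> blinfun_apply (D x) = frechet_derivative \<phi> (at x)"
    using Ck_on_blinfun_derivative[OF smooth_on_Ck[OF sm]] by blast
  have injD: "inj (blinfun_apply (D x0))" using inj D(2)[OF assms(2)] by simp
  have linD: "linear (blinfun_apply (D x0))" using blinfun.bounded_linear_right bounded_linear.linear by blast
  obtain A' where A': "linear A'" "A' \<circ> blinfun_apply (D x0) = id"
    using linear_injective_left_inverse[OF linD injD] by blast
  define A where "A = Blinfun A'"
  have A: "blinfun_apply A = A'" unfolding A_def
    by (rule bounded_linear_Blinfun_apply) (simp add: A'(1) linear_conv_bounded_linear[symmetric])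
  have AD: "blinfun_apply A (blinfun_apply (D x0) v) = v" for v
    using A'(2) A by (metis comp_apply id_apply)
  have "A o\<^sub>L D x0 = id_blinfun" by (rule blinfun_eqI) (simp add: AD)
  obtain U' V g g' where U': "open U'" "U' \<subseteq> U" "x0 \<in> U'" "open V" "\<phi> x0 \<in> V" "homeomorphism U' V \<phi> g"
    "\<And>y. y \<in> V \<Longrightarrow> (g has_derivative (g' y)) (at y)"
    by (rule inverse_function_theorem[OF assms(1) D(1) D_cont assms(2) \<open>A o\<^sub>L D x0 = id_blinfun\<close>]) blast+
  \<comment> \<open>Newton's map \<open>e \<mapsto> e - A (\<phi> e - p)\<close> is a contraction near \<open>x0\<close>\<close>
  define n where "n = norm A + 1"
  have n: "0 < n" by (simp add: n_def add_nonneg_pos)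
  have "isCont D x0" using D_cont assms(1,2) continuous_on_eq_continuous_at by blast
  moreover have "0 < 1 / (2 * n)" using n by simp
  ultimately obtain d where d: "0 < d" "\<And>x. dist x x0 < d \<Longrightarrow> dist (D x) (D x0) < 1 / (2 * n)"
    unfolding continuous_at_eps_delta by blast
  obtain d' where d': "0 < d'" "ball x0 d' \<subseteq> U" using assms(1,2) openE by blast
  define E where "E = ball x0 (min d d')"
  have E: "open E" "x0 \<in> E" "convex E" "E \<subseteq> U" using d d' by (auto simp: E_def)
  define F where "F = (\<lambda>(p, e). e - blinfun_apply A (\<phi> e - p))"
  have lip: "norm (F (p, e) - F (p, e')) \<le> norm (e - e') / 2" if "e \<in> E" "e' \<in> E" for p e e'
  proof -
    have "norm ((e - blinfun_apply A (\<phi> e - p)) - (e' - blinfun_apply A (\<phi> e' - p))) \<le> 1/2 * norm (e - e')"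
    proof (rule differentiable_bound[OF E(3)])
      fix x assume x: "x \<in> E"
      have "((\<lambda>e. e - blinfun_apply A (\<phi> e - p)) has_derivative
          (\<lambda>h. h - blinfun_apply A (blinfun_apply (D x) h - 0))) (at x)"
        by (intro has_derivative_diff has_derivative_ident has_derivative_const D(1) subsetD[OF E(4) x]
            bounded_linear.has_derivative[OF blinfun.bounded_linear_right])
      then show "((\<lambda>e. e - blinfun_apply A (\<phi> e - p)) has_derivative
          (\<lambda>h. h - blinfun_apply A (blinfun_apply (D x) h))) (at x within E)"
        by (simp add: has_derivative_at_withinI)
      show "onorm (\<lambda>h. h - blinfun_apply A (blinfun_apply (D x) h)) \<le> 1/2"
      proof (rule onorm_bound)
        fix h
        have "h - blinfun_apply A (blinfun_apply (D x) h) = - blinfun_apply A (blinfun_apply (D x - D x0) h)"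
          by (simp add: blinfun.diff_left blinfun.diff_right AD)
        also have "norm \<dots> \<le> norm A * (norm (D x - D x0) * norm h)"
          unfolding norm_minus_cancel
          by (rule order_trans[OF norm_blinfun mult_left_mono[OF norm_blinfun norm_ge_zero]])
        also have "\<dots> \<le> n * (1 / (2 * n) * norm h)"
        proof (intro mult_mono)
          show "norm (D x - D x0) \<le> 1 / (2 * n)"
            using d(2)[of x] x by (simp add: E_def dist_norm norm_minus_commute)
        qed (use n in \<open>auto simp: n_def\<close>)
        also have "\<dots> = 1/2 * norm h" using n by simp
        finally show "norm (h - blinfun_apply A (blinfun_apply (D x) h)) \<le> 1/2 * norm h" .
      qed simp
    qed (use that in auto)
    then show ?thesis by (simp add: F_def)
  qed
  have g: "continuous_on V g" "g (\<phi> x0) = x0" "g ` V = U'" "\<phi> ` U' = V" "continuous_on U' \<phi>"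
    "\<And>y. y \<in> V \<Longrightarrow> \<phi> (g y) = y"
    using U'(3,6) unfolding homeomorphism_def by auto
  have "open (V \<inter> g -` E)" by (rule continuous_open_preimage[OF g(1) U'(4) E(1)])
  moreover have "\<phi> x0 \<in> V \<inter> g -` E" using U'(5) g(2) E(2) by simp
  ultimately obtain R where R: "0 < R" "ball (\<phi> x0) R \<subseteq> V \<inter> g -` E" using openE by blast
  define B where "B = ball (\<phi> x0) R"
  define S where "S = g ` B"
  have hom: "homeomorphism S B \<phi> g"
  proof (rule homeomorphism_of_subsets[OF U'(6)])
    show "S \<subseteq> U'" using R g(3) unfolding S_def B_def by blast
    have "\<phi> (g y) = y" if "y \<in> B" for y using g(6) R that unfolding B_def by blast
    then show "\<phi> ` S = B" unfolding S_def by force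
  qed (rule order_refl)
  have SU': "S \<subseteq> U'" using R g(3) unfolding S_def B_def by blast
  have "S = U' \<inter> \<phi> -` B"
  proof -
    have "x \<in> S" if "x \<in> U'" "\<phi> x \<in> B" for x
      using homeomorphism_apply1[OF U'(6) that(1)] that(2) unfolding S_def by (metis imageI)
    then show ?thesis using hom SU' unfolding homeomorphism_def by auto
  qed
  then have "open S" using continuous_open_preimage[OF g(5) U'(1), of B] by (simp add: B_def)
  have "smooth_on B g"
    unfolding B_def
  proof (rule smooth_implicit_fixed_point[OF E(1), of _ _ F])
    let ?O = "ball (\<phi> x0) R \<times> E"
    have O: "open ?O" using E(1) by (intro open_Times) auto
    have "Ck_on k ?O (\<lambda>x. \<phi> (snd x))" for k
      by (rule Ck_on_compose[OF O assms(1) Ck_on_snd[OF O Ck_on_id[OF O]] smooth_on_Ck[OF sm]]) (use E in auto)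
    then show "smooth_on ?O F"
      unfolding smooth_on_def F_def case_prod_beta
      by (intro allI Ck_on_diff Ck_on_bounded_linear[OF blinfun.bounded_linear_right] Ck_on_fst Ck_on_snd Ck_on_id O)
    show "continuous_on (ball (\<phi> x0) R) g" using hom by (simp add: homeomorphism_def B_def)
    show "g ` ball (\<phi> x0) R \<subseteq> E" using R by auto
    show "g p = F (p, g p)" if "p \<in> ball (\<phi> x0) R" for p
    proof -
      have "\<phi> (g p) = p" using g(6) R that by blast
      then show ?thesis by (simp add: F_def blinfun.zero_right)
    qed
  qed (use lip in auto)
  show ?thesis
  proof
    have "\<phi> x0 \<in> B" using R by (simp add: B_def)
    then show "x0 \<in> S" unfolding S_def using g(2) by (metis imageI)
    show "S \<subseteq> U" using SU' U'(2) by blast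
    show "0 < R" by (rule R(1))
    show "diffeomorphism S (ball (\<phi> x0) R) \<phi> g"
      unfolding diffeomorphism_def B_def[symmetric]
      using hom \<open>open S\<close> \<open>smooth_on B g\<close> smooth_on_subset[OF sm \<open>S \<subseteq> U\<close>] by (simp add: B_def)
  qed
qed

lemma open_image_if_derivative_surj:
  fixes f :: "'a::euclidean_space \<Rightarrow> 'b::euclidean_space"
  assumes "open W" "smooth_on W f" "\<And>p. p \<in> W \<Longrightarrow> surj (frechet_derivative f (at p))"
  shows "open (f ` W)"
proof -
  have "y \<in> interior (f ` W)" if "y \<in> f ` W" for y
  proof -
    from that obtain p where p: "p \<in> W" "y = f p" by blast
  note der = smooth_on_has_derivative[OF assms(2) p(1)]
  obtain h where h: "linear h" "frechet_derivative f (at p) \<circ> h = id"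
    using linear_surjective_right_inverse[OF has_derivative_linear[OF der] assms(3)[OF p(1)]] by blast
  have "f p \<in> interior (f ` W)"
    by (rule sussmann_open_mapping[OF assms(1) Ck_on_imp_continuous_on[OF smooth_on_Ck[OF assms(2)]] p(1) der _ h(2) order_refl])
      (use h(1) linear_conv_bounded_linear assms(1) p(1) in \<open>auto simp: interior_open\<close>)
  then show "y \<in> interior (f ` W)" using p(2) by simp
  qed
  then have "interior (f ` W) = f ` W" using interior_subset by blast
  then show ?thesis by (simp only: interior_eq)
qed

lemma diffeomorphism_sym: "diffeomorphism S T \<phi> \<psi> \<Longrightarrow> diffeomorphism T S \<psi> \<phi>"
  unfolding diffeomorphism_def using homeomorphism_symD by blast

lemma diffeomorphism_apply:
  assumes "diffeomorphism S T \<phi> \<psi>" "x \<in> S"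
  shows "\<phi> x \<in> T" "\<psi> (\<phi> x) = x"
  using assms unfolding diffeomorphism_def homeomorphism_def by auto

lemma diffeomorphism_smooth:
  assumes "diffeomorphism S T \<phi> \<psi>"
  shows "smooth_on S \<phi>" "smooth_on T \<psi>" "open S" "open T" "\<phi> ` S = T"
  using assms unfolding diffeomorphism_def homeomorphism_def by auto

lemma diffeomorphism_derivative_inverse:
  assumes d: "diffeomorphism S T \<phi> \<psi>" and x: "x \<in> S"
  shows "frechet_derivative \<psi> (at (\<phi> x)) (frechet_derivative \<phi> (at x) v) = v"
proof -
  have "((\<lambda>y. \<psi> (\<phi> y)) has_derivative
      (\<lambda>v. frechet_derivative \<psi> (at (\<phi> x)) (frechet_derivative \<phi> (at x) v))) (at x)"
    by (rule has_derivative_compose[OF smooth_on_has_derivative[OF diffeomorphism_smooth(1)[OF d] x]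
          smooth_on_has_derivative[OF diffeomorphism_smooth(2)[OF d] diffeomorphism_apply(1)[OF d x]]])
  then have "((\<lambda>y. y) has_derivative
      (\<lambda>v. frechet_derivative \<psi> (at (\<phi> x)) (frechet_derivative \<phi> (at x) v))) (at x)"
    by (rule has_derivative_transform_within_open[OF _ diffeomorphism_smooth(3)[OF d] x])
      (rule diffeomorphism_apply(2)[OF d])
  from has_derivative_unique[OF has_derivative_ident this] show ?thesis by metis
qed

section \<open>Second derivatives and Lie brackets\<close>

text \<open>
  The second difference of \<open>f\<close> in the directions \<open>s u\<close> and \<open>s v\<close> is symmetric in \<open>u\<close> and \<open>v\<close> and
  differs from \<open>s\<^sup>2\<close> times each of the two mixed derivatives by \<open>o(s\<^sup>2)\<close>.
\<close>

lemma second_derivative_symmetric: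
  fixes f :: "'a::euclidean_space \<Rightarrow> 'b::euclidean_space"
  assumes "open S" "p \<in> S" and sm: "smooth_on S f"
  shows "frechet_derivative (\<lambda>x. frechet_derivative f (at x) u) (at p) v =
    frechet_derivative (\<lambda>x. frechet_derivative f (at x) v) (at p) u"
proof -
  let ?D = "\<lambda>u x. frechet_derivative f (at x) u"
  let ?DD = "\<lambda>u v x. frechet_derivative (?D u) (at x) v"
  have der: "(f has_derivative (\<lambda>h. ?D h x)) (at x)" if "x \<in> S" for x
    using smooth_on_has_derivative[OF sm that] by simp
  have der2: "(?D u has_derivative (\<lambda>h. ?DD u h x)) (at x)" if "x \<in> S" for x u
    using smooth_on_has_derivative[OF smooth_on_frechet_derivative[OF sm] that] by simp
  have cont: "isCont (?DD u v) p" for u v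
    using Ck_on_imp_continuous_on[OF smooth_on_Ck[OF smooth_on_frechet_derivative[OF smooth_on_frechet_derivative[OF sm]]]]
      assms(1,2) continuous_on_eq_continuous_at by blast
  \<comment> \<open>the mean value inequality in the direction of \<open>u\<close>, then in that of \<open>v\<close>\<close>
  have key: "\<exists>d>0. \<forall>s. 0 < s \<and> s < d \<longrightarrow>
      norm (f (p + s *\<^sub>R u + s *\<^sub>R v) - f (p + s *\<^sub>R u) - f (p + s *\<^sub>R v) + f p - s\<^sup>2 *\<^sub>R ?DD u v p) \<le> e * s\<^sup>2"
    if e: "0 < e" for e u v
  proof -
    obtain d1 where d1: "0 < d1" "\<And>x. dist x p < d1 \<Longrightarrow> dist (?DD u v x) (?DD u v p) < e"
      using cont[of u v] e unfolding continuous_at_eps_delta by blast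
    obtain d2 where d2: "0 < d2" "ball p d2 \<subseteq> S" using assms(1,2) openE by blast
    define d where "d = min d1 d2 / (norm u + norm v + 1)"
    have pos: "0 < norm u + norm v + 1" by (simp add: add_nonneg_pos)
    have "0 < d" using d1 d2 pos by (simp add: d_def)
    show ?thesis
    proof (intro exI[of _ d] conjI allI impI, rule \<open>0 < d\<close>)
      fix s assume s: "0 < s \<and> s < d"
      have near: "dist (p + a *\<^sub>R u + b *\<^sub>R v) p < min d1 d2" if "a \<in> {0..s}" "b \<in> {0..s}" for a b
      proof -
        have "dist (p + a *\<^sub>R u + b *\<^sub>R v) p \<le> a * norm u + b * norm v"
          using norm_triangle_ineq[of "a *\<^sub>R u" "b *\<^sub>R v"] that by (simp add: dist_norm add.assoc)
        also have "\<dots> \<le> s * norm u + s * norm v" using that by (intro add_mono mult_right_mono) auto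
        also have "\<dots> < s * (norm u + norm v + 1)" using s by (simp add: distrib_left)
        also have "\<dots> < min d1 d2" using s pos by (simp add: d_def pos_less_divide_eq)
        finally show ?thesis .
      qed
      have inS: "p + a *\<^sub>R u + b *\<^sub>R v \<in> S" if "a \<in> {0..s}" "b \<in> {0..s}" for a b
        using near[OF that] d2(2) by (auto simp: dist_commute subset_iff)
      have inS0: "p + a *\<^sub>R u \<in> S" if "a \<in> {0..s}" for a using inS[OF that, of 0] s by simp
      have inner: "norm (?D u (p + a *\<^sub>R u + s *\<^sub>R v) - ?D u (p + a *\<^sub>R u) - s *\<^sub>R ?DD u v p) \<le> e * s"
        if a: "a \<in> {0..s}" for a
      proof -
        have "norm ((?D u (p + a *\<^sub>R u + s *\<^sub>R v) - s *\<^sub>R ?DD u v p)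
          - (?D u (p + a *\<^sub>R u + 0 *\<^sub>R v) - 0 *\<^sub>R ?DD u v p)) \<le> e * norm (s - 0)"
        proof (rule differentiable_bound[where S = "{0..s}" and f = "\<lambda>b. ?D u (p + a *\<^sub>R u + b *\<^sub>R v) - b *\<^sub>R ?DD u v p"])
          fix b assume b: "b \<in> {0..s}"
          have "((\<lambda>b. p + a *\<^sub>R u + b *\<^sub>R v) has_derivative (\<lambda>h. h *\<^sub>R v)) (at b)"
            by (auto intro!: derivative_eq_intros)
          from has_derivative_compose[OF this der2[OF inS[OF a b]]]
          have "((\<lambda>b. ?D u (p + a *\<^sub>R u + b *\<^sub>R v)) has_derivative (\<lambda>h. ?DD u (h *\<^sub>R v) (p + a *\<^sub>R u + b *\<^sub>R v))) (at b)" .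
          moreover have "?DD u (h *\<^sub>R v) x = h *\<^sub>R ?DD u v x" if "x \<in> S" for h x
            using linear_scale[OF has_derivative_linear[OF der2[OF that]]] .
          ultimately have "((\<lambda>b. ?D u (p + a *\<^sub>R u + b *\<^sub>R v) - b *\<^sub>R ?DD u v p) has_derivative
              (\<lambda>h. h *\<^sub>R ?DD u v (p + a *\<^sub>R u + b *\<^sub>R v) - h *\<^sub>R ?DD u v p)) (at b)"
            using inS[OF a b]
            by (intro has_derivative_diff has_derivative_scaleR_left has_derivative_ident) simp
          then show "((\<lambda>b. ?D u (p + a *\<^sub>R u + b *\<^sub>R v) - b *\<^sub>R ?DD u v p) has_derivative
              (\<lambda>h. h *\<^sub>R ?DD u v (p + a *\<^sub>R u + b *\<^sub>R v) - h *\<^sub>R ?DD u v p)) (at b within {0..s})"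
            by (rule has_derivative_at_withinI)
          show "onorm (\<lambda>h. h *\<^sub>R ?DD u v (p + a *\<^sub>R u + b *\<^sub>R v) - h *\<^sub>R ?DD u v p) \<le> e"
          proof (rule onorm_bound)
            fix h :: real
            have "norm (?DD u v (p + a *\<^sub>R u + b *\<^sub>R v) - ?DD u v p) \<le> e"
              using d1(2)[of "p + a *\<^sub>R u + b *\<^sub>R v"] near[OF a b] by (simp add: dist_norm)
            then have "\<bar>h\<bar> * norm (?DD u v (p + a *\<^sub>R u + b *\<^sub>R v) - ?DD u v p) \<le> \<bar>h\<bar> * e"
              by (rule mult_left_mono) simp
            then show "norm (h *\<^sub>R ?DD u v (p + a *\<^sub>R u + b *\<^sub>R v) - h *\<^sub>R ?DD u v p) \<le> e * norm h"
              unfolding scaleR_diff_right[symmetric] norm_scaleR by (simp add: mult.commute)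
          qed (use e in simp)
        qed (use s in auto)
        then show ?thesis using s by (simp add: algebra_simps)
      qed
      have "norm ((f (p + s *\<^sub>R u + s *\<^sub>R v) - f (p + s *\<^sub>R u) - s *\<^sub>R (s *\<^sub>R ?DD u v p))
         - (f (p + 0 *\<^sub>R u + s *\<^sub>R v) - f (p + 0 *\<^sub>R u) - 0 *\<^sub>R (s *\<^sub>R ?DD u v p))) \<le> (e * s) * norm (s - 0)"
      proof (rule differentiable_bound[where S = "{0..s}"
            and f = "\<lambda>a. f (p + a *\<^sub>R u + s *\<^sub>R v) - f (p + a *\<^sub>R u) - a *\<^sub>R (s *\<^sub>R ?DD u v p)"])
        fix a assume a: "a \<in> {0..s}"
        have ss: "s \<in> {0..s}" using s by simp
        have hom: "?D (h *\<^sub>R u) x = h *\<^sub>R ?D u x" if "x \<in> S" for h x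
          using linear_scale[OF has_derivative_linear[OF der[OF that]]] .
        have "((\<lambda>a. p + a *\<^sub>R u + s *\<^sub>R v) has_derivative (\<lambda>h. h *\<^sub>R u)) (at a)"
          by (auto intro!: derivative_eq_intros)
        from has_derivative_compose[OF this der[OF inS[OF a ss]]]
        have 1: "((\<lambda>a. f (p + a *\<^sub>R u + s *\<^sub>R v)) has_derivative (\<lambda>h. h *\<^sub>R ?D u (p + a *\<^sub>R u + s *\<^sub>R v))) (at a)"
          using hom inS[OF a ss] by simp
        have "((\<lambda>a. p + a *\<^sub>R u) has_derivative (\<lambda>h. h *\<^sub>R u)) (at a)"
          by (auto intro!: derivative_eq_intros)
        from has_derivative_compose[OF this der[OF inS0[OF a]]]
        have 2: "((\<lambda>a. f (p + a *\<^sub>R u)) has_derivative (\<lambda>h. h *\<^sub>R ?D u (p + a *\<^sub>R u))) (at a)"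
          using hom inS0[OF a] by simp
        show "((\<lambda>a. f (p + a *\<^sub>R u + s *\<^sub>R v) - f (p + a *\<^sub>R u) - a *\<^sub>R (s *\<^sub>R ?DD u v p)) has_derivative
           (\<lambda>h. h *\<^sub>R ?D u (p + a *\<^sub>R u + s *\<^sub>R v) - h *\<^sub>R ?D u (p + a *\<^sub>R u) - h *\<^sub>R (s *\<^sub>R ?DD u v p))) (at a within {0..s})"
          by (intro has_derivative_diff has_derivative_scaleR_left has_derivative_ident
              has_derivative_at_withinI[OF 1] has_derivative_at_withinI[OF 2])
        show "onorm (\<lambda>h. h *\<^sub>R ?D u (p + a *\<^sub>R u + s *\<^sub>R v) - h *\<^sub>R ?D u (p + a *\<^sub>R u) - h *\<^sub>R (s *\<^sub>R ?DD u v p)) \<le> e * s"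
        proof (rule onorm_bound)
          fix h :: real
          show "norm (h *\<^sub>R ?D u (p + a *\<^sub>R u + s *\<^sub>R v) - h *\<^sub>R ?D u (p + a *\<^sub>R u) - h *\<^sub>R (s *\<^sub>R ?DD u v p)) \<le> e * s * norm h"
            using mult_left_mono[OF inner[OF a], of "\<bar>h\<bar>"]
            unfolding scaleR_diff_right[symmetric] norm_scaleR by (simp add: mult.commute)
        qed (use e s in simp)
      qed (use s in auto)
      then show "norm (f (p + s *\<^sub>R u + s *\<^sub>R v) - f (p + s *\<^sub>R u) - f (p + s *\<^sub>R v) + f p - s\<^sup>2 *\<^sub>R ?DD u v p) \<le> e * s\<^sup>2"
        using s by (simp add: power2_eq_square algebra_simps)
    qed
  qed
  have "norm (?DD u v p - ?DD v u p) \<le> 0 + e" if "0 < e" for e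
  proof -
    have e2: "0 < e / 2" using that by simp
    obtain d where d: "0 < d" "\<And>s. 0 < s \<and> s < d \<Longrightarrow> 
      norm (f (p + s *\<^sub>R u + s *\<^sub>R v) - f (p + s *\<^sub>R u) - f (p + s *\<^sub>R v) + f p - s\<^sup>2 *\<^sub>R ?DD u v p) \<le> e / 2 * s\<^sup>2"
      using key[OF e2, of u v] by blast
    obtain d' where d': "0 < d'" "\<And>s. 0 < s \<and> s < d' \<Longrightarrow> 
      norm (f (p + s *\<^sub>R v + s *\<^sub>R u) - f (p + s *\<^sub>R v) - f (p + s *\<^sub>R u) + f p - s\<^sup>2 *\<^sub>R ?DD v u p) \<le> e / 2 * s\<^sup>2"
      using key[OF e2, of v u] by blast
    define s where "s = min d d' / 2"
    have s: "0 < s" "s < d" "s < d'" using d(1) d'(1) by (auto simp: s_def)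
    define \<Delta> where "\<Delta> = f (p + s *\<^sub>R u + s *\<^sub>R v) - f (p + s *\<^sub>R u) - f (p + s *\<^sub>R v) + f p"
    have "f (p + s *\<^sub>R v + s *\<^sub>R u) - f (p + s *\<^sub>R v) - f (p + s *\<^sub>R u) + f p = \<Delta>"
      by (simp add: \<Delta>_def algebra_simps)
    then have 1: "norm (\<Delta> - s\<^sup>2 *\<^sub>R ?DD v u p) \<le> e / 2 * s\<^sup>2" using d'(2)[of s] s by simp
    have 2: "norm (\<Delta> - s\<^sup>2 *\<^sub>R ?DD u v p) \<le> e / 2 * s\<^sup>2" using d(2)[of s] s by (simp add: \<Delta>_def)
    have "s\<^sup>2 *\<^sub>R (?DD u v p - ?DD v u p) = (\<Delta> - s\<^sup>2 *\<^sub>R ?DD v u p) - (\<Delta> - s\<^sup>2 *\<^sub>R ?DD u v p)"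
      by (simp add: algebra_simps)
    then have "norm (s\<^sup>2 *\<^sub>R (?DD u v p - ?DD v u p)) \<le> e / 2 * s\<^sup>2 + e / 2 * s\<^sup>2"
      using norm_triangle_ineq4[of "\<Delta> - s\<^sup>2 *\<^sub>R ?DD v u p" "\<Delta> - s\<^sup>2 *\<^sub>R ?DD u v p"] 1 2
      by (simp only:)
    then have "s\<^sup>2 * norm (?DD u v p - ?DD v u p) \<le> s\<^sup>2 * e" by (simp add: mult.commute)
    then show ?thesis using s by (simp add: mult_le_cancel_left_pos)
  qed
  then have "norm (?DD u v p - ?DD v u p) \<le> 0" by (rule field_le_epsilon)
  then show ?thesis by simp
qed

lemma has_derivative_frechet_derivative_apply:
  fixes g :: "'a::euclidean_space \<Rightarrow> 'b::euclidean_space"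
  assumes "open S" "p \<in> S" "smooth_on S g" "smooth_on S v"
  shows "((\<lambda>x. frechet_derivative g (at x) (v x)) has_derivative
    (\<lambda>h. frechet_derivative (\<lambda>x. frechet_derivative g (at x) (v p)) (at p) h
       + frechet_derivative g (at p) (frechet_derivative v (at p) h))) (at p)"
proof -
  let ?D = "\<lambda>x. frechet_derivative g (at x)"
  have lin: "linear (?D x)" if "x \<in> S" for x
    using has_derivative_linear[OF smooth_on_has_derivative[OF assms(3) that]] .
  have dv: "(v has_derivative frechet_derivative v (at p)) (at p)"
    using smooth_on_has_derivative[OF assms(4,2)] .
  have dD: "((\<lambda>x. ?D x b) has_derivative frechet_derivative (\<lambda>x. ?D x b) (at p)) (at p)" for b
    using smooth_on_has_derivative[OF smooth_on_frechet_derivative[OF assms(3)] assms(2)] .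
  have *: "((\<lambda>x. \<Sum>b\<in>Basis. (v x \<bullet> b) *\<^sub>R ?D x b) has_derivative
    (\<lambda>h. \<Sum>b\<in>Basis. (v p \<bullet> b) *\<^sub>R frechet_derivative (\<lambda>x. ?D x b) (at p) h
        + (frechet_derivative v (at p) h \<bullet> b) *\<^sub>R ?D p b)) (at p)"
    by (intro has_derivative_sum has_derivative_scaleR dD has_derivative_inner_left dv)
  have 1: "(\<Sum>b\<in>Basis. (v p \<bullet> b) *\<^sub>R frechet_derivative (\<lambda>x. ?D x b) (at p) h)
      = frechet_derivative (\<lambda>x. ?D x (v p)) (at p) h" for h
  proof -
    have "((\<lambda>x. \<Sum>b\<in>Basis. (v p \<bullet> b) *\<^sub>R ?D x b) has_derivative
        (\<lambda>h. \<Sum>b\<in>Basis. (v p \<bullet> b) *\<^sub>R frechet_derivative (\<lambda>x. ?D x b) (at p) h)) (at p)"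
      by (intro has_derivative_sum has_derivative_scaleR_right dD)
    then have "((\<lambda>x. ?D x (v p)) has_derivative
        (\<lambda>h. \<Sum>b\<in>Basis. (v p \<bullet> b) *\<^sub>R frechet_derivative (\<lambda>x. ?D x b) (at p) h)) (at p)"
      by (rule has_derivative_transform_within_open[OF _ assms(1,2)]) (rule linear_basis_expansion[OF lin, symmetric], assumption)
    from frechet_derivative_apply_eq[OF this] show ?thesis by (rule sym)
  qed
  have 2: "(\<Sum>b\<in>Basis. (w \<bullet> b) *\<^sub>R ?D p b) = ?D p w" for w
    using linear_basis_expansion[OF lin[OF assms(2)], of w] by simp
  have "((\<lambda>x. \<Sum>b\<in>Basis. (v x \<bullet> b) *\<^sub>R ?D x b) has_derivative
    (\<lambda>h. frechet_derivative (\<lambda>x. ?D x (v p)) (at p) h + ?D p (frechet_derivative v (at p) h))) (at p)"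
    using * unfolding sum.distrib 1 2 .
  then show ?thesis
    by (rule has_derivative_transform_within_open[OF _ assms(1,2)]) (rule linear_basis_expansion[OF lin, symmetric], assumption)
qed

text \<open>
  The bracket is built from first derivatives of the fields; expanding both terms on the right by the
  product rule, the second derivatives of \<open>g\<close> cancel by symmetry. This is how brackets are pushed
  forward and how involutivity is verified below.
\<close>

lemma frechet_derivative_lie_bracket:
  fixes g :: "'a::euclidean_space \<Rightarrow> 'b::euclidean_space"
  assumes "open S" "p \<in> S" "smooth_on S g" "smooth_on S v" "smooth_on S w"
  shows "frechet_derivative g (at p) (lie_bracket v w p) =
    frechet_derivative (\<lambda>x. frechet_derivative g (at x) (w x)) (at p) (v p) -
    frechet_derivative (\<lambda>x. frechet_derivative g (at x) (v x)) (at p) (w p)"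
proof -
  have lin: "linear (frechet_derivative g (at p))"
    using has_derivative_linear[OF smooth_on_has_derivative[OF assms(3,2)]] .
  show ?thesis
    unfolding frechet_derivative_at[OF has_derivative_frechet_derivative_apply[OF assms(1-3,4)], symmetric]
      frechet_derivative_at[OF has_derivative_frechet_derivative_apply[OF assms(1-3,5)], symmetric]
      lie_bracket_def linear_diff[OF lin]
    using second_derivative_symmetric[OF assms(1-3)] by simp
qed

text \<open>
  Along \<open>f\<close>-related fields \<open>df v = w \<circ> f\<close>, so the chain rule turns the right-hand side of
  \<open>frechet_derivative_lie_bracket\<close> into the bracket of the projected fields.
\<close>

lemma lie_bracket_related_fields:
  fixes f :: "'a::euclidean_space \<Rightarrow> 'b::euclidean_space"
  assumes W: "open W" "p \<in> W" and V: "open V" "f ` W \<subseteq> V"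
    and sm: "smooth_on W f" "smooth_on W v" "smooth_on W v'" "smooth_on V w" "smooth_on V w'"
    and rel: "\<And>p. p \<in> W \<Longrightarrow> frechet_derivative f (at p) (v p) = w (f p)"
      "\<And>p. p \<in> W \<Longrightarrow> frechet_derivative f (at p) (v' p) = w' (f p)"
  shows "frechet_derivative f (at p) (lie_bracket v v' p) = lie_bracket w w' (f p)"
proof -
  have fp: "f p \<in> V" using W V by blast
  have D: "frechet_derivative (\<lambda>x. frechet_derivative f (at x) (u x)) (at p) h =
      frechet_derivative y (at (f p)) (frechet_derivative f (at p) h)"
    if "smooth_on V y" "\<And>p. p \<in> W \<Longrightarrow> frechet_derivative f (at p) (u p) = y (f p)" for u y h
  proof -
    have "((\<lambda>x. y (f x)) has_derivative (\<lambda>h. frechet_derivative y (at (f p)) (frechet_derivative f (at p) h))) (at p)"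
      by (rule has_derivative_compose[OF smooth_on_has_derivative[OF sm(1) W(2)] smooth_on_has_derivative[OF that(1) fp]])
    then have "((\<lambda>x. frechet_derivative f (at x) (u x)) has_derivative
        (\<lambda>h. frechet_derivative y (at (f p)) (frechet_derivative f (at p) h))) (at p)"
      by (rule has_derivative_transform_within_open[OF _ W]) (simp add: that(2))
    from frechet_derivative_apply_eq[OF this] show ?thesis .
  qed
  have "frechet_derivative (\<lambda>x. frechet_derivative f (at x) (v' x)) (at p) (v p) =
      frechet_derivative w' (at (f p)) (w (f p))"
    unfolding rel(1)[OF W(2), symmetric] by (rule D[OF sm(5)]) (rule rel(2))
  moreover have "frechet_derivative (\<lambda>x. frechet_derivative f (at x) (v x)) (at p) (v' p) =
      frechet_derivative w (at (f p)) (w' (f p))"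
    unfolding rel(2)[OF W(2), symmetric] by (rule D[OF sm(4)]) (rule rel(1))
  ultimately show ?thesis
    unfolding frechet_derivative_lie_bracket[OF W sm(1-3)] by (simp add: lie_bracket_def)
qed

text \<open>
  Involutivity is a property of the span: the derivatives of the coefficients only contribute
  multiples of the frame.
\<close>

lemma lie_bracket_in_span_combination:
  fixes w :: "'i \<Rightarrow> 'a::euclidean_space \<Rightarrow> 'a"
  assumes "finite J"
    and w: "\<And>i. i \<in> J \<Longrightarrow> w i differentiable (at p)"
    and f: "\<And>i. i \<in> J \<Longrightarrow> f i differentiable (at p)" and g: "\<And>i. i \<in> J \<Longrightarrow> g i differentiable (at p)"
    and br: "\<And>i j. i \<in> J \<Longrightarrow> j \<in> J \<Longrightarrow> lie_bracket (w i) (w j) p \<in> span ((\<lambda>i. w i p) ` J)"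
  shows "lie_bracket (\<lambda>x. \<Sum>i\<in>J. f i x *\<^sub>R w i x) (\<lambda>x. \<Sum>i\<in>J. g i x *\<^sub>R w i x) p \<in> span ((\<lambda>i. w i p) ` J)"
proof -
  let ?S = "span ((\<lambda>i. w i p) ` J)"
  let ?D = "\<lambda>i. frechet_derivative (w i) (at p)"
  have wS: "w i p \<in> ?S" if "i \<in> J" for i using that by (intro span_base) auto
  have D: "frechet_derivative (\<lambda>x. \<Sum>i\<in>J. f i x *\<^sub>R w i x) (at p) h =
      (\<Sum>i\<in>J. f i p *\<^sub>R ?D i h + frechet_derivative (f i) (at p) h *\<^sub>R w i p)"
    if "\<And>i. i \<in> J \<Longrightarrow> f i differentiable (at p)" for f :: "'i \<Rightarrow> 'a \<Rightarrow> real" and h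
  proof -
    have "((\<lambda>x. \<Sum>i\<in>J. f i x *\<^sub>R w i x) has_derivative
      (\<lambda>h. \<Sum>i\<in>J. f i p *\<^sub>R ?D i h + frechet_derivative (f i) (at p) h *\<^sub>R w i p)) (at p)"
      by (intro has_derivative_sum has_derivative_scaleR that[unfolded frechet_derivative_works]
          w[unfolded frechet_derivative_works])
    from frechet_derivative_apply_eq[OF this] show ?thesis .
  qed
  have Df: "frechet_derivative (\<lambda>x. \<Sum>i\<in>J. f i x *\<^sub>R w i x) (at p) h =
      (\<Sum>i\<in>J. f i p *\<^sub>R ?D i h + frechet_derivative (f i) (at p) h *\<^sub>R w i p)" for h
    by (rule D) (rule f)
  have Dg: "frechet_derivative (\<lambda>x. \<Sum>i\<in>J. g i x *\<^sub>R w i x) (at p) h =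
      (\<Sum>i\<in>J. g i p *\<^sub>R ?D i h + frechet_derivative (g i) (at p) h *\<^sub>R w i p)" for h
    by (rule D) (rule g)
  have lin: "linear (?D i)" if "i \<in> J" for i using w[OF that] linear_frechet_derivative by blast
  have E: "(\<Sum>i\<in>J. a i *\<^sub>R ?D i (\<Sum>j\<in>J. b j *\<^sub>R w j p)) = (\<Sum>i\<in>J. \<Sum>j\<in>J. (a i * b j) *\<^sub>R ?D i (w j p))" for a b
    by (rule sum.cong) (simp_all add: linear_sum[OF lin] linear_scale[OF lin] scaleR_sum_right)
  have "lie_bracket (\<lambda>x. \<Sum>i\<in>J. f i x *\<^sub>R w i x) (\<lambda>x. \<Sum>i\<in>J. g i x *\<^sub>R w i x) p =
    ((\<Sum>i\<in>J. \<Sum>j\<in>J. (g i p * f j p) *\<^sub>R ?D i (w j p)) - (\<Sum>i\<in>J. \<Sum>j\<in>J. (f i p * g j p) *\<^sub>R ?D i (w j p))) +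
    ((\<Sum>i\<in>J. frechet_derivative (g i) (at p) (\<Sum>i\<in>J. f i p *\<^sub>R w i p) *\<^sub>R w i p)
      - (\<Sum>i\<in>J. frechet_derivative (f i) (at p) (\<Sum>i\<in>J. g i p *\<^sub>R w i p) *\<^sub>R w i p))"
    unfolding lie_bracket_def Df Dg sum.distrib E by simp
  also have "(\<Sum>i\<in>J. \<Sum>j\<in>J. (f i p * g j p) *\<^sub>R ?D i (w j p)) = (\<Sum>i\<in>J. \<Sum>j\<in>J. (g i p * f j p) *\<^sub>R ?D j (w i p))"
    by (subst sum.swap) (simp add: mult.commute)
  also have "(\<Sum>i\<in>J. \<Sum>j\<in>J. (g i p * f j p) *\<^sub>R ?D i (w j p)) - (\<Sum>i\<in>J. \<Sum>j\<in>J. (g i p * f j p) *\<^sub>R ?D j (w i p))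
      = (\<Sum>i\<in>J. \<Sum>j\<in>J. (g i p * f j p) *\<^sub>R lie_bracket (w j) (w i) p)"
    by (simp add: lie_bracket_def scaleR_diff_right sum_subtractf)
  finally show ?thesis
    using br wS by (auto intro!: span_add span_diff span_sum span_scale)
qed

section \<open>The joint flow of a commuting frame\<close>

lemma linear_family_bounded_on_compact:
  fixes L :: "'x::topological_space \<Rightarrow> 'a::euclidean_space \<Rightarrow> 'b::real_normed_vector"
  assumes "compact K" and lin: "\<And>x. x \<in> K \<Longrightarrow> linear (L x)"
    and cont: "\<And>b. b \<in> Basis \<Longrightarrow> continuous_on K (\<lambda>x. L x b)"
  obtains C where "0 < C" "\<And>x v. x \<in> K \<Longrightarrow> norm (L x v) \<le> C * norm v"
proof -
  have "\<exists>B>0. \<forall>x\<in>K. norm (L x b) \<le> B" if "b \<in> Basis" for b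
    using compact_imp_bounded[OF compact_continuous_image[OF cont[OF that] assms(1)]]
    unfolding bounded_pos by auto
  then obtain B where B: "\<And>b. b \<in> Basis \<Longrightarrow> 0 < B b" "\<And>b x. b \<in> Basis \<Longrightarrow> x \<in> K \<Longrightarrow> norm (L x b) \<le> B b"
    by metis
  show ?thesis
  proof
    show "0 < (\<Sum>b\<in>Basis. B b)" using B(1) by (intro sum_pos) auto
    fix x v assume x: "x \<in> K"
    have "norm (L x v) \<le> (\<Sum>b\<in>Basis. B b * norm v)"
      unfolding linear_basis_expansion[OF lin[OF x], of v]
    proof (rule sum_norm_le)
      fix b :: 'a assume b: "b \<in> Basis"
      show "norm ((v \<bullet> b) *\<^sub>R L x b) \<le> B b * norm v"
        using mult_mono[OF Basis_le_norm[OF b, of v] B(2)[OF b x]] by (simp add: mult.commute)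
    qed
    then show "norm (L x v) \<le> (\<Sum>b\<in>Basis. B b) * norm v" by (simp add: sum_distrib_right)
  qed
qed

text \<open>
  \<open>G (y, z)\<close> is the point reached at time 1 from \<open>x0 + z\<close> along the field \<open>w y\<close>. Since the flow of
  \<open>w (s y)\<close> at time 1 is the flow of \<open>w y\<close> at time \<open>s\<close>, it satisfies the fixed-point equation
  \<open>G (y, z) = x0 + z + \<integral> w\<^sub>y (G (s y, z)) ds\<close> over the unit interval, which is a contraction for small \<open>y\<close>.
  The substitution \<open>s = \<theta> t\<close> with \<open>\<theta>\<close> a rescaled sine makes the scaling factor bounded by \<open>1\<close> for
  all real \<open>t\<close>.

  That the \<open>y\<close>-derivatives of \<open>G\<close> are the frame is where commutativity enters: by \<open>[w b, w y] = 0\<close>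
  the fields \<open>w b\<close> along the flow solve the same inhomogeneous linear equation as \<open>\<partial>\<^sub>b G\<close>, and the
  difference \<open>\<epsilon>\<close> of the two solves the homogeneous one, hence vanishes.
\<close>

lemma commuting_frame_flow:
  fixes w :: "'a::euclidean_space \<Rightarrow> 'a \<Rightarrow> 'a"
  assumes "open U" "x0 \<in> U"
    and lin: "\<And>x. x \<in> U \<Longrightarrow> linear (\<lambda>v. w v x)"
    and sm: "\<And>v. smooth_on U (w v)"
    and comm: "\<And>u v x. x \<in> U \<Longrightarrow> lie_bracket (w u) (w v) x = 0"
  obtains R and G :: "'a \<times> 'a \<Rightarrow> 'a" where "0 < R" "smooth_on (ball 0 R) G" "G ` ball 0 R \<subseteq> U"
    "\<And>z. norm z < R \<Longrightarrow> G (0, z) = x0 + z"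
    "\<And>p v. p \<in> ball 0 R \<Longrightarrow> frechet_derivative G (at p) (v, 0) = w v (G p)"
proof -
  define Dw where "Dw v x = frechet_derivative (w v) (at x)" for v x
  have Dw: "(w v has_derivative Dw v x) (at x)" if "x \<in> U" for v x
    unfolding Dw_def using smooth_on_has_derivative[OF sm that] .
  have wsum: "w v x = (\<Sum>b\<in>Basis. (v \<bullet> b) *\<^sub>R w b x)" if "x \<in> U" for v x
    using linear_basis_expansion[OF lin[OF that], of v] .
  have Dwsum: "Dw v x h = (\<Sum>b\<in>Basis. (v \<bullet> b) *\<^sub>R Dw b x h)" if "x \<in> U" for v x h
  proof -
    have "((\<lambda>x. \<Sum>b\<in>Basis. (v \<bullet> b) *\<^sub>R w b x) has_derivative (\<lambda>h. \<Sum>b\<in>Basis. (v \<bullet> b) *\<^sub>R Dw b x h)) (at x)"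
      by (intro has_derivative_sum has_derivative_scaleR_right Dw that)
    then have "(w v has_derivative (\<lambda>h. \<Sum>b\<in>Basis. (v \<bullet> b) *\<^sub>R Dw b x h)) (at x)"
      by (rule has_derivative_transform_within_open[OF _ assms(1) that]) (use wsum in simp)
    from frechet_derivative_apply_eq[OF this] show ?thesis unfolding Dw_def .
  qed
  have Dw_sym: "Dw u x (w v x) = Dw v x (w u x)" if "x \<in> U" for u v x
    using comm[OF that, of u v] unfolding lie_bracket_def Dw_def by simp
  obtain \<rho> where \<rho>: "0 < \<rho>" "cball x0 \<rho> \<subseteq> U" using assms(1,2) open_contains_cball by blast
  define K where "K = cball x0 \<rho>"
  have K: "compact K" "convex K" "K \<subseteq> U" using \<rho> by (auto simp: K_def)
  have wcont: "continuous_on U (w v)" for v using Ck_on_imp_continuous_on[OF smooth_on_Ck[OF sm]] .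
  have Dwcont: "continuous_on U (\<lambda>x. Dw v x h)" for v h
    unfolding Dw_def using Ck_on_imp_continuous_on[OF smooth_on_Ck[OF smooth_on_frechet_derivative[OF sm]]] .
  obtain C1 where C1: "0 < C1" "\<And>x v. x \<in> K \<Longrightarrow> norm (w v x) \<le> C1 * norm v"
    by (rule linear_family_bounded_on_compact[OF K(1), of "\<lambda>x v. w v x"])
      (use lin K(3) wcont continuous_on_subset in blast)+
  have "\<exists>C>0. \<forall>x\<in>K. \<forall>h. norm (Dw b x h) \<le> C * norm h" for b
  proof (rule linear_family_bounded_on_compact[OF K(1), of "\<lambda>x. Dw b x"])
    show "linear (Dw b x)" if "x \<in> K" for x using has_derivative_linear[OF Dw] K(3) that by blast
    show "continuous_on K (\<lambda>x. Dw b x h)" for h by (rule continuous_on_subset[OF Dwcont K(3)])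
  qed blast
  then obtain B where B: "\<And>b. 0 < B b" "\<And>b x h. x \<in> K \<Longrightarrow> norm (Dw b x h) \<le> B b * norm h" by metis
  define C where "C = C1 + (\<Sum>b\<in>Basis. B b)"
  have C: "0 < C" unfolding C_def
    by (rule add_pos_nonneg[OF C1(1) sum_nonneg[OF less_imp_le[OF B(1)]]])
  have wC: "norm (w v x) \<le> C * norm v" if "x \<in> K" for v x
  proof -
    have "0 \<le> (\<Sum>b\<in>Basis. B b)" by (rule sum_nonneg) (rule less_imp_le[OF B(1)])
    then have "C1 * norm v \<le> C * norm v"
      unfolding C_def by (intro mult_right_mono) auto
    then show ?thesis using C1(2)[OF that] order_trans by blast
  qed
  have DwC: "norm (Dw v x h) \<le> C * norm v * norm h" if x: "x \<in> K" for v x h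
  proof -
    have "norm (Dw v x h) \<le> (\<Sum>b\<in>Basis. B b * (norm v * norm h))"
      unfolding Dwsum[OF subsetD[OF K(3) x], of v]
    proof (rule sum_norm_le)
      fix b :: 'a assume b: "b \<in> Basis"
      show "norm ((v \<bullet> b) *\<^sub>R Dw b x h) \<le> B b * (norm v * norm h)"
        using mult_mono[OF Basis_le_norm[OF b, of v] B(2)[OF x, of b h]] by (simp add: mult_ac)
    qed
    also have "\<dots> = (\<Sum>b\<in>Basis. B b) * (norm v * norm h)" by (simp add: sum_distrib_right)
    also have "\<dots> \<le> C * (norm v * norm h)" unfolding C_def using C1(1) by (intro mult_right_mono) auto
    finally show ?thesis by (simp add: mult.assoc)
  qed
  have wlip: "norm (w v x - w v y) \<le> C * norm v * norm (x - y)" if "x \<in> K" "y \<in> K" for v x y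
  proof (rule differentiable_bound[OF K(2)])
    show "(w v has_derivative Dw v x) (at x within K)" if "x \<in> K" for x
      using Dw K(3) that has_derivative_at_withinI by blast
    show "onorm (Dw v x) \<le> C * norm v" if "x \<in> K" for x
      using DwC[OF that] C by (intro onorm_bound) auto
  qed (use that in auto)
  define \<theta> where "\<theta> t = sin (pi / 2 * t)" for t :: real
  define \<theta>' where "\<theta>' t = pi / 2 * cos (pi / 2 * t)" for t :: real
  have \<theta>: "\<theta> 0 = 0" "\<theta> 1 = 1" "\<And>t. \<bar>\<theta> t\<bar> \<le> 1" by (auto simp: \<theta>_def)
  have \<theta>01: "\<theta> t \<in> {0..1}" if "t \<in> {0..1}" for t
  proof -
    have "pi / 2 * t \<le> pi" using that mult_left_le[of t "pi / 2"] pi_gt_zero by simp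
    then show ?thesis using that unfolding \<theta>_def by (auto intro!: sin_ge_zero)
  qed
  have \<theta>'_le: "\<bar>\<theta>' t\<bar> \<le> 2" for t
  proof -
    have "\<bar>\<theta>' t\<bar> \<le> pi / 2 * 1" unfolding \<theta>'_def abs_mult by (intro mult_mono) auto
    then show ?thesis using pi_less_4 by linarith
  qed
  have \<theta>_der: "(\<theta> has_field_derivative \<theta>' t) (at t within T)" for t T
    unfolding \<theta>_def[abs_def] \<theta>'_def by (auto intro!: derivative_eq_intros)
  have \<theta>'_cont: "continuous_on T \<theta>'" for T
    unfolding \<theta>'_def[abs_def] by (intro continuous_intros)
  have \<theta>_cont: "continuous_on T \<theta>" for T
    unfolding \<theta>_def[abs_def] by (intro continuous_intros)
  define c where "c b t = (if snd b = 0 then \<theta> t else 1)" for b :: "'a \<times> 'a" and t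
  interpret diagonal_contraction c
  proof
    show "smooth_on UNIV (c b)" for b
    proof (cases "snd b = 0")
      case True
      then have "c b = (\<lambda>t. sin (pi / 2 * t))" by (simp add: c_def[abs_def] \<theta>_def)
      then show ?thesis by (simp only: smooth_on_def Ck_on_sin_cos simp_thms)
    next
      case False
      then have "c b = (\<lambda>t. 1)" by (simp add: c_def[abs_def])
      then show ?thesis by (simp add: smooth_on_const)
    qed
    show "\<bar>c b t\<bar> \<le> 1" for b t using \<theta>(3) by (simp add: c_def)
  qed
  have \<sigma>_eq: "\<sigma> t (y, z) = (\<theta> t *\<^sub>R y, z)" for t y z
  proof (rule euclidean_eqI)
    fix b :: "'a \<times> 'a" assume b: "b \<in> Basis"
    then show "\<sigma> t (y, z) \<bullet> b = (\<theta> t *\<^sub>R y, z) \<bullet> b"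
      unfolding \<sigma>_inner[OF b] by (auto simp: Basis_prod_def c_def)
  qed
  \<comment> \<open>the first bound keeps the flow within distance \<open>\<rho> / 2\<close> of \<open>x0\<close>, the second makes it a contraction;
    the factor 2 bounds \<open>\<theta>'\<close>\<close>
  define R where "R = min (\<rho> / (2 * (1 + 2 * C))) (1 / (4 * C))"
  have R: "0 < R" "R * (1 + 2 * C) \<le> \<rho> / 2" "2 * C * R \<le> 1 / 2"
  proof -
    show "0 < R" using \<rho>(1) C by (simp add: R_def)
    have "R \<le> \<rho> / (2 * (1 + 2 * C))" by (simp add: R_def)
    then show "R * (1 + 2 * C) \<le> \<rho> / 2" using C by (simp add: field_simps)
    have "R \<le> 1 / (4 * C)" by (simp add: R_def)
    then show "2 * C * R \<le> 1 / 2" using C by (simp add: field_simps)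
  qed
  define F where "F = (\<lambda>(t, p, e). x0 + snd p + \<theta>' t *\<^sub>R w (fst p) e)"
  have np: "norm (fst p) \<le> R" "norm (snd p) \<le> R" if "p \<in> cball (0 :: 'a \<times> 'a) R" for p
    using that norm_fst_le[of "fst p" "snd p"] norm_snd_le[of "snd p" "fst p"] by auto
  have CR: "C * norm (fst p) \<le> C * R" if "p \<in> cball (0 :: 'a \<times> 'a) R" for p
    using mult_left_mono[OF np(1)[OF that], of C] C by simp
  have wR: "norm (w (fst p) e) \<le> C * R" if "p \<in> cball (0 :: 'a \<times> 'a) R" "e \<in> K" for p e
    using order_trans[OF wC[OF that(2)] CR[OF that(1)]] .
  have wlipR: "norm (w (fst p) e - w (fst p) e') \<le> C * R * norm (e - e')"
    if "p \<in> cball (0 :: 'a \<times> 'a) R" "e \<in> K" "e' \<in> K" for p e e'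
    using order_trans[OF wlip[OF that(2,3)] mult_right_mono[OF CR[OF that(1)] norm_ge_zero]] .
  have DwR: "norm (Dw (fst p) e h) \<le> C * R * norm h" if "p \<in> cball (0 :: 'a \<times> 'a) R" "e \<in> K" for p e h
    using order_trans[OF DwC[OF that(2)] mult_right_mono[OF CR[OF that(1)] norm_ge_zero]] .
  have lip: "norm (F (t, p, e) - F (t, p, e')) \<le> norm (e - e') / 2"
    if "p \<in> cball 0 R" "e \<in> K" "e' \<in> K" for t p e e'
  proof -
    have "norm (F (t, p, e) - F (t, p, e')) = \<bar>\<theta>' t\<bar> * norm (w (fst p) e - w (fst p) e')"
      unfolding F_def by (simp flip: scaleR_diff_right)
    also have "\<dots> \<le> 2 * (C * R * norm (e - e'))"
      by (rule mult_mono[OF \<theta>'_le wlipR[OF that]]) auto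
    also have "\<dots> \<le> 1 / 2 * norm (e - e')"
      using mult_right_mono[OF R(3), of "norm (e - e')"] by (simp add: mult_ac)
    finally show ?thesis by simp
  qed
  define E where "E = ball x0 \<rho>"
  have EK: "E \<subseteq> K" "cball x0 (\<rho> / 2) \<subseteq> E" using \<rho>(1) by (auto simp: E_def K_def)
  have EU: "cball x0 (\<rho> / 2) \<subseteq> U" using EK K(3) by blast
  have Fcont: "continuous_on ({0..1} \<times> cball 0 R \<times> cball x0 (\<rho> / 2)) F"
  proof -
    let ?S = "{0..1::real} \<times> cball (0 :: 'a \<times> 'a) R \<times> cball x0 (\<rho> / 2)"
    have "continuous_on ?S (\<lambda>x. x0 + snd (fst (snd x)) + \<theta>' (fst x) *\<^sub>R
        (\<Sum>b\<in>Basis. (fst (fst (snd x)) \<bullet> b) *\<^sub>R w b (snd (snd x))))"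
    proof (intro continuous_intros)
      show "continuous_on ?S (\<lambda>x. \<theta>' (fst x))"
        by (rule continuous_on_compose2[OF \<theta>'_cont[of UNIV]]) (auto intro!: continuous_intros)
      show "continuous_on ?S (\<lambda>x. w b (snd (snd x)))" for b
        by (rule continuous_on_compose2[OF wcont])
          (use subsetD[OF EU] in \<open>auto intro!: continuous_intros simp del: mem_cball\<close>)
    qed
    moreover have "F x = x0 + snd (fst (snd x)) + \<theta>' (fst x) *\<^sub>R
        (\<Sum>b\<in>Basis. (fst (fst (snd x)) \<bullet> b) *\<^sub>R w b (snd (snd x)))" if "x \<in> ?S" for x
    proof -
      have "snd (snd x) \<in> U" using that subsetD[OF EU] by (auto simp del: mem_cball)
      then show ?thesis unfolding F_def case_prod_beta using wsum by simp
    qed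
    ultimately show ?thesis by (simp cong: continuous_on_cong)
  qed
  obtain G where G0: "continuous_on (cball 0 R) G" "G ` cball 0 R \<subseteq> cball x0 (\<rho> / 2)"
    and G0_fixed: "\<And>p. p \<in> cball 0 R \<Longrightarrow> G p = integral {0..1} (\<lambda>t. F (t, p, G (\<sigma> t p)))"
  proof (rule averaged_fixed_point_exists[OF _ _ Fcont])
    show "norm (F (t, p, e) - F (t, p, e')) \<le> norm (e - e') / 2"
      if "p \<in> cball 0 R" "e \<in> cball x0 (\<rho> / 2)" "e' \<in> cball x0 (\<rho> / 2)" for t p e e'
      using lip[OF that(1)] that(2,3) EK by blast
    fix t p e assume "t \<in> {0..1::real}" and p: "p \<in> cball (0 :: 'a \<times> 'a) R" and e: "e \<in> cball x0 (\<rho> / 2)"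
    have "e \<in> K" using e EK by blast
    have "norm (F (t, p, e) - x0) \<le> norm (snd p) + \<bar>\<theta>' t\<bar> * norm (w (fst p) e)"
      unfolding F_def using norm_triangle_ineq[of "snd p" "\<theta>' t *\<^sub>R w (fst p) e"] by simp
    also have "\<dots> \<le> R + 2 * (C * R)"
      by (rule add_mono[OF np(2)[OF p] mult_mono[OF \<theta>'_le wR[OF p \<open>e \<in> K\<close>]]]) auto
    also have "\<dots> \<le> \<rho> / 2" using R(2) by (simp add: algebra_simps)
    finally show "F (t, p, e) \<in> cball x0 (\<rho> / 2)" by (simp add: dist_norm norm_minus_commute)
  qed (use R \<rho> in auto)
  have G: "continuous_on (ball 0 R) G" "G ` ball 0 R \<subseteq> E"
    "\<And>p. p \<in> ball 0 R \<Longrightarrow> G p = integral {0..1} (\<lambda>t. F (t, p, G (\<sigma> t p)))"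
  proof -
    have b: "ball 0 R \<subseteq> cball (0 :: 'a \<times> 'a) R" by (rule ball_subset_cball)
    show "continuous_on (ball 0 R) G" by (rule continuous_on_subset[OF G0(1) b])
    show "G ` ball 0 R \<subseteq> E" using G0(2) EK(2) b by blast
    show "G p = integral {0..1} (\<lambda>t. F (t, p, G (\<sigma> t p)))" if "p \<in> ball 0 R" for p
      by (rule G0_fixed[OF subsetD[OF b that]])
  qed
  have GK: "G p \<in> K" "G p \<in> U" if "p \<in> ball 0 R" for p using G(2) that EK K(3) by blast+
  let ?O = "(UNIV :: real set) \<times> ball (0 :: 'a \<times> 'a) R \<times> E"
  have O: "open ?O" by (intro open_Times) (auto simp: E_def)
  have Fsm: "smooth_on ?O F"
  proof -
    have "Ck_on k ?O (\<lambda>x. x0 + snd (fst (snd x)) + \<theta>' (fst x) *\<^sub>R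
        (\<Sum>b\<in>Basis. (fst (fst (snd x)) \<bullet> b) *\<^sub>R w b (snd (snd x))))" for k
    proof -
      have "Ck_on k ?O (\<lambda>x. cos (pi / 2 * fst x))"
        by (rule Ck_on_compose[OF O open_UNIV Ck_on_fst[OF O Ck_on_id[OF O]] Ck_on_sin_cos[THEN conjunct2]]) simp
      then have "Ck_on k ?O (\<lambda>x. \<theta>' (fst x))"
        unfolding \<theta>'_def by (intro Ck_on_mult Ck_on_const O)
      moreover have "Ck_on k ?O (\<lambda>x. w b (snd (snd x)))" for b
        by (rule Ck_on_compose[OF O assms(1) Ck_on_snd[OF O Ck_on_snd[OF O Ck_on_id[OF O]]] smooth_on_Ck[OF sm]])
          (use EK(1) K(3) in auto)
      ultimately show ?thesis
        by (intro Ck_on_add Ck_on_sum Ck_on_scaleR Ck_on_inner Ck_on_const Ck_on_snd Ck_on_fst Ck_on_id O)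
    qed
    note 1 = this
    have 2: "x0 + snd (fst (snd x)) + \<theta>' (fst x) *\<^sub>R
        (\<Sum>b\<in>Basis. (fst (fst (snd x)) \<bullet> b) *\<^sub>R w b (snd (snd x))) = F x" if "x \<in> ?O" for x
    proof -
      have "snd (snd x) \<in> U" using that EK K(3) by auto
      then show ?thesis unfolding F_def case_prod_beta using wsum by simp
    qed
    show ?thesis unfolding smooth_on_def using Ck_on_cong[OF O 2 1] by (rule allI)
  qed
  have F_dir: "frechet_derivative F (at (t, p, e)) (0, (b, 0), h) = \<theta>' t *\<^sub>R (w b e + Dw (fst p) e h)"
    if O': "(t, p, e) \<in> ?O" for t p e b h
  proof -
    have e: "e \<in> E" "e \<in> U" using O' EK(1) K(3) by auto
    let ?\<gamma> = "\<lambda>s::real. (t, (fst p + s *\<^sub>R b, snd p), e + s *\<^sub>R h)"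
    have \<gamma>: "(?\<gamma> has_derivative (\<lambda>s. (0, (s *\<^sub>R b, 0), s *\<^sub>R h))) (at 0)"
      by (auto intro!: derivative_eq_intros)
    have "(F has_derivative frechet_derivative F (at (t, p, e))) (at (?\<gamma> 0))"
      using smooth_on_has_derivative[OF Fsm O'] by simp
    from has_derivative_compose[OF \<gamma> this]
    have 1: "((\<lambda>s. F (?\<gamma> s)) has_derivative (\<lambda>s. frechet_derivative F (at (t, p, e)) (0, (s *\<^sub>R b, 0), s *\<^sub>R h))) (at 0)" .
    have wl: "((\<lambda>s. w v (e + s *\<^sub>R h)) has_derivative (\<lambda>s. Dw v e (s *\<^sub>R h))) (at 0)" for v
    proof -
      have "((\<lambda>s. e + s *\<^sub>R h) has_derivative (\<lambda>s. s *\<^sub>R h)) (at 0)"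
        by (auto intro!: derivative_eq_intros)
      moreover have "(w v has_derivative Dw v e) (at (e + 0 *\<^sub>R h))" using Dw[OF e(2)] by simp
      ultimately show ?thesis by (rule has_derivative_compose)
    qed
    have "((\<lambda>s. (x0 + snd p) + \<theta>' t *\<^sub>R (w (fst p) (e + s *\<^sub>R h) + s *\<^sub>R w b (e + s *\<^sub>R h))) has_derivative
        (\<lambda>s. 0 + \<theta>' t *\<^sub>R (Dw (fst p) e (s *\<^sub>R h) + (0 *\<^sub>R Dw b e (s *\<^sub>R h) + s *\<^sub>R w b (e + 0 *\<^sub>R h))))) (at 0)"
      by (intro has_derivative_add has_derivative_const has_derivative_scaleR_right has_derivative_scaleR
          has_derivative_ident wl)
    then have "((\<lambda>s. F (?\<gamma> s)) has_derivative
        (\<lambda>s. 0 + \<theta>' t *\<^sub>R (Dw (fst p) e (s *\<^sub>R h) + (0 *\<^sub>R Dw b e (s *\<^sub>R h) + s *\<^sub>R w b (e + 0 *\<^sub>R h))))) (at 0)"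
    proof (rule has_derivative_transform_within_open)
      show "open ((\<lambda>s::real. e + s *\<^sub>R h) -` E)"
        by (intro open_vimage continuous_intros) (simp add: E_def)
      fix s :: real assume "s \<in> (\<lambda>s. e + s *\<^sub>R h) -` E"
      then have "e + s *\<^sub>R h \<in> U" using EK(1) K(3) by blast
      from linear_add[OF lin[OF this]] linear_scale[OF lin[OF this]]
      show "(x0 + snd p) + \<theta>' t *\<^sub>R (w (fst p) (e + s *\<^sub>R h) + s *\<^sub>R w b (e + s *\<^sub>R h)) = F (?\<gamma> s)"
        by (simp add: F_def)
    qed (use e in simp)
    from fun_cong[OF has_derivative_unique[OF 1 this], of 1] show ?thesis by (simp add: add.commute)
  qed
  have lip': "norm (F (t, p, e) - F (t, p, e')) \<le> norm (e - e') / 2"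
    if "t \<in> {0..1}" "p \<in> ball 0 R" "e \<in> E" "e' \<in> E" for t p e e'
    using lip[of p e e' t] that EK(1) by auto
  have Gsm: "smooth_on (ball 0 R) G"
    by (rule averaged_fixed_point_smooth[OF _ Fsm lip' G]) (simp_all add: E_def)
  have "openE": "open E" by (simp add: E_def)
  have avg: "frechet_derivative G (at p) b = integral {0..1} (\<lambda>t.
      frechet_derivative F (at (t, p, G (\<sigma> t p))) (0, b, c b t *\<^sub>R frechet_derivative G (at (\<sigma> t p)) b))"
    if "p \<in> ball 0 R" "b \<in> Basis" for p b
    by (rule averaged_fixed_point_derivative(3)[OF openE smooth_on_Ck[OF Fsm] lip' G that]; assumption)
  have int01: "integral {0..1} (\<lambda>t::real. a) = a" for a :: 'a by simp
  have F_apply: "F (t, p, e) = x0 + snd p + \<theta>' t *\<^sub>R w (fst p) e" for t p e by (simp add: F_def)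
  have w0: "w 0 x = 0" if "x \<in> U" for x using linear_0[OF lin[OF that]] .
  have wscale: "w (s *\<^sub>R v) x = s *\<^sub>R w v x" if "x \<in> U" for s v x using linear_scale[OF lin[OF that]] .
  \<comment> \<open>along rays, \<open>G\<close> follows the flow\<close>
  have ray: "((\<lambda>s. G (s *\<^sub>R y, z)) has_vector_derivative w y (G (t *\<^sub>R y, z))) (at t within {0..1})"
    if yz: "(y, z) \<in> ball 0 R" and t: "t \<in> {0..1}" for y z t
  proof -
    have inb: "(s *\<^sub>R y, z) \<in> ball 0 R" if "s \<in> {0..1}" for s
    proof -
      have "norm (s *\<^sub>R y, z) \<le> norm (y, z)"
        using that mult_left_le_one_le[of "norm y" s]
        by (auto simp: norm_Pair intro!: real_sqrt_le_mono add_mono power_mono)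
      then show ?thesis using yz by simp
    qed
    define X where "X s = G (s *\<^sub>R y, z)" for s
    have Xcont: "continuous_on {0..1} X"
      unfolding X_def by (rule continuous_on_compose2[OF G(1)]) (use inb in \<open>auto intro!: continuous_intros simp del: mem_ball\<close>)
    have wX: "continuous_on {0..1} (\<lambda>s. w y (X s))"
      by (rule continuous_on_compose2[OF wcont Xcont]) (use inb GK(2) in \<open>auto simp: X_def simp del: mem_ball\<close>)
    have X_eq: "x0 + z + integral {0..s} (\<lambda>u. w y (X u)) = X s" if s: "s \<in> {0..1}" for s
    proof -
      have "((\<lambda>\<tau>. (s * \<theta>' \<tau>) *\<^sub>R w y (X (s * \<theta> \<tau>))) has_integral integral {s * \<theta> 0..s * \<theta> 1} (\<lambda>u. w y (X u))) {0..1}"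
      proof (rule has_integral_substitution[where c = 0 and d = 1])
        show "((\<lambda>\<tau>. s * \<theta> \<tau>) has_field_derivative s * \<theta>' t) (at t within {0..1})" for t
          by (rule DERIV_cmult[OF \<theta>_der])
        show "(\<lambda>\<tau>. s * \<theta> \<tau>) ` {0..1} \<subseteq> {0..1}"
        proof (rule image_subsetI)
          fix \<tau> :: real assume "\<tau> \<in> {0..1}"
          then have "\<theta> \<tau> \<in> {0..1}" by (rule \<theta>01)
          then show "s * \<theta> \<tau> \<in> {0..1}" using s mult_le_one[of s "\<theta> \<tau>"] by simp
        qed
      qed (use s \<theta> wX in auto)
      then have "((\<lambda>\<tau>. (x0 + z) + (s * \<theta>' \<tau>) *\<^sub>R w y (X (s * \<theta> \<tau>))) has_integral
          (x0 + z) + integral {0..s} (\<lambda>u. w y (X u))) {0..1}"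
        using has_integral_add[OF has_integral_const_real[of "x0 + z" 0 1]] \<theta> by fastforce
      then have "x0 + z + integral {0..s} (\<lambda>u. w y (X u)) =
          integral {0..1} (\<lambda>\<tau>. x0 + z + (s * \<theta>' \<tau>) *\<^sub>R w y (X (s * \<theta> \<tau>)))"
        using integral_unique by metis
      also have "\<dots> = integral {0..1} (\<lambda>\<tau>. F (\<tau>, (s *\<^sub>R y, z), G (\<sigma> \<tau> (s *\<^sub>R y, z))))"
      proof (rule integral_cong)
        fix \<tau> :: real
        have "G (\<sigma> \<tau> (s *\<^sub>R y, z)) \<in> U" by (rule GK(2)[OF \<sigma>_in_ball[OF inb[OF s]]])
        then show "x0 + z + (s * \<theta>' \<tau>) *\<^sub>R w y (X (s * \<theta> \<tau>)) = F (\<tau>, (s *\<^sub>R y, z), G (\<sigma> \<tau> (s *\<^sub>R y, z)))"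
          unfolding F_apply \<sigma>_eq X_def by (simp add: wscale mult.commute)
      qed
      also have "\<dots> = X s" unfolding X_def by (rule G(3)[OF inb[OF s], symmetric])
      finally show ?thesis .
    qed
    have "((\<lambda>s. x0 + z + integral {0..s} (\<lambda>u. w y (X u))) has_vector_derivative 0 + w y (X t)) (at t within {0..1})"
      by (intro has_vector_derivative_add has_vector_derivative_const integral_has_vector_derivative wX t)
    then have "(X has_vector_derivative w y (X t)) (at t within {0..1})"
      using has_vector_derivative_transform[OF t X_eq[symmetric]] by simp
    then show ?thesis unfolding X_def .
  qed
  \<comment> \<open>compare \<open>\<partial>\<^sub>b G\<close> with the frame along the flow\<close>
  have frame: "frechet_derivative G (at p) (b, 0) = w b (G p)" if b: "b \<in> Basis" and p0: "p \<in> ball 0 R" for b p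
  proof -
    have bb: "(b, 0) \<in> (Basis :: ('a \<times> 'a) set)" using b by (simp add: Basis_prod_def)
    have cb: "c (b, 0) t = \<theta> t" for t by (simp add: c_def)
    define \<xi> where "\<xi> p = frechet_derivative G (at p) (b, 0)" for p
    have \<xi>cont: "continuous_on (ball 0 R) \<xi>"
      unfolding \<xi>_def using Ck_on_imp_continuous_on[OF smooth_on_Ck[OF smooth_on_frechet_derivative[OF Gsm]]] .
    define \<epsilon> where "\<epsilon> p = \<xi> p - w b (G p)" for p
    have \<epsilon>_eq: "\<epsilon> p = integral {0..1} (\<lambda>t. (\<theta>' t * \<theta> t) *\<^sub>R Dw (fst p) (G (\<sigma> t p)) (\<epsilon> (\<sigma> t p)))"
      if p: "p \<in> ball 0 R" for p
    proof -
      obtain y z where [simp]: "p = (y, z)" by fastforce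
      define X where "X t = G (\<sigma> t p)" for t
      have \<sigma>p: "\<sigma> t p \<in> ball 0 R" for t by (rule \<sigma>_in_ball[OF p])
      have XU: "X t \<in> U" "X t \<in> E" for t using GK(2)[OF \<sigma>p] G(2) \<sigma>p unfolding X_def by blast+
      have linD: "linear (Dw v (X t))" for v t using has_derivative_linear[OF Dw[OF XU(1)]] .
      have \<sigma>cont: "continuous_on {0..1} (\<lambda>t. \<sigma> t p)" by (intro continuous_intros)
      have Xcont: "continuous_on {0..1} X"
        unfolding X_def by (rule continuous_on_compose2[OF G(1) \<sigma>cont]) (use \<sigma>p in blast)
      have \<xi>\<sigma>cont: "continuous_on {0..1} (\<lambda>t. \<xi> (\<sigma> t p))"
        by (rule continuous_on_compose2[OF \<xi>cont \<sigma>cont]) (use \<sigma>p in blast)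
      have wXcont: "continuous_on {0..1} (\<lambda>t. w v (X t))" for v
        by (rule continuous_on_compose2[OF wcont Xcont]) (use XU in blast)
      have DwXcont: "continuous_on {0..1} (\<lambda>t. Dw v (X t) (h t))" if "continuous_on {0..1} h" for v h
      proof -
        have "continuous_on {0..1} (\<lambda>t. \<Sum>i\<in>Basis. (h t \<bullet> i) *\<^sub>R Dw v (X t) i)"
          by (intro continuous_intros that continuous_on_compose2[OF Dwcont Xcont]) (use XU in blast)
        then show ?thesis by (subst linear_basis_expansion[OF linD])
      qed
      have "\<xi> p = integral {0..1} (\<lambda>t. \<theta>' t *\<^sub>R (w b (X t) + \<theta> t *\<^sub>R Dw y (X t) (\<xi> (\<sigma> t p))))"
      proof -
        have "\<xi> p = integral {0..1} (\<lambda>t. frechet_derivative F (at (t, p, X t)) (0, (b, 0), c (b, 0) t *\<^sub>R \<xi> (\<sigma> t p)))"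
          unfolding \<xi>_def X_def using avg[OF p bb] .
        also have "\<dots> = integral {0..1} (\<lambda>t. \<theta>' t *\<^sub>R (w b (X t) + \<theta> t *\<^sub>R Dw y (X t) (\<xi> (\<sigma> t p))))"
        proof (rule integral_cong)
          fix t :: real
          have "(t, p, X t) \<in> ?O" using p XU(2) by simp
          from F_dir[OF this, of b "\<theta> t *\<^sub>R \<xi> (\<sigma> t p)"]
          show "frechet_derivative F (at (t, p, X t)) (0, (b, 0), c (b, 0) t *\<^sub>R \<xi> (\<sigma> t p)) =
              \<theta>' t *\<^sub>R (w b (X t) + \<theta> t *\<^sub>R Dw y (X t) (\<xi> (\<sigma> t p)))"
            by (simp add: cb linear_scale[OF linD])
        qed
        finally show ?thesis .
      qed
      moreover have "((\<lambda>t. \<theta>' t *\<^sub>R (w b (X t) + \<theta> t *\<^sub>R Dw y (X t) (w b (X t)))) has_integral w b (G p)) {0..1}"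
      proof -
        have X_ray: "X t = G (\<theta> t *\<^sub>R y, z)" for t by (simp add: X_def \<sigma>_eq)
        have "((\<lambda>t. \<theta>' t *\<^sub>R (w b (X t) + \<theta> t *\<^sub>R Dw y (X t) (w b (X t)))) has_integral
            \<theta> 1 *\<^sub>R w b (X 1) - \<theta> 0 *\<^sub>R w b (X 0)) {0..1}"
        proof (rule fundamental_theorem_of_calculus)
          fix t :: real assume t: "t \<in> {0..1}"
          have "(\<theta> has_vector_derivative \<theta>' t) (at t within {0..1})"
            using \<theta>_der has_real_derivative_iff_has_vector_derivative by blast
          moreover have "((\<lambda>s. G (s *\<^sub>R y, z)) has_vector_derivative w y (X t)) (at (\<theta> t) within \<theta> ` {0..1})"
          proof (rule has_vector_derivative_within_subset)
            show "((\<lambda>s. G (s *\<^sub>R y, z)) has_vector_derivative w y (X t)) (at (\<theta> t) within {0..1})"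
              unfolding X_ray by (rule ray) (use p \<theta>01[OF t] in simp_all)
            show "\<theta> ` {0..1} \<subseteq> {0..1}" using \<theta>01 by blast
          qed
          ultimately have "(((\<lambda>s. G (s *\<^sub>R y, z)) \<circ> \<theta>) has_vector_derivative \<theta>' t *\<^sub>R w y (X t)) (at t within {0..1})"
            by (rule vector_diff_chain_within)
          then have X': "(X has_vector_derivative \<theta>' t *\<^sub>R w y (X t)) (at t within {0..1})"
            by (simp add: o_def X_ray[abs_def])
          have "((w b \<circ> X) has_vector_derivative Dw b (X t) (\<theta>' t *\<^sub>R w y (X t))) (at t within {0..1})"
            by (rule vector_derivative_diff_chain_within[OF X' has_derivative_at_withinI[OF Dw[OF XU(1)]]])
          then have "((\<lambda>t. w b (X t)) has_vector_derivative \<theta>' t *\<^sub>R Dw y (X t) (w b (X t))) (at t within {0..1})"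
            by (simp add: o_def linear_scale[OF linD] Dw_sym[OF XU(1)])
          from has_vector_derivative_scaleR[OF \<theta>_der this]
          show "((\<lambda>t. \<theta> t *\<^sub>R w b (X t)) has_vector_derivative
              \<theta>' t *\<^sub>R (w b (X t) + \<theta> t *\<^sub>R Dw y (X t) (w b (X t)))) (at t within {0..1})"
            by (simp add: algebra_simps)
        qed simp
        moreover have "X 1 = G p" by (simp add: X_ray \<theta>)
        ultimately show ?thesis by (simp add: \<theta>)
      qed
      ultimately have "\<epsilon> p = integral {0..1} (\<lambda>t. \<theta>' t *\<^sub>R (w b (X t) + \<theta> t *\<^sub>R Dw y (X t) (\<xi> (\<sigma> t p))))
          - integral {0..1} (\<lambda>t. \<theta>' t *\<^sub>R (w b (X t) + \<theta> t *\<^sub>R Dw y (X t) (w b (X t))))"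
        unfolding \<epsilon>_def using integral_unique by metis
      also have "\<dots> = integral {0..1} (\<lambda>t. \<theta>' t *\<^sub>R (w b (X t) + \<theta> t *\<^sub>R Dw y (X t) (\<xi> (\<sigma> t p)))
          - \<theta>' t *\<^sub>R (w b (X t) + \<theta> t *\<^sub>R Dw y (X t) (w b (X t))))"
        by (intro integral_diff[symmetric] integrable_continuous_interval continuous_intros
            \<theta>'_cont \<theta>_cont wXcont DwXcont \<xi>\<sigma>cont)
      also have "\<dots> = integral {0..1} (\<lambda>t. (\<theta>' t * \<theta> t) *\<^sub>R Dw (fst p) (G (\<sigma> t p)) (\<epsilon> (\<sigma> t p)))"
      proof (rule integral_cong)
        fix t :: real
        have *: "Dw y (X t) (\<epsilon> (\<sigma> t p)) = Dw y (X t) (\<xi> (\<sigma> t p)) - Dw y (X t) (w b (X t))"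
          unfolding \<epsilon>_def X_def[symmetric] by (rule linear_diff[OF linD])
        have e: "Dw (fst p) (G (\<sigma> t p)) (\<epsilon> (\<sigma> t p)) = Dw y (X t) (\<xi> (\<sigma> t p)) - Dw y (X t) (w b (X t))"
          using * by (simp add: X_def)
        show "\<theta>' t *\<^sub>R (w b (X t) + \<theta> t *\<^sub>R Dw y (X t) (\<xi> (\<sigma> t p)))
          - \<theta>' t *\<^sub>R (w b (X t) + \<theta> t *\<^sub>R Dw y (X t) (w b (X t)))
          = (\<theta>' t * \<theta> t) *\<^sub>R Dw (fst p) (G (\<sigma> t p)) (\<epsilon> (\<sigma> t p))"
          unfolding e by (simp add: algebra_simps)
      qed
      finally show ?thesis .
    qed
    define r where "r = norm p"
    have Kr: "cball 0 r \<subseteq> ball (0 :: 'a \<times> 'a) R" using p0 by (auto simp: r_def)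
    have \<epsilon>cont: "continuous_on (ball 0 R) \<epsilon>"
      unfolding \<epsilon>_def by (intro continuous_intros \<xi>cont continuous_on_compose2[OF wcont G(1)]) (use GK in blast)
    have "compact (\<epsilon> ` cball 0 r)"
      by (rule compact_continuous_image[OF continuous_on_subset[OF \<epsilon>cont Kr] compact_cball])
    then obtain M where M: "0 < M" "\<And>q. q \<in> cball 0 r \<Longrightarrow> norm (\<epsilon> q) \<le> M"
      using compact_imp_bounded[THEN bounded_pos[THEN iffD1]] by (metis imageI)
    have "norm (\<epsilon> p) \<le> 2 * 0 * 1"
    proof (rule halving_bound[where X = "cball 0 r" and \<psi> = "\<lambda>_. 1" and ?B0.0 = M and \<phi> = "\<lambda>q. norm (\<epsilon> q)"])
      fix B' q assume B': "0 \<le> B'" "\<And>q. q \<in> cball 0 r \<Longrightarrow> norm (\<epsilon> q) \<le> B' * 1" and q: "q \<in> cball (0 :: 'a \<times> 'a) r"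
      have qR: "q \<in> ball 0 R" using q Kr by blast
      have "norm ((\<theta>' t * \<theta> t) *\<^sub>R Dw (fst q) (G (\<sigma> t q)) (\<epsilon> (\<sigma> t q))) \<le> B' / 2" for t
      proof -
        have "norm ((\<theta>' t * \<theta> t) *\<^sub>R Dw (fst q) (G (\<sigma> t q)) (\<epsilon> (\<sigma> t q)))
          = \<bar>\<theta>' t\<bar> * \<bar>\<theta> t\<bar> * norm (Dw (fst q) (G (\<sigma> t q)) (\<epsilon> (\<sigma> t q)))" by (simp add: abs_mult)
        also have "\<dots> \<le> 2 * 1 * (C * R * B')"
        proof (rule mult_mono[OF mult_mono[OF \<theta>'_le \<theta>(3)]])
          have "norm (\<epsilon> (\<sigma> t q)) \<le> B'" using B'(2)[OF \<sigma>_in_cball[OF q]] by simp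
          then have "C * R * norm (\<epsilon> (\<sigma> t q)) \<le> C * R * B'" using C R by (intro mult_left_mono) auto
          moreover have "q \<in> cball 0 R" using qR by simp
          ultimately show "norm (Dw (fst q) (G (\<sigma> t q)) (\<epsilon> (\<sigma> t q))) \<le> C * R * B'"
            using DwR[OF _ GK(1)[OF \<sigma>_in_ball[OF qR]]] order_trans by blast
        qed auto
        also have "\<dots> \<le> 1 / 2 * B'" using mult_right_mono[OF R(3) B'(1)] by (simp add: mult_ac)
        finally show ?thesis by simp
      qed
      moreover have "continuous_on {0..1} (\<lambda>t. (\<theta>' t * \<theta> t) *\<^sub>R Dw (fst q) (G (\<sigma> t q)) (\<epsilon> (\<sigma> t q)))"
      proof -
        have \<sigma>q: "\<sigma> t q \<in> ball 0 R" for t by (rule \<sigma>_in_ball[OF qR])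
        have \<sigma>cont: "continuous_on {0..1} (\<lambda>t. \<sigma> t q)" by (intro continuous_intros)
        have 1: "continuous_on {0..1} (\<lambda>t. G (\<sigma> t q))" "continuous_on {0..1} (\<lambda>t. \<epsilon> (\<sigma> t q))"
          by (rule continuous_on_compose2[OF G(1) \<sigma>cont] continuous_on_compose2[OF \<epsilon>cont \<sigma>cont], use \<sigma>q in blast)+
        have "continuous_on {0..1} (\<lambda>t. (\<theta>' t * \<theta> t) *\<^sub>R (\<Sum>i\<in>Basis. (\<epsilon> (\<sigma> t q) \<bullet> i) *\<^sub>R Dw (fst q) (G (\<sigma> t q)) i))"
          by (intro continuous_intros \<theta>'_cont \<theta>_cont 1 continuous_on_compose2[OF Dwcont 1(1)])
            (use GK(2) \<sigma>q in blast)
        then show ?thesis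
          by (subst linear_basis_expansion[OF has_derivative_linear[OF Dw[OF GK(2)[OF \<sigma>q]]]])
      qed
      ultimately have "norm (\<epsilon> q) \<le> B' / 2"
        unfolding \<epsilon>_eq[OF qR] by (intro integral_unit_bound)
      then show "norm (\<epsilon> q) \<le> (B' / 2 + 0) * 1" by simp
    qed (use M in \<open>auto simp: r_def\<close>)
    then show ?thesis by (simp add: \<epsilon>_def \<xi>_def)
  qed
  show ?thesis
  proof
    show "0 < R" by (rule R(1))
    show "smooth_on (ball 0 R) G" by (rule Gsm)
    show "G ` ball 0 R \<subseteq> U" using GK(2) by blast
    show "G (0, z) = x0 + z" if "norm z < R" for z
    proof -
      have z: "(0 :: 'a, z) \<in> ball 0 R" using that by (simp add: norm_Pair)
      have "F (t, (0, z), G (\<sigma> t (0, z))) = x0 + z" for t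
        unfolding F_apply using w0 GK(2)[OF \<sigma>_in_ball[OF z]] by simp
      then show ?thesis using G(3)[OF z] by simp
    qed
    show "frechet_derivative G (at p) (v, 0) = w v (G p)" if p: "p \<in> ball 0 R" for p v
    proof -
      have lG: "linear (frechet_derivative G (at p))"
        using has_derivative_linear[OF smooth_on_has_derivative[OF Gsm p]] .
      have "(v, 0) = (\<Sum>b\<in>Basis. (v \<bullet> b) *\<^sub>R (b, 0 :: 'a))"
        by (simp add: prod_eq_iff fst_sum snd_sum euclidean_representation)
      then have "frechet_derivative G (at p) (v, 0) = (\<Sum>b\<in>Basis. (v \<bullet> b) *\<^sub>R frechet_derivative G (at p) (b, 0))"
        by (simp add: linear_sum[OF lG] linear_scale[OF lG] del: scaleR_Pair)
      also have "\<dots> = w v (G p)" unfolding wsum[OF GK(2)[OF p], of v] using frame[OF _ p] by simp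
      finally show ?thesis .
    qed
  qed
qed

section \<open>Coordinate subspaces\<close>

definition coordinate_subspace :: "'n set \<Rightarrow> (real^'n) set" where
  "coordinate_subspace I = {x. \<forall>i. i \<notin> I \<longrightarrow> x $ i = 0}"

lemma subspace_coordinate_subspace: "subspace (coordinate_subspace I)"
  by (auto simp: subspace_def coordinate_subspace_def)

text \<open>
  Extend \<open>B\<close> to a basis and enumerate it by the coordinates in any way; \<open>I\<close> consists of the indices
  that number elements of \<open>B\<close>.
\<close>

lemma coordinate_subspace_adapted_to:
  fixes B :: "(real^'n) set"
  assumes "independent B"
  obtains I :: "'n set" and T :: "real^'n \<Rightarrow> real^'n" where
    "card I = card B" "linear T" "bij T" "T ` coordinate_subspace I = span B"
proof -
  define B' where "B' = extend_basis B"
  have B': "B \<subseteq> B'" "independent B'" "span B' = UNIV"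
    unfolding B'_def using assms
    by (auto simp: extend_basis_superset independent_extend_basis)
  have fin: "finite B'" using B'(2) independent_imp_finite by blast
  have "card B' = CARD('n)" using B'(2,3) dim_eq_card[of B' UNIV] by simp
  then obtain h where h: "bij_betw h (UNIV :: 'n set) B'"
    using finite_same_card_bij[of "UNIV :: 'n set" B'] fin by auto
  define T where "T x = (\<Sum>i\<in>UNIV. (x $ i) *\<^sub>R h i)" for x :: "real^'n"
  define I where "I = {i. h i \<in> B}"
  have lin: "linear T"
    unfolding T_def
    by (rule linearI) (simp_all add: scaleR_add_left sum.distrib scaleR_sum_right)
  have T_axis: "T (axis i 1) = h i" for i
    unfolding T_def axis_def by (simp add: if_distrib[of "\<lambda>x. x *\<^sub>R _"] cong: if_cong)
  have "B' \<subseteq> range T" using h T_axis unfolding bij_betw_def by (metis image_subset_iff rangeI)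
  then have "span B' \<subseteq> range T" by (rule span_minimal) (rule linear_subspace_image[OF lin subspace_UNIV])
  then have "surj T" using B'(3) by auto
  then have "bij T" using linear_surjective_imp_injective[OF lin] by (simp add: bij_def)
  have hI: "h ` I = B" unfolding I_def using h B'(1) unfolding bij_betw_def by blast
  have "inj_on h I" using h unfolding bij_betw_def by (meson inj_on_subset subset_UNIV)
  then have "card I = card B" using card_image hI by metis
  moreover have "T ` coordinate_subspace I = span B"
  proof
    show "T ` coordinate_subspace I \<subseteq> span B"
    proof
      fix y assume "y \<in> T ` coordinate_subspace I"
      then obtain x where x: "y = T x" "x \<in> coordinate_subspace I" by blast
      have "(x $ i) *\<^sub>R h i \<in> span B" for i
        using x(2) by (cases "i \<in> I") (auto simp: coordinate_subspace_def I_def intro: span_scale span_base span_zero)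
      then show "y \<in> span B" unfolding x(1) T_def by (intro span_sum)
    qed
    have "axis i 1 \<in> coordinate_subspace I" if "i \<in> I" for i
      using that by (auto simp: coordinate_subspace_def axis_def)
    then have "h i \<in> T ` coordinate_subspace I" if "i \<in> I" for i
      using that T_axis[of i, symmetric] by (intro image_eqI[of _ _ "axis i 1"])
    then have "B \<subseteq> T ` coordinate_subspace I" unfolding hI[symmetric] by (rule image_subsetI)
    then show "span B \<subseteq> T ` coordinate_subspace I"
      by (rule span_minimal) (rule linear_subspace_image[OF lin subspace_coordinate_subspace])
  qed
  ultimately show ?thesis using that lin \<open>bij T\<close> by blast
qed

lemma linear_full_rank_imp_inj:
  fixes L :: "'a::euclidean_space \<Rightarrow> 'b::euclidean_space"
  assumes "linear L" "dim (range L) = DIM('a)"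
  shows "inj L"
proof -
  have rng: "range L = span (L ` Basis)" using linear_span_image[OF assms(1), of Basis] by simp
  have le: "card (L ` Basis) \<le> DIM('a)" by (rule card_image_le) simp
  have "independent (L ` Basis)"
    by (rule card_le_dim_spanning[of _ "range L"]) (use rng le assms(2) in auto)
  moreover from this have "card (L ` Basis) = DIM('a)"
    using dim_span_eq_card_independent rng assms(2) by metis
  then have "inj_on L Basis" by (intro eq_card_imp_inj_on) auto
  ultimately have "inj_on L (span Basis)"
    by (intro linear_inj_on_span_independent_image[OF assms(1)])
  then show ?thesis by simp
qed

lemma independent_axes: "independent ((\<lambda>i. axis i (1::real)) ` I :: (real^'n) set)"
  by (rule independent_mono[OF independent_Basis]) (auto simp: axis_in_Basis_iff)

lemma inj_axis: "inj_on (\<lambda>i. axis i (1::real) :: real^'n) I"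
  by (auto simp: inj_on_def axis_eq_axis)

lemma coordinate_subspace_eq_span:
  "coordinate_subspace I = span ((\<lambda>i. axis i (1::real)) ` I :: (real^'n) set)"
proof
  show "coordinate_subspace I \<subseteq> span ((\<lambda>i. axis i (1::real)) ` I :: (real^'n) set)"
  proof
    fix x :: "real^'n" assume x: "x \<in> coordinate_subspace I"
    have eq: "(\<Sum>i\<in>UNIV. (x $ i) *\<^sub>R axis i 1) = x"
      by (simp add: vec_eq_iff axis_def if_distrib[of "\<lambda>y. _ * y"] cong: if_cong)
    have "(x $ i) *\<^sub>R axis i 1 \<in> span ((\<lambda>i. axis i (1::real)) ` I :: (real^'n) set)" for i
      using x by (cases "i \<in> I") (auto simp: coordinate_subspace_def intro: span_scale span_base span_zero)
    then have "(\<Sum>i\<in>UNIV. (x $ i) *\<^sub>R axis i 1) \<in> span ((\<lambda>i. axis i (1::real)) ` I)"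
      by (rule span_sum)
    then show "x \<in> span ((\<lambda>i. axis i (1::real)) ` I)" unfolding eq .
  qed
  show "span ((\<lambda>i. axis i (1::real)) ` I :: (real^'n) set) \<subseteq> coordinate_subspace I"
    by (rule span_minimal[OF _ subspace_coordinate_subspace]) (auto simp: coordinate_subspace_def axis_def)
qed

lemma dim_coordinate_subspace: "dim (coordinate_subspace I :: (real^'n) set) = card (I :: 'n set)"
  unfolding coordinate_subspace_eq_span dim_span_eq_card_independent[OF independent_axes]
  by (rule card_image[OF inj_axis])

lemma linear_image_eq_if_dim:
  fixes L :: "'a::euclidean_space \<Rightarrow> 'b::euclidean_space"
  assumes "linear L" "inj L" "subspace S" "subspace T" "L ` S \<subseteq> T" "dim T = dim S"
  shows "L ` S = T"
proof (rule subspace_dim_equal[OF linear_subspace_image[OF assms(1,3)] assms(4,5)])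
  have "dim (L ` S) = dim S"
    using dim_image_eq[OF assms(1)] assms(2) inj_on_subset by blast
  then show "dim T \<le> dim (L ` S)" using assms(6) by simp
qed

lemma span_du_eq: "span_du = {p :: (real^'n) \<times> (real^'m). fst p = 0}"
proof
  have "subspace {p :: (real^'n) \<times> (real^'m). fst p = 0}" by (auto simp: subspace_def)
  then show "span_du \<subseteq> {p :: (real^'n) \<times> (real^'m). fst p = 0}"
    unfolding span_du_def by (intro span_minimal) auto
  show "{p. fst p = 0} \<subseteq> (span_du :: ((real^'n) \<times> (real^'m)) set)"
  proof clarsimp
    fix u :: "real^'m"
    have "(0, u) = (\<Sum>j\<in>UNIV. (u $ j) *\<^sub>R ((0 :: real^'n), axis j (1::real)))"
      by (simp add: prod_eq_iff fst_sum snd_sum vec_eq_iff axis_def if_distrib[of "\<lambda>y. _ * y"] cong: if_cong)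
    also have "\<dots> \<in> span_du"
      unfolding span_du_def by (intro span_sum span_scale span_base) auto
    finally show "((0 :: real^'n), u) \<in> span_du" .
  qed
qed

text \<open>
  A function with values in the kernel of \<open>l\<close> has derivatives in that kernel.
\<close>

lemma derivative_annihilated:
  fixes f :: "'a::real_normed_vector \<Rightarrow> 'b::euclidean_space" and l :: "'b \<Rightarrow> 'c::real_normed_vector"
  assumes "open S" "p \<in> S" "(f has_derivative D) (at p)" "bounded_linear l" "\<And>x. x \<in> S \<Longrightarrow> l (f x) = 0"
  shows "l (D h) = 0"
proof -
  have "((\<lambda>x. l (f x)) has_derivative (\<lambda>h. l (D h))) (at p)"
    by (rule bounded_linear.has_derivative[OF assms(4,3)])
  then have "((\<lambda>x. 0) has_derivative (\<lambda>h. l (D h))) (at p)"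
    by (rule has_derivative_transform_within_open[OF _ assms(1,2)]) (rule assms(5))
  from has_derivative_unique[OF this has_derivative_const] show ?thesis by metis
qed

lemma derivative_in_coordinate_subspace:
  fixes f :: "'a::real_normed_vector \<Rightarrow> real^'n"
  assumes "open S" "p \<in> S" "(f has_derivative D) (at p)" "\<And>x. x \<in> S \<Longrightarrow> f x \<in> coordinate_subspace I"
  shows "D h \<in> coordinate_subspace I"
  using derivative_annihilated[OF assms(1-3) bounded_linear_vec_nth] assms(4)
  unfolding coordinate_subspace_def by blast

lemma constant_mod_coordinate_subspace:
  fixes F :: "'a::real_normed_vector \<Rightarrow> real^'n"
  assumes "convex S" "x \<in> S" "y \<in> S" "\<And>z. z \<in> S \<Longrightarrow> (F has_derivative F' z) (at z)"
    and "\<And>z. z \<in> S \<Longrightarrow> F' z (x - y) \<in> coordinate_subspace I"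
  shows "F x - F y \<in> coordinate_subspace I"
proof -
  have "F x $ i = F y $ i" if "i \<notin> I" for i
  proof -
    let ?\<gamma> = "\<lambda>s::real. y + s *\<^sub>R (x - y)"
    have "\<exists>c. \<forall>s\<in>{0..1}. F (?\<gamma> s) $ i = c"
    proof (rule has_derivative_zero_constant)
      fix s :: real assume s: "s \<in> {0..1}"
      have "?\<gamma> s = (1 - s) *\<^sub>R y + s *\<^sub>R x" by (simp add: algebra_simps)
      then have \<gamma>S: "?\<gamma> s \<in> S" using convexD[OF assms(1,3,2), of "1 - s" s] s by simp
      have "(?\<gamma> has_derivative (\<lambda>h. h *\<^sub>R (x - y))) (at s)"
        by (auto intro!: derivative_eq_intros)
      from has_derivative_compose[OF this assms(4)[OF \<gamma>S]]
      have "((\<lambda>s. F (?\<gamma> s) $ i) has_derivative (\<lambda>h. F' (?\<gamma> s) (h *\<^sub>R (x - y)) $ i)) (at s)"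
        by (rule bounded_linear.has_derivative[OF bounded_linear_vec_nth])
      moreover have "F' (?\<gamma> s) (h *\<^sub>R (x - y)) $ i = 0" for h
        using assms(5)[OF \<gamma>S] that linear_scale[OF has_derivative_linear[OF assms(4)[OF \<gamma>S]], of h "x - y"]
        by (simp add: coordinate_subspace_def)
      ultimately show "((\<lambda>s. F (?\<gamma> s) $ i) has_derivative (\<lambda>h. 0)) (at s within {0..1})"
        by (simp add: has_derivative_at_withinI)
    qed simp
    then obtain c where "\<forall>s\<in>{0..1}. F (?\<gamma> s) $ i = c" by blast
    from bspec[OF this, of 0] bspec[OF this, of 1] show ?thesis by simp
  qed
  then show ?thesis by (simp add: coordinate_subspace_def)
qed

section \<open>Frobenius' theorem\<close>

text \<open>
  A linear projection \<open>\<pi>\<close> onto the span of the frame at \<open>x0\<close> is injective on the span at all nearby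
  points. Replacing the frame by the fields \<open>\<omega> v\<close> of the same span with \<open>\<pi> (\<omega> v) = \<pi> v\<close>, all brackets
  lie in the span and are annihilated by \<open>\<pi>\<close>, so the fields commute. Their joint flow, started at the
  points of the transversal \<open>x0 + ker \<pi>\<close>, is a local diffeomorphism whose derivative maps the
  coordinate subspace \<open>I\<close> to the span; the linear map \<open>T\<close> arranges the coordinates accordingly.
\<close>

theorem frobenius_chart:
  fixes w :: "nat \<Rightarrow> real^'n \<Rightarrow> real^'n"
  assumes V: "open V" "x0 \<in> V" and sm: "\<And>i. i < r \<Longrightarrow> smooth_on V (w i)"
    and inj: "inj_on (\<lambda>i. w i x0) {..<r}" and ind: "independent ((\<lambda>i. w i x0) ` {..<r})"
    and br: "\<And>i j q. i < r \<Longrightarrow> j < r \<Longrightarrow> q \<in> V \<Longrightarrow> lie_bracket (w i) (w j) q \<in> span ((\<lambda>k. w k q) ` {..<r})"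
  obtains A \<Phi> \<Psi> and I :: "'n set" where "x0 \<in> A" "A \<subseteq> V" "diffeomorphism A (\<Phi> ` A) \<Phi> \<Psi>" "card I = r"
    "\<And>q i. q \<in> A \<Longrightarrow> i < r \<Longrightarrow> frechet_derivative \<Phi> (at q) (w i q) \<in> coordinate_subspace I"
proof -
  define Sp where "Sp q = span ((\<lambda>k. w k q) ` {..<r})" for q
  \<comment> \<open>functionals dual to the frame at \<open>x0\<close>\<close>
  have "\<exists>L. i < r \<longrightarrow> linear L \<and> (\<forall>j<r. L (w j x0) = (if j = i then 1 else 0 :: real))" for i
  proof (cases "i < r")
    case True
    obtain L where "linear L" "\<forall>x\<in>(\<lambda>i. w i x0) ` {..<r}. L x = (if x = w i x0 then 1 else 0 :: real)"
      using linear_independent_extend[OF ind, of "\<lambda>x. if x = w i x0 then 1 else (0 :: real)"] by blast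
    moreover have "w j x0 = w i x0 \<longleftrightarrow> j = i" if "j < r" for j
      using inj_on_eq_iff[OF inj, of j i] that True by simp
    ultimately show ?thesis by auto
  qed simp
  from choice[OF allI, OF this] obtain L where
    dual: "\<forall>i. i < r \<longrightarrow> linear (L i) \<and> (\<forall>j<r. L i (w j x0) = (if j = i then 1 else 0 :: real))" ..
  have L1: "linear (L i)" if "i < r" for i
    by (rule conjunct1[OF mp[OF spec[OF dual] that]])
  have L2: "L i (w j x0) = (if j = i then 1 else 0)" if "i < r" "j < r" for i j
    by (rule mp[OF spec[OF conjunct2[OF mp[OF spec[OF dual] that(1)]]] that(2)])
  note L = L1 L2
  define W where "W x v = (\<Sum>i<r. L i v *\<^sub>R w i x)" for x v
  define \<pi> where "\<pi> v = W x0 v" for v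
  have linW: "linear (W x)" for x
    unfolding W_def
    by (rule linearI)
      (simp_all add: linear_add[OF L(1)] linear_scale[OF L(1)] scaleR_add_left sum.distrib scaleR_sum_right)
  have lin\<pi>: "linear \<pi>" unfolding \<pi>_def using linW by blast
  have W_Sp: "W x v \<in> Sp x" for x v
    unfolding W_def Sp_def by (intro span_sum span_scale span_base) auto
  have W_frame: "W x (w j x0) = w j x" if "j < r" for x j
  proof -
    have "W x (w j x0) = (\<Sum>i<r. if i = j then w i x else 0)"
      unfolding W_def by (rule sum.cong) (auto simp: L(2) that)
    then show ?thesis using that by simp
  qed
  have \<pi>_id: "\<pi> v = v" if "v \<in> Sp x0" for v
  proof -
    have "Sp x0 \<subseteq> {v. \<pi> v = v}"
      unfolding Sp_def
    proof (rule span_minimal)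
      show "(\<lambda>k. w k x0) ` {..<r} \<subseteq> {v. \<pi> v = v}" using W_frame unfolding \<pi>_def by auto
      show "subspace {v. \<pi> v = v}"
        by (auto simp: subspace_def linear_0[OF lin\<pi>] linear_add[OF lin\<pi>] linear_scale[OF lin\<pi>])
    qed
    then show ?thesis using that by blast
  qed
  have \<pi>\<pi>: "\<pi> (\<pi> v) = \<pi> v" for v using \<pi>_id[OF W_Sp] by (simp add: \<pi>_def)
  \<comment> \<open>\<open>M\<close> is the identity at \<open>x0\<close>; its inverse normalises the frame such that \<open>\<pi>\<close> maps it to constant
    fields, the summand \<open>v - \<pi> v\<close> makes it invertible on the whole space\<close>
  define M where "M x v = \<pi> (W x v) + (v - \<pi> v)" for x v
  have linM: "linear (M x)" for x
    unfolding M_def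
    by (rule linearI) (simp_all add: linear_add[OF lin\<pi>] linear_add[OF linW] linear_scale[OF lin\<pi>]
        linear_scale[OF linW] algebra_simps)
  have smW: "smooth_on V (\<lambda>x. W x v)" for v
    unfolding smooth_on_def W_def
    by (intro allI Ck_on_sum Ck_on_scaleR Ck_on_const V) (use sm in \<open>auto intro: smooth_on_Ck\<close>)
  have bl\<pi>: "bounded_linear \<pi>" using lin\<pi> by (simp add: linear_conv_bounded_linear)
  have smM: "smooth_on V (\<lambda>x. M x v)" for v
    unfolding smooth_on_def M_def
    using Ck_on_add[OF V(1) Ck_on_bounded_linear[OF bl\<pi> V(1) smooth_on_Ck[OF smW]] Ck_on_const] by (rule allI)
  have M_x0: "M x0 v = v" for v unfolding M_def \<pi>_def[symmetric] \<pi>\<pi> by simp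
  obtain R0 N where R0: "0 < R0" "ball x0 R0 \<subseteq> V" and linN: "\<And>p. p \<in> ball x0 R0 \<Longrightarrow> linear (N p)"
    and MN: "\<And>p v. p \<in> ball x0 R0 \<Longrightarrow> M p (N p v) = v" "\<And>p v. p \<in> ball x0 R0 \<Longrightarrow> N p (M p v) = v"
    and smN: "\<And>v. smooth_on (ball x0 R0) (\<lambda>p. N p v)"
    by (rule smooth_linear_inverse[OF V linM smM M_x0]) blast
  define B0 where "B0 = ball x0 R0"
  have B0: "open B0" "x0 \<in> B0" "B0 \<subseteq> V" using R0 by (auto simp: B0_def)
  define \<omega> where "\<omega> v x = W x (N x (\<pi> v))" for v x
  have \<omega>_Sp: "\<omega> v x \<in> Sp x" for v x unfolding \<omega>_def by (rule W_Sp)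
  have \<pi>\<omega>: "\<pi> (\<omega> v x) = \<pi> v" if "x \<in> B0" for v x
  proof -
    have "\<pi> (M x (N x (\<pi> v))) = \<pi> (\<pi> v)" using MN(1) that by (simp add: B0_def)
    then show ?thesis unfolding M_def \<omega>_def by (simp add: linear_add[OF lin\<pi>] linear_diff[OF lin\<pi>] \<pi>\<pi>)
  qed
  have \<omega>\<pi>: "\<omega> (\<pi> v) x = \<omega> v x" for v x by (simp add: \<omega>_def \<pi>\<pi>)
  have \<pi>_inj: "u = 0" if x: "x \<in> B0" and u: "u \<in> Sp x" "\<pi> u = 0" for u x
  proof -
    have "Sp x \<subseteq> W x ` Sp x0"
      unfolding Sp_def[of x]
    proof (rule span_minimal)
      show "subspace (W x ` Sp x0)" by (rule linear_subspace_image[OF linW]) (simp add: Sp_def)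
      have "w k x \<in> W x ` Sp x0" if "k < r" for k
        using W_frame[OF that, of x] that by (auto simp: Sp_def intro!: image_eqI[of _ _ "w k x0"] span_base)
      then show "(\<lambda>k. w k x) ` {..<r} \<subseteq> W x ` Sp x0" by auto
    qed
    then obtain n where n: "u = W x n" "n \<in> Sp x0" using u(1) by blast
    have "M x n = 0" using u(2) n(1) \<pi>_id[OF n(2)] by (simp add: M_def)
    then have "n = 0" using MN(2)[of x n] linear_0[OF linN, of x] x by (simp add: B0_def)
    then show ?thesis using n(1) linear_0[OF linW] by simp
  qed
  have lin\<omega>: "linear (\<lambda>v. \<omega> v x)" if "x \<in> B0" for x
    unfolding \<omega>_def
    using linear_compose[OF lin\<pi> linear_compose[OF linN[of x] linW[of x]]] that by (simp add: B0_def o_def)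
  have smL: "smooth_on B0 (\<lambda>x. L i (N x (\<pi> v)))" if "i < r" for i v
    unfolding smooth_on_def
    using Ck_on_bounded_linear[OF L(1)[OF that, unfolded linear_conv_bounded_linear] B0(1)
      smooth_on_Ck[OF smN, folded B0_def]] by (rule allI)
  have smw: "smooth_on B0 (w i)" if "i < r" for i using smooth_on_subset[OF sm[OF that] B0(3)] .
  have sm\<omega>: "smooth_on B0 (\<omega> v)" for v
    unfolding smooth_on_def \<omega>_def[abs_def] W_def
    by (intro allI Ck_on_sum Ck_on_scaleR B0) (use smL smw in \<open>auto intro: smooth_on_Ck\<close>)
  have comm: "lie_bracket (\<omega> u) (\<omega> v) x = 0" if x: "x \<in> B0" for u v x
  proof (rule \<pi>_inj[OF x])
    have diff: "h differentiable (at x)" if "smooth_on B0 h" for h :: "real^'n \<Rightarrow> 'b::real_normed_vector"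
      using smooth_on_has_derivative[OF that x] differentiableI by blast
    have "lie_bracket (\<lambda>x. \<Sum>i<r. L i (N x (\<pi> u)) *\<^sub>R w i x) (\<lambda>x. \<Sum>i<r. L i (N x (\<pi> v)) *\<^sub>R w i x) x \<in> Sp x"
      unfolding Sp_def
      by (rule lie_bracket_in_span_combination) (use diff smw smL br x B0(3) in auto)
    then show "lie_bracket (\<omega> u) (\<omega> v) x \<in> Sp x" unfolding \<omega>_def[abs_def] W_def .
    have \<pi>': "frechet_derivative \<pi> (at y) = \<pi>" for y
      using frechet_derivative_at[OF linear_imp_has_derivative[OF lin\<pi>]] by metis
    have "smooth_on B0 \<pi>" unfolding smooth_on_def using Ck_on_linear[OF lin\<pi> B0(1)] by blast
    from frechet_derivative_lie_bracket[OF B0(1) x this sm\<omega>[of u] sm\<omega>[of v]]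
    have "\<pi> (lie_bracket (\<omega> u) (\<omega> v) x) =
      frechet_derivative (\<lambda>x. \<pi> (\<omega> v x)) (at x) (\<omega> u x) - frechet_derivative (\<lambda>x. \<pi> (\<omega> u x)) (at x) (\<omega> v x)"
      unfolding \<pi>' .
    moreover have "frechet_derivative (\<lambda>x. \<pi> (\<omega> v x)) (at x) = (\<lambda>_. 0)" for v
      using frechet_derivative_cong_open[OF B0(1) x, of "\<lambda>x. \<pi> (\<omega> v x)" "\<lambda>_. \<pi> v"] \<pi>\<omega> by simp
    ultimately show "\<pi> (lie_bracket (\<omega> u) (\<omega> v) x) = 0" by simp
  qed
  obtain R1 G where R1: "0 < R1" and G: "smooth_on (ball 0 R1) G" "G ` ball 0 R1 \<subseteq> B0"
    "\<And>z. norm z < R1 \<Longrightarrow> G (0, z) = x0 + z"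
    "\<And>p v. p \<in> ball 0 R1 \<Longrightarrow> frechet_derivative G (at p) (v, 0) = \<omega> v (G p)"
    by (rule commuting_frame_flow[OF B0(1,2) lin\<omega> sm\<omega> comm];
        (assumption | (rule that; assumption)))
  obtain I :: "'n set" and T where IT: "card I = card ((\<lambda>i. w i x0) ` {..<r})" "linear T" "bij T"
    "T ` coordinate_subspace I = Sp x0"
    by (rule coordinate_subspace_adapted_to[OF ind, folded Sp_def]) (rule that)
  have cardI: "card I = r" using IT(1) card_image[OF inj] by simp
  \<comment> \<open>flow from the transversal \<open>x0 + kernel \<pi>\<close>\<close>
  define P where "P x = (T x, T x - \<pi> (T x))" for x
  have linP: "linear P"
    unfolding P_def
    by (rule linearI) (simp_all add: linear_add[OF IT(2)] linear_scale[OF IT(2)] linear_add[OF lin\<pi>]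
        linear_scale[OF lin\<pi>] algebra_simps)
  define Q where "Q = P -` ball 0 R1"
  have "open Q" unfolding Q_def
    by (rule open_vimage[OF open_ball linear_continuous_on[OF linP[unfolded linear_conv_bounded_linear]]])
  have P0: "P 0 = 0" by (rule linear_0[OF linP])
  then have Q0: "0 \<in> Q" using R1 by (simp add: Q_def)
  define \<Gamma> where "\<Gamma> x = G (P x)" for x
  have sm\<Gamma>: "smooth_on Q \<Gamma>"
    unfolding \<Gamma>_def
  proof (rule smooth_on_compose[OF _ G(1) \<open>open Q\<close> open_ball])
    show "smooth_on Q P" unfolding smooth_on_def using Ck_on_linear[OF linP \<open>open Q\<close>] by blast
  qed (simp add: Q_def)
  have P': "(P has_derivative P) (at x)" for x by (rule linear_imp_has_derivative[OF linP])
  have G': "(G has_derivative frechet_derivative G (at p)) (at p)" if "p \<in> ball 0 R1" for p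
    using smooth_on_has_derivative[OF G(1) that] .
  have \<Gamma>': "frechet_derivative \<Gamma> (at x) e = frechet_derivative G (at (P x)) (P e)" if "x \<in> Q" for x e
  proof -
    have "(\<Gamma> has_derivative (\<lambda>e. frechet_derivative G (at (P x)) (P e))) (at x)"
      unfolding \<Gamma>_def by (rule has_derivative_compose[OF P' G']) (use that in \<open>simp add: Q_def\<close>)
    from frechet_derivative_apply_eq[OF this] show ?thesis .
  qed
  have ball0: "0 \<in> ball (0 :: (real^'n) \<times> (real^'n)) R1" using R1 by simp
  have linG0: "linear (frechet_derivative G (at 0))" using has_derivative_linear[OF G'[OF ball0]] .
  have Gz: "frechet_derivative G (at 0) (0, z) = z" for z
  proof -
    have "((\<lambda>z::real^'n. (0::real^'n, z)) has_derivative (\<lambda>z. (0, z))) (at 0)"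
      by (auto intro!: derivative_eq_intros)
    moreover have "(G has_derivative frechet_derivative G (at 0)) (at (0, 0))"
      using G'[OF ball0] by (simp add: zero_prod_def)
    ultimately have "((\<lambda>z. G (0, z)) has_derivative (\<lambda>z. frechet_derivative G (at 0) (0, z))) (at 0)"
      by (rule has_derivative_compose)
    then have "((\<lambda>z. x0 + z) has_derivative (\<lambda>z. frechet_derivative G (at 0) (0, z))) (at 0)"
    proof (rule has_derivative_transform_within_open)
      show "open (ball (0 :: real^'n) R1)" "0 \<in> ball (0 :: real^'n) R1" using R1 by simp_all
      show "G (0, z) = x0 + z" if "z \<in> ball 0 R1" for z using G(3) that by simp
    qed
    moreover have "((\<lambda>z. x0 + z) has_derivative (\<lambda>z. z)) (at 0)"
      by (auto intro!: derivative_eq_intros)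
    ultimately show ?thesis using has_derivative_unique by metis
  qed
  have G0: "G 0 = x0" using G(3)[of 0] R1 by (simp add: zero_prod_def)
  have N0: "N x0 v = v" for v using MN(2)[of x0 v] M_x0 R0 by simp
  have \<Gamma>0': "frechet_derivative \<Gamma> (at 0) e = T e" for e
  proof -
    have "frechet_derivative \<Gamma> (at 0) e = frechet_derivative G (at 0) ((T e, 0) + (0, T e - \<pi> (T e)))"
      unfolding \<Gamma>'[OF Q0] P0 by (simp add: P_def)
    also have "\<dots> = \<omega> (T e) x0 + (T e - \<pi> (T e))"
      unfolding linear_add[OF linG0] G(4)[OF ball0] Gz G0 ..
    also have "\<dots> = T e" unfolding \<omega>_def N0 \<pi>_def[symmetric] by (simp add: \<pi>\<pi>)
    finally show ?thesis .
  qed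
  have "inj (frechet_derivative \<Gamma> (at 0))"
    using IT(3) \<Gamma>0' unfolding bij_def inj_def by simp
  then obtain S R \<psi> where S: "0 \<in> S" "S \<subseteq> Q" "0 < R" "diffeomorphism S (ball (\<Gamma> 0) R) \<Gamma> \<psi>"
    by (rule smooth_inverse_function[OF \<open>open Q\<close> Q0 sm\<Gamma>])
  have \<Gamma>0: "\<Gamma> 0 = x0" unfolding \<Gamma>_def P0 G0 ..
  define A where "A = ball x0 R"
  have dA: "diffeomorphism S A \<Gamma> \<psi>" using S(4) unfolding A_def \<Gamma>0 .
  have \<psi>A: "\<psi> ` A = S" using diffeomorphism_smooth(5)[OF diffeomorphism_sym[OF dA]] .
  show ?thesis
  proof
    show "x0 \<in> A" using S(3) by (simp add: A_def)
    show "diffeomorphism A (\<psi> ` A) \<psi> \<Gamma>" unfolding \<psi>A by (rule diffeomorphism_sym[OF dA])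
    show "card I = r" by (rule cardI)
    have "A = \<Gamma> ` S" using diffeomorphism_smooth(5)[OF dA] by simp
    also have "\<dots> \<subseteq> G ` ball 0 R1" unfolding \<Gamma>_def using S(2) by (auto simp: Q_def simp del: mem_ball)
    finally have AB0: "A \<subseteq> B0" using G(2) by blast
    then show "A \<subseteq> V" using B0(3) by blast
    fix q i assume q: "q \<in> A" and i: "i < r"
    define x where "x = \<psi> q"
    have x: "x \<in> S" "\<Gamma> x = q"
      using diffeomorphism_apply[OF diffeomorphism_sym[OF dA] q] by (simp_all add: x_def)
    have qB: "q \<in> B0" using q AB0 by blast
    define u where "u = w i q"
    have u: "u \<in> Sp q" unfolding u_def Sp_def using i by (intro span_base) auto
    have "\<omega> u q - u = 0"
    proof (rule \<pi>_inj[OF qB])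
      show "\<omega> u q - u \<in> Sp q" using \<omega>_Sp u unfolding Sp_def by (intro span_diff)
      show "\<pi> (\<omega> u q - u) = 0" by (simp add: linear_diff[OF lin\<pi>] \<pi>\<omega>[OF qB])
    qed
    then have \<omega>u: "\<omega> u q = u" by simp
    have "\<pi> u \<in> Sp x0" unfolding \<pi>_def by (rule W_Sp)
    then obtain e where e: "e \<in> coordinate_subspace I" "T e = \<pi> u" using IT(4) by (metis imageE)
    have xQ: "x \<in> Q" using x S(2) by blast
    then have Px: "P x \<in> ball 0 R1" by (simp add: Q_def)
    have "frechet_derivative \<Gamma> (at x) e = frechet_derivative G (at (P x)) (\<pi> u, 0)"
      unfolding \<Gamma>'[OF xQ] by (simp add: P_def e(2) \<pi>\<pi>)
    also have "\<dots> = \<omega> (\<pi> u) q" unfolding G(4)[OF Px] using x(2) by (simp add: \<Gamma>_def)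
    also have "\<dots> = u" unfolding \<omega>\<pi> by (rule \<omega>u)
    finally have "frechet_derivative \<Gamma> (at x) e = u" .
    then have "frechet_derivative \<psi> (at q) u = e"
      using diffeomorphism_derivative_inverse[OF dA x(1), of e] x(2) by simp
    then show "frechet_derivative \<psi> (at q) (w i q) \<in> coordinate_subspace I"
      using e(1) by (simp add: u_def)
  qed
qed

section \<open>Triangular systems\<close>

lemma block_eq_iff: "block I x = block I y \<longleftrightarrow> (\<forall>i\<in>I. x $ i = y $ i)"
  unfolding block_def by (auto simp: restrict_def fun_eq_iff)

lemma triangular_formD:
  assumes "triangular_form I2 J2 W g" "(x, u) \<in> W" "(x, u') \<in> W" "u - u' \<in> coordinate_subspace J2"
  shows "g (x, u) - g (x, u') \<in> coordinate_subspace I2"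
proof -
  obtain f1 f2 where f: "\<forall>(x, u)\<in>W. block (- I2) (g (x, u)) = f1 (block (- I2) x) (block I2 x) (block (- J2) u) \<and>
      block I2 (g (x, u)) = f2 (block (- I2) x) (block I2 x) (block (- J2) u) (block J2 u)"
    using assms(1) unfolding triangular_form_def by blast
  have "block (- J2) u = block (- J2) u'"
    using assms(4) by (auto simp: block_eq_iff coordinate_subspace_def)
  then have "block (- I2) (g (x, u)) = block (- I2) (g (x, u'))"
    using bspec[OF f assms(2)] bspec[OF f assms(3)] by simp
  then show ?thesis by (auto simp: block_eq_iff coordinate_subspace_def)
qed

text \<open>
  The functions of the normal form are obtained by choosing, for given values of the blocks, any
  point of the domain that has these values.
\<close>

lemma triangular_formI:
  assumes "\<And>x u u'. (x, u) \<in> W \<Longrightarrow> (x, u') \<in> W \<Longrightarrow> u - u' \<in> coordinate_subspace J2 \<Longrightarrow>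
    g (x, u) - g (x, u') \<in> coordinate_subspace I2"
  shows "triangular_form I2 J2 W g"
proof -
  define f1 where "f1 a b c = block (- I2) (g (SOME p. p \<in> W \<and> block (- I2) (fst p) = a \<and>
      block I2 (fst p) = b \<and> block (- J2) (snd p) = c))" for a b c
  define f2 where "f2 a b c d = block I2 (g (SOME p. p \<in> W \<and> block (- I2) (fst p) = a \<and>
      block I2 (fst p) = b \<and> block (- J2) (snd p) = c \<and> block J2 (snd p) = d))" for a b c d
  have "block (- I2) (g (x, u)) = f1 (block (- I2) x) (block I2 x) (block (- J2) u) \<and>
        block I2 (g (x, u)) = f2 (block (- I2) x) (block I2 x) (block (- J2) u) (block J2 u)"
    if W: "(x, u) \<in> W" for x u
  proof
    define P where "P p \<longleftrightarrow> p \<in> W \<and> block (- I2) (fst p) = block (- I2) x \<and>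
      block I2 (fst p) = block I2 x \<and> block (- J2) (snd p) = block (- J2) u" for p
    have "P (SOME p. P p)" by (rule someI[of P "(x, u)"]) (simp add: P_def W)
    then obtain x' u' where p: "(SOME p. P p) = (x', u')" "P (x', u')" by (metis surj_pair)
    have "x' = x" using p(2) unfolding P_def by (auto simp: block_eq_iff vec_eq_iff)
    moreover have "u - u' \<in> coordinate_subspace J2"
      using p(2) unfolding P_def by (auto simp: block_eq_iff coordinate_subspace_def)
    ultimately have "g (x, u) - g (x', u') \<in> coordinate_subspace I2"
      using assms[OF W] p(2) unfolding P_def by blast
    then have "block (- I2) (g (x, u)) = block (- I2) (g (SOME p. P p))"
      unfolding p(1) by (auto simp: block_eq_iff coordinate_subspace_def)
    then show "block (- I2) (g (x, u)) = f1 (block (- I2) x) (block I2 x) (block (- J2) u)"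
      unfolding f1_def P_def .
  next
    define P where "P p \<longleftrightarrow> p \<in> W \<and> block (- I2) (fst p) = block (- I2) x \<and>
      block I2 (fst p) = block I2 x \<and> block (- J2) (snd p) = block (- J2) u \<and> block J2 (snd p) = block J2 u" for p
    have "P (SOME p. P p)" by (rule someI[of P "(x, u)"]) (simp add: P_def W)
    then have "(SOME p. P p) = (x, u)"
      unfolding P_def by (auto simp: block_eq_iff vec_eq_iff prod_eq_iff)
    then show "block I2 (g (x, u)) = f2 (block (- I2) x) (block I2 x) (block (- J2) u) (block J2 u)"
      unfolding f2_def P_def by simp
  qed
  then show ?thesis unfolding triangular_form_def by blast
qed

lemma extended_map_derivative:
  fixes \<Phi>x :: "real^'n \<Rightarrow> real^'n" and \<Phi>u :: "(real^'n) \<times> (real^'m) \<Rightarrow> real^'m"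
  assumes "(\<Phi>x has_derivative Dx) (at (fst p))" "(\<Phi>u has_derivative Du) (at p)"
  shows "(extended_map \<Phi>x \<Phi>u has_derivative (\<lambda>d. (Dx (fst d), Du d))) (at p)"
proof -
  have "extended_map \<Phi>x \<Phi>u = (\<lambda>p. (\<Phi>x (fst p), \<Phi>u p))"
    by (simp add: extended_map_def case_prod_beta fun_eq_iff)
  moreover have "((\<lambda>p. \<Phi>x (fst p)) has_derivative (\<lambda>d. Dx (fst d))) (at p)"
    by (rule has_derivative_compose[OF has_derivative_fst[OF has_derivative_ident] assms(1)])
  ultimately show ?thesis using has_derivative_Pair[OF _ assms(2)] by simp
qed

lemma inj_partial_derivative_compose_diffeomorphism:
  fixes f :: "(real^'n) \<times> (real^'m) \<Rightarrow> real^'n"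
  assumes d: "diffeomorphism A B \<Phi> \<Psi>" and fp: "f p \<in> A" and f: "(f has_derivative Df) (at p)"
  shows "frechet_derivative (\<lambda>p. \<Phi> (f p)) (at p) h = frechet_derivative \<Phi> (at (f p)) (Df h)"
    and "inj (\<lambda>v. Df (0, v)) \<Longrightarrow> inj (\<lambda>v. frechet_derivative (\<lambda>p. \<Phi> (f p)) (at p) (0, v))"
proof -
  have "((\<lambda>p. \<Phi> (f p)) has_derivative (\<lambda>h. frechet_derivative \<Phi> (at (f p)) (Df h))) (at p)"
    by (rule has_derivative_compose[OF f smooth_on_has_derivative[OF diffeomorphism_smooth(1)[OF d] fp]])
  from frechet_derivative_apply_eq[OF this]
  show eq: "frechet_derivative (\<lambda>p. \<Phi> (f p)) (at p) h = frechet_derivative \<Phi> (at (f p)) (Df h)" for h .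
  assume i: "inj (\<lambda>v. Df (0, v))"
  show "inj (\<lambda>v. frechet_derivative (\<lambda>p. \<Phi> (f p)) (at p) (0, v))"
    unfolding eq
  proof (rule injI)
    fix a b assume "frechet_derivative \<Phi> (at (f p)) (Df (0, a)) = frechet_derivative \<Phi> (at (f p)) (Df (0, b))"
    then have "Df (0, a) = Df (0, b)" using diffeomorphism_derivative_inverse[OF d fp] by metis
    then show "a = b" using i by (auto dest: injD)
  qed
qed

section \<open>From the normal form to the distribution\<close>

text \<open>
  In the normal form the derivative of \<open>\<Phi>x \<circ> f\<close> maps the \<open>u2\<close>-directions, pulled back by the
  transformation, injectively into the \<open>x2\<close>-directions. Equality of the two dimensions makes this
  map onto.
\<close>

lemma triangular_imp_coordinate_directions_attained:
  fixes f :: "(real^'n) \<times> (real^'m) \<Rightarrow> real^'n"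
  assumes tr: "state_input_transformation f A W \<Phi>x \<Phi>u \<Phi>hat"
    and tri: "triangular_form I2 J2 (extended_map \<Phi>x \<Phi>u ` W) (transformed_system f \<Phi>x \<Phi>hat)"
    and card: "card I2 = card J2"
    and p: "p \<in> W" and g: "smooth_on W (\<lambda>p. \<Phi>x (f p))"
    and inj: "inj (\<lambda>v. frechet_derivative (\<lambda>p. \<Phi>x (f p)) (at p) (0, v))"
    and e: "e \<in> coordinate_subspace I2"
  obtains v where "frechet_derivative (\<lambda>p. \<Phi>x (f p)) (at p) (0, v) = e"
proof -
  define X where "X = extended_map \<Phi>x \<Phi>u"
  define g where "g = (\<lambda>p. \<Phi>x (f p))"
  have d: "diffeomorphism W (X ` W) X \<Phi>hat" and fW: "fst ` W \<subseteq> A"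
    using tr unfolding state_input_transformation_def X_def by blast+
  obtain \<Psi>x where dx: "diffeomorphism A (\<Phi>x ` A) \<Phi>x \<Psi>x"
    using tr unfolding state_input_transformation_def by blast
  note d' = diffeomorphism_sym[OF d]
  have oXW: "open (X ` W)" using diffeomorphism_smooth(4)[OF d] .
  have Xp: "X p \<in> X ` W" "\<Phi>hat (X p) = p" using diffeomorphism_apply[OF d p] .
  define N where "N = frechet_derivative \<Phi>hat (at (X p))"
  have N: "(\<Phi>hat has_derivative N) (at (X p))"
    unfolding N_def using smooth_on_has_derivative[OF diffeomorphism_smooth(2)[OF d] Xp(1)] .
  have linN: "linear N" using has_derivative_linear[OF N] .
  define Dg where "Dg = frechet_derivative g (at p)"
  have Dg: "(g has_derivative Dg) (at p)"
    unfolding Dg_def g_def using smooth_on_has_derivative[OF assms(5) p] .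
  have XN: "frechet_derivative X (at p) (N h) = h" for h
    using diffeomorphism_derivative_inverse[OF d' Xp(1), of h] unfolding N_def Xp(2) .
  have DX: "(X has_derivative frechet_derivative X (at p)) (at p)"
    using smooth_on_has_derivative[OF diffeomorphism_smooth(1)[OF d] p] .
  have fp: "fst p \<in> A" using fW p by blast
  have Dx: "(\<Phi>x has_derivative frechet_derivative \<Phi>x (at (fst p))) (at (fst p))"
    using smooth_on_has_derivative[OF diffeomorphism_smooth(1)[OF dx] fp] .
  have fstX: "fst (frechet_derivative X (at p) h) = frechet_derivative \<Phi>x (at (fst p)) (fst h)" for h
  proof -
    have "((\<lambda>q. fst (X q)) has_derivative (\<lambda>h. fst (frechet_derivative X (at p) h))) (at p)"
      by (rule has_derivative_fst[OF DX])
    moreover have "(\<lambda>q. fst (X q)) = (\<lambda>q. \<Phi>x (fst q))"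
      by (simp add: X_def extended_map_def case_prod_beta)
    moreover have "((\<lambda>q. \<Phi>x (fst q)) has_derivative (\<lambda>h. frechet_derivative \<Phi>x (at (fst p)) (fst h))) (at p)"
      by (rule has_derivative_compose[OF has_derivative_fst[OF has_derivative_ident] Dx])
    ultimately show ?thesis using has_derivative_unique by metis
  qed
  have fstN: "fst (N (0, d)) = 0" for d
  proof -
    have "frechet_derivative \<Phi>x (at (fst p)) (fst (N (0, d))) = 0"
      unfolding fstX[symmetric] XN by simp
    then show ?thesis
      using diffeomorphism_derivative_inverse[OF dx fp, of "fst (N (0, d))"]
        linear_0[OF has_derivative_linear[OF smooth_on_has_derivative[OF diffeomorphism_smooth(2)[OF dx]
          diffeomorphism_apply(1)[OF dx fp]]]] by simp
  qed
  define K where "K v = Dg (0, v)" for v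
  have linK: "linear K"
    unfolding K_def
    using linear_compose[OF _ has_derivative_linear[OF Dg], of "\<lambda>v. (0, v)"]
    by (simp add: o_def linear_iff)
  have injK: "inj K" using inj unfolding K_def Dg_def g_def .
  define L where "L d = snd (N (0, d))" for d
  have N_eq: "N (0, d) = (0, L d)" for d using fstN[of d] by (simp add: L_def prod_eq_iff)
  have linL: "linear L"
  proof (rule linearI)
    show "L (a + b) = L a + L b" for a b
      using linear_add[OF linN, of "(0, a)" "(0, b)"] by (simp add: L_def)
    show "L (c *\<^sub>R a) = c *\<^sub>R L a" for c a
      using linear_scale[OF linN, of c "(0, a)"] by (simp add: L_def)
  qed
  have injL: "inj L"
  proof (rule injI)
    fix a b assume "L a = L b"
    then have "N (0, a) = N (0, b)" by (simp add: N_eq)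
    then have "frechet_derivative X (at p) (N (0, a)) = frechet_derivative X (at p) (N (0, b))" by (rule arg_cong)
    then show "a = b" unfolding XN by simp
  qed
  have KL: "K (L d) \<in> coordinate_subspace I2" if "d \<in> coordinate_subspace J2" for d
  proof -
    obtain x u where xu: "X p = (x, u)" by fastforce
    have c: "continuous_on UNIV (\<lambda>s::real. (x, u + s *\<^sub>R d))" by (intro continuous_intros)
    have line: "((\<lambda>s::real. (x, u + s *\<^sub>R d)) has_derivative (\<lambda>s. (0, s *\<^sub>R d))) (at 0)"
      by (auto intro!: derivative_eq_intros)
    have N0: "(\<Phi>hat has_derivative N) (at (x, u + 0 *\<^sub>R d))" using N xu by simp
    have Dg0: "(g has_derivative Dg) (at (\<Phi>hat (x, u + 0 *\<^sub>R d)))" using Dg Xp(2) xu by simp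
    from has_derivative_compose[OF has_derivative_compose[OF line N0] Dg0]
    have 1: "((\<lambda>s::real. g (\<Phi>hat (x, u + s *\<^sub>R d)) - g (\<Phi>hat (x, u))) has_derivative (\<lambda>s. Dg (N (0, s *\<^sub>R d)) - 0)) (at 0)"
      by (intro has_derivative_diff has_derivative_const)
    have 2: "g (\<Phi>hat (x, u + s *\<^sub>R d)) - g (\<Phi>hat (x, u)) \<in> coordinate_subspace I2"
      if "s \<in> (\<lambda>s::real. (x, u + s *\<^sub>R d)) -` (X ` W)" for s
      using triangular_formD[OF tri[folded X_def], of x "u + s *\<^sub>R d" u] that Xp(1)
        subspace_scale[OF subspace_coordinate_subspace \<open>d \<in> coordinate_subspace J2\<close>]
      unfolding transformed_system_def g_def xu by simp
    have 3: "open ((\<lambda>s::real. (x, u + s *\<^sub>R d)) -` (X ` W))" by (rule open_vimage[OF oXW c])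
    have 4: "0 \<in> (\<lambda>s::real. (x, u + s *\<^sub>R d)) -` (X ` W)" using Xp(1) xu by simp
    have "Dg (N (0, 1 *\<^sub>R d)) - 0 \<in> coordinate_subspace I2"
      using derivative_in_coordinate_subspace[OF 3 4 1 2] .
    then show ?thesis by (simp add: N_eq K_def)
  qed
  have "(K \<circ> L) ` coordinate_subspace J2 = coordinate_subspace I2"
    by (rule linear_image_eq_if_dim)
      (use linear_compose[OF linL linK] inj_compose[OF injK injL] KL card in
        \<open>auto simp: subspace_coordinate_subspace dim_coordinate_subspace\<close>)
  then obtain d where "e = K (L d)" using e by auto
  then show ?thesis using that[of "L d"] by (simp add: K_def Dg_def g_def)
qed

text \<open>
  \<open>D p\<close> consists of the vectors \<open>(0, v)\<close> that \<open>d(\<Phi>x \<circ> f)\<close> maps into the coordinate subspace of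
  \<open>I2\<close>, and \<open>\<Theta> p\<close> is the inverse of this map on that subspace. With a left inverse \<open>L\<close> of the partial
  derivative at the equilibrium, \<open>\<Theta> p\<close> is given by the inverse of a square matrix near the identity,
  which is smooth in \<open>p\<close>.
\<close>

lemma normal_form_imp_distribution:
  fixes f :: "(real^'n) \<times> (real^'m) \<Rightarrow> real^'n"
  assumes "p0 \<in> W" and f: "smooth_on W f"
    and rank: "\<And>p. p \<in> W \<Longrightarrow> inj (\<lambda>v. frechet_derivative f (at p) (0, v))"
    and tr: "state_input_transformation f A W \<Phi>x \<Phi>u \<Phi>hat"
    and card: "card I2 = m2" "card J2 = m2"
    and tri: "triangular_form I2 J2 (extended_map \<Phi>x \<Phi>u ` W) (transformed_system f \<Phi>x \<Phi>hat)"
  shows "\<exists>W' V D. open W' \<and> p0 \<in> W' \<and> W' \<subseteq> W \<and> open V \<and> f ` W' \<subseteq> V \<and> distribution_on W' m2 D \<and>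
     (\<forall>p\<in>W'. D p \<subseteq> span_du) \<and> projectable_distribution f W' V m2 D \<and> involutive_on W' D"
proof -
  obtain \<Psi>x where dx: "diffeomorphism A (\<Phi>x ` A) \<Phi>x \<Psi>x" and fA: "f ` W \<subseteq> A"
    using tr unfolding state_input_transformation_def by blast
  have oW: "open W"
    using tr unfolding state_input_transformation_def diffeomorphism_def by blast
  have oA: "open A" using diffeomorphism_smooth(3)[OF dx] .
  define g where "g = (\<lambda>p. \<Phi>x (f p))"
  have smg: "smooth_on W g"
    unfolding g_def by (rule smooth_on_compose[OF f diffeomorphism_smooth(1)[OF dx] oW oA fA])
  have Df: "(f has_derivative frechet_derivative f (at p)) (at p)" if "p \<in> W" for p
    using smooth_on_has_derivative[OF f that] .
  define Dg where "Dg p = frechet_derivative g (at p)" for p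
  have Dg_eq: "Dg p h = frechet_derivative \<Phi>x (at (f p)) (frechet_derivative f (at p) h)" if "p \<in> W" for p h
    unfolding Dg_def g_def
    by (rule inj_partial_derivative_compose_diffeomorphism(1)[OF dx _ Df[OF that]]) (use fA that in blast)
  have injK: "inj (\<lambda>v. Dg p (0, v))" if "p \<in> W" for p
    unfolding Dg_def g_def
    by (rule inj_partial_derivative_compose_diffeomorphism(2)[OF dx _ Df[OF that] rank[OF that]]) (use fA that in blast)
  have linDg: "linear (Dg p)" if "p \<in> W" for p
    unfolding Dg_def using has_derivative_linear[OF smooth_on_has_derivative[OF smg that]] .
  have att: "\<exists>v. Dg p (0, v) = e" if "p \<in> W" "e \<in> coordinate_subspace I2" for p e
    using triangular_imp_coordinate_directions_attained[OF tr tri _ that(1) smg[unfolded g_def]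
        injK[OF that(1), unfolded Dg_def g_def] that(2)] card
    unfolding Dg_def g_def by metis
  \<comment> \<open>solve \<open>Dg p (0, v) = e\<close> smoothly in \<open>p\<close>\<close>
  have linK: "linear (\<lambda>v. Dg p (0, v))" if "p \<in> W" for p
    using linear_compose[OF _ linDg[OF that], of "\<lambda>v. (0, v)"] by (simp add: o_def linear_iff)
  obtain L where L: "linear L" "L \<circ> (\<lambda>v. Dg p0 (0, v)) = id"
    using linear_injective_left_inverse[OF linK injK] assms(1) by blast
  have smM: "smooth_on W (\<lambda>p. L (Dg p (0, v)))" for v
    unfolding smooth_on_def Dg_def
    using Ck_on_bounded_linear[OF L(1)[unfolded linear_conv_bounded_linear] oW
      smooth_on_Ck[OF smooth_on_frechet_derivative[OF smg]]] by (rule allI)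
  obtain R N where R: "0 < R" "ball p0 R \<subseteq> W" and linN: "\<And>p. p \<in> ball p0 R \<Longrightarrow> linear (N p)"
    and N: "\<And>p v. p \<in> ball p0 R \<Longrightarrow> N p (L (Dg p (0, v))) = v"
    and smN: "\<And>v. smooth_on (ball p0 R) (\<lambda>p. N p v)"
  proof (rule smooth_linear_inverse[OF oW assms(1), of "\<lambda>p v. L (Dg p (0, v))"])
    show "linear (\<lambda>v. L (Dg p (0, v)))" if "p \<in> W" for p
      using linear_compose[OF linK[OF that] L(1)] by (simp add: o_def)
    show "L (Dg p0 (0, v)) = v" for v using L(2) by (metis comp_apply id_apply)
  qed (use smM in blast)+
  define B where "B = ball p0 R"
  have B: "open B" "p0 \<in> B" "B \<subseteq> W" using R by (auto simp: B_def)
  define \<Theta> where "\<Theta> p e = (0 :: real^'n, N p (L e))" for p e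
  have DgO: "Dg p (\<Theta> p e) = e" if p: "p \<in> B" and e: "e \<in> coordinate_subspace I2" for p e
  proof -
    have "p \<in> W" using p B(3) by blast
    then obtain v where "Dg p (0, v) = e" using att e by blast
    then show ?thesis using N[of p v] p by (auto simp: \<Theta>_def B_def)
  qed
  have linO: "linear (\<Theta> p)" if "p \<in> B" for p
    unfolding \<Theta>_def
    using linear_add[OF linN[of p]] linear_scale[OF linN[of p]] that
    by (intro linearI) (simp_all add: linear_add[OF L(1)] linear_scale[OF L(1)] B_def)
  define D where "D p = {d. fst d = 0 \<and> Dg p d \<in> coordinate_subspace I2}" for p
  have DO: "D p = \<Theta> p ` coordinate_subspace I2" if p: "p \<in> B" for p
  proof
    show "\<Theta> p ` coordinate_subspace I2 \<subseteq> D p"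
      using DgO[OF p] by (auto simp: D_def) (simp add: \<Theta>_def)
    show "D p \<subseteq> \<Theta> p ` coordinate_subspace I2"
    proof
      fix d assume d: "d \<in> D p"
      obtain v where v: "d = (0, v)" using d by (cases d) (auto simp: D_def)
      have "\<Theta> p (Dg p d) = d" unfolding v \<Theta>_def using N[of p v] p by (simp add: B_def)
      then show "d \<in> \<Theta> p ` coordinate_subspace I2" using d unfolding D_def by (metis (mono_tags, lifting) imageI mem_Collect_eq)
    qed
  qed
  have injO: "inj_on (\<Theta> p) (coordinate_subspace I2)" if "p \<in> B" for p
    using DgO[OF that] by (metis inj_on_inverseI)
  obtain h where h: "bij_betw h {..<m2} I2"
    using card(1) by (metis card_lessThan finite finite_lessThan finite_same_card_bij)
  define v where "v i p = \<Theta> p (axis (h i) 1)" for i p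
  have axI: "axis (h i) 1 \<in> coordinate_subspace I2" if "i < m2" for i
    using h that unfolding coordinate_subspace_eq_span bij_betw_def by (auto intro!: span_base)
  have img: "(\<lambda>i. v i p) ` {..<m2} = \<Theta> p ` (\<lambda>i. axis i 1) ` I2" for p
    using h unfolding v_def bij_betw_def by (auto simp: image_image)
  have smv: "smooth_on B (v i)" for i
    unfolding smooth_on_def v_def \<Theta>_def
    by (intro allI Ck_on_Pair Ck_on_const B smooth_on_Ck[OF smN, folded B_def])
  have frame: "frame_on B m2 v D"
    unfolding frame_on_def
  proof (intro conjI ballI allI impI)
    show "smooth_on B (v i)" for i by (rule smv)
    fix p assume p: "p \<in> B"
    have inj': "inj_on (\<Theta> p) (span ((\<lambda>i. axis i 1) ` I2))"
      using injO[OF p] unfolding coordinate_subspace_eq_span .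
    show "inj_on (\<lambda>i. v i p) {..<m2}"
    proof (rule inj_onI)
      fix i j assume ij: "i \<in> {..<m2}" "j \<in> {..<m2}" "v i p = v j p"
      then have "axis (h i) (1::real) = axis (h j) 1"
        using inj_onD[OF injO[OF p]] axI unfolding v_def by blast
      then have "h i = h j" by (simp add: axis_eq_axis)
      then show "i = j" using h ij unfolding bij_betw_def inj_on_def by blast
    qed
    show "independent ((\<lambda>i. v i p) ` {..<m2})"
      unfolding img by (rule linear_independent_injective_image[OF linO[OF p] independent_axes inj'])
    show "span ((\<lambda>i. v i p) ` {..<m2}) = D p"
      unfolding img linear_span_image[OF linO[OF p]] DO[OF p] coordinate_subspace_eq_span ..
  qed
  have dist: "distribution_on B m2 D"
    unfolding distribution_on_def
  proof (intro conjI ballI)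
    fix p assume p: "p \<in> B"
    note fr = frame[unfolded frame_on_def, THEN conjunct2, rule_format, OF p]
    show "subspace (D p)" using fr subspace_span by metis
    show "dim (D p) = m2" using fr dim_span_eq_card_independent card_image by (metis card_lessThan)
    show "\<exists>W' v. open W' \<and> p \<in> W' \<and> W' \<subseteq> B \<and> frame_on W' m2 v D"
      using B(1) p frame by blast
  qed
  have proj: "projectable_distribution f B A m2 D"
    unfolding projectable_distribution_def projectable_field_def
  proof (intro exI[of _ v] conjI allI impI frame smv)
    fix i assume i: "i < m2"
    let ?w = "\<lambda>q. frechet_derivative \<Psi>x (at (\<Phi>x q)) (axis (h i) 1)"
    show "\<exists>w. smooth_on A w \<and> (\<forall>q\<in>A. \<forall>p\<in>B. f p = q \<longrightarrow> frechet_derivative f (at p) (v i p) = w q)"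
    proof (intro exI[of _ ?w] conjI ballI impI)
      show "smooth_on A ?w"
        by (rule smooth_on_compose[OF diffeomorphism_smooth(1)[OF dx]
              smooth_on_frechet_derivative[OF diffeomorphism_smooth(2)[OF dx]]
              diffeomorphism_smooth(3,4)[OF dx]]) simp
      fix q p assume q: "q \<in> A" and p: "p \<in> B" and fp: "f p = q"
      have "frechet_derivative \<Phi>x (at q) (frechet_derivative f (at p) (v i p)) = axis (h i) 1"
        using Dg_eq[of p "v i p"] DgO[OF p axI[OF i]] p B(3) fp unfolding v_def by auto
      then show "frechet_derivative f (at p) (v i p) = ?w q"
        using diffeomorphism_derivative_inverse[OF dx q] by metis
    qed
  qed
  have invol: "involutive_on B D"
    unfolding involutive_on_def
  proof (intro allI impI ballI)
    fix S a b p
    assume *: "open S \<and> S \<subseteq> B \<and> smooth_on S a \<and> smooth_on S b \<and> (\<forall>p\<in>S. a p \<in> D p \<and> b p \<in> D p)"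
      and p: "p \<in> S"
    then have S: "open S" "S \<subseteq> B" "smooth_on S a" "smooth_on S b"
      and ab: "\<And>p. p \<in> S \<Longrightarrow> a p \<in> D p" "\<And>p. p \<in> S \<Longrightarrow> b p \<in> D p" by blast+
    have smg': "smooth_on S g" using smooth_on_subset[OF smg] S(2) B(3) by blast
    have fst0: "fst (frechet_derivative c (at p) d) = 0" if "smooth_on S c" "\<And>p. p \<in> S \<Longrightarrow> c p \<in> D p" for c d
      by (rule derivative_annihilated[OF S(1) p smooth_on_has_derivative[OF that(1) p] bounded_linear_fst])
        (use that(2) in \<open>simp add: D_def\<close>)
    have Dgc: "frechet_derivative (\<lambda>x. frechet_derivative g (at x) (c x)) (at p) d \<in> coordinate_subspace I2"
      if "smooth_on S c" "\<And>p. p \<in> S \<Longrightarrow> c p \<in> D p" for c d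
    proof -
      note der = has_derivative_frechet_derivative_apply[OF S(1) p smg' that(1)]
      show ?thesis
        unfolding frechet_derivative_apply_eq[OF der]
        by (rule derivative_in_coordinate_subspace[OF S(1) p der]) (use that(2) in \<open>simp add: D_def Dg_def\<close>)
    qed
    have "fst (lie_bracket a b p) = 0"
      unfolding lie_bracket_def using fst0[OF S(3) ab(1)] fst0[OF S(4) ab(2)] by simp
    moreover have "Dg p (lie_bracket a b p) \<in> coordinate_subspace I2"
      unfolding Dg_def frechet_derivative_lie_bracket[OF S(1) p smg' S(3,4)]
      by (intro subspace_diff[OF subspace_coordinate_subspace] Dgc S ab)
    ultimately show "lie_bracket a b p \<in> D p" by (simp add: D_def)
  qed
  have "f ` B \<subseteq> A" using fA B(3) by blast
  moreover have "\<forall>p\<in>B. D p \<subseteq> span_du" unfolding span_du_eq by (auto simp: D_def)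
  ultimately show ?thesis using B oA dist proj invol by blast
qed

section \<open>From the distribution to the normal form\<close>

text \<open>
  Frobenius' theorem is applied to the fields \<open>w i\<close> to which the projectable frame of \<open>D\<close> is related.
  For the input, a linear image of the transformed successor state is used. Its blocks are chosen
  such that \<open>S\<close> maps the directions of \<open>x2\<close> to those of \<open>u2\<close>; then \<open>D\<close> is mapped into the directions
  of \<open>u2\<close> at every point and, by dimension, onto them.
\<close>

lemma distribution_imp_normal_form:
  fixes f :: "(real^'n) \<times> (real^'m) \<Rightarrow> real^'n"
  assumes W0: "open W0" "(x0, u0) \<in> W0" and eq: "f (x0, u0) = x0" and f: "smooth_on W0 f"
    and sub: "\<And>p. p \<in> W0 \<Longrightarrow> surj (frechet_derivative f (at p))"
    and rank: "\<And>p. p \<in> W0 \<Longrightarrow> inj (\<lambda>v. frechet_derivative f (at p) (0, v))"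
    and V: "open V" "f ` W0 \<subseteq> V"
    and D_du: "\<And>p. p \<in> W0 \<Longrightarrow> D p \<subseteq> span_du"
    and proj: "projectable_distribution f W0 V m2 D" and inv: "involutive_on W0 D"
  shows "\<exists>A W \<Phi>x \<Phi>u \<Phi>hat I2 J2. (x0, u0) \<in> W \<and> W \<subseteq> W0 \<and>
        state_input_transformation f A W \<Phi>x \<Phi>u \<Phi>hat \<and> card I2 = m2 \<and> card J2 = m2 \<and>
        triangular_form I2 J2 (extended_map \<Phi>x \<Phi>u ` W) (transformed_system f \<Phi>x \<Phi>hat)"
proof -
  define p0 where "p0 = (x0, u0)"
  have p0: "p0 \<in> W0" "f p0 = x0" using W0 eq by (simp_all add: p0_def)
  define Df where "Df p = frechet_derivative f (at p)" for p
  have Df: "(f has_derivative Df p) (at p)" if "p \<in> W0" for p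
    unfolding Df_def using smooth_on_has_derivative[OF f that] .
  have linDf: "linear (Df p)" if "p \<in> W0" for p using has_derivative_linear[OF Df[OF that]] .
  obtain v where frame: "frame_on W0 m2 v D" and "\<forall>i<m2. projectable_field f W0 V (v i)"
    using proj unfolding projectable_distribution_def by blast
  then have "\<forall>i<m2. \<exists>w. smooth_on V w \<and> (\<forall>q\<in>V. \<forall>p\<in>W0. f p = q \<longrightarrow> frechet_derivative f (at p) (v i p) = w q)"
    unfolding projectable_field_def by blast
  then obtain w where w: "\<And>i. i < m2 \<Longrightarrow> smooth_on V (w i)"
    "\<And>i q p. i < m2 \<Longrightarrow> q \<in> V \<Longrightarrow> p \<in> W0 \<Longrightarrow> f p = q \<Longrightarrow> frechet_derivative f (at p) (v i p) = w i q"
    by metis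
  have rel: "frechet_derivative f (at p) (v i p) = w i (f p)" if "i < m2" "p \<in> W0" for i p
    using w(2)[OF that(1) _ that(2) refl] V(2) that(2) by blast
  have smv: "smooth_on W0 (v i)" if "i < m2" for i using frame that unfolding frame_on_def by blast
  have fr: "inj_on (\<lambda>i. v i p) {..<m2}" "independent ((\<lambda>i. v i p) ` {..<m2})"
    "span ((\<lambda>i. v i p) ` {..<m2}) = D p" if "p \<in> W0" for p
    using frame that unfolding frame_on_def by blast+
  have Dspan: "Df p ` D p = span ((\<lambda>k. w k (f p)) ` {..<m2})" if "p \<in> W0" for p
  proof -
    have "Df p ` D p = span (Df p ` (\<lambda>i. v i p) ` {..<m2})"
      unfolding fr(3)[OF that, symmetric] by (rule linear_span_image[OF linDf[OF that], symmetric])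
    also have "Df p ` (\<lambda>i. v i p) ` {..<m2} = (\<lambda>k. w k (f p)) ` {..<m2}"
      unfolding image_image by (rule image_cong) (use rel[OF _ that] in \<open>auto simp: Df_def\<close>)
    finally show ?thesis .
  qed
  have D_fst: "d = (0, snd d)" if "p \<in> W0" "d \<in> D p" for p d
    using D_du[OF that(1)] that(2) unfolding span_du_eq by (auto simp: prod_eq_iff)
  have injDf: "inj_on (Df p) (D p)" if p: "p \<in> W0" for p
  proof (rule inj_onI)
    fix a b assume ab: "a \<in> D p" "b \<in> D p" "Df p a = Df p b"
    have "Df p (0, snd a) = Df p (0, snd b)" using ab D_fst[OF p] by metis
    then have "snd a = snd b" using injD[OF rank[OF p]] unfolding Df_def by blast
    then show "a = b" using D_fst[OF p] ab by metis
  qed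
  \<comment> \<open>brackets are controlled on the image of \<open>f\<close>, which is a neighbourhood of \<open>x0\<close>\<close>
  define V1 where "V1 = f ` W0"
  have V1: "open V1" "x0 \<in> V1" "V1 \<subseteq> V"
    using open_image_if_derivative_surj[OF W0(1) f sub] p0 V(2) unfolding V1_def by force+
  have w_eq: "(\<lambda>i. w i x0) ` {..<m2} = Df p0 ` (\<lambda>i. v i p0) ` {..<m2}"
    unfolding image_image by (rule image_cong) (use rel[OF _ p0(1)] p0(2) in \<open>auto simp: Df_def\<close>)
  have ind: "independent ((\<lambda>i. w i x0) ` {..<m2})"
    unfolding w_eq
    by (rule linear_independent_injective_image[OF linDf[OF p0(1)] fr(2)[OF p0(1)]])
      (use injDf[OF p0(1)] fr(3)[OF p0(1)] in simp)
  have injw: "inj_on (\<lambda>i. w i x0) {..<m2}"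
  proof (rule inj_onI)
    fix i j assume ij: "i \<in> {..<m2}" "j \<in> {..<m2}" "w i x0 = w j x0"
    have "v i p0 \<in> D p0" "v j p0 \<in> D p0"
      unfolding fr(3)[OF p0(1), symmetric] using ij(1,2) by (auto intro: span_base)
    moreover have "Df p0 (v i p0) = Df p0 (v j p0)"
      using ij rel[OF _ p0(1)] p0(2) unfolding Df_def by auto
    ultimately have "v i p0 = v j p0" using inj_onD[OF injDf[OF p0(1)]] by blast
    then show "i = j" using inj_onD[OF fr(1)[OF p0(1)] _ ij(1,2)] by blast
  qed
  have br: "lie_bracket (w i) (w j) q \<in> span ((\<lambda>k. w k q) ` {..<m2})"
    if ij: "i < m2" "j < m2" and q: "q \<in> V1" for i j q
  proof -
    obtain p where p: "p \<in> W0" "q = f p" using q unfolding V1_def by blast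
    have "v i p \<in> D p" "v j p \<in> D p" if "p \<in> W0" for p
      unfolding fr(3)[OF that, symmetric] using ij by (auto intro: span_base)
    then have "lie_bracket (v i) (v j) p \<in> D p"
      using inv[unfolded involutive_on_def, rule_format, of W0 "v i" "v j" p] W0(1) smv ij p(1) by blast
    then have "Df p (lie_bracket (v i) (v j) p) \<in> span ((\<lambda>k. w k q) ` {..<m2})"
      using Dspan[OF p(1)] unfolding p(2) by blast
    moreover have "Df p (lie_bracket (v i) (v j) p) = lie_bracket (w i) (w j) q"
      unfolding Df_def p(2)
      by (rule lie_bracket_related_fields[OF W0(1) p(1) V f smv[OF ij(1)] smv[OF ij(2)] w(1)[OF ij(1)] w(1)[OF ij(2)]])
        (rule rel[OF ij(1)] rel[OF ij(2)]; assumption)+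
    ultimately show ?thesis by simp
  qed
  have smw: "smooth_on V1 (w i)" if "i < m2" for i using smooth_on_subset[OF w(1)[OF that] V1(3)] .
  obtain A \<Phi> \<Psi> and I2 :: "'n set" where A: "x0 \<in> A" "A \<subseteq> V1" and dA: "diffeomorphism A (\<Phi> ` A) \<Phi> \<Psi>"
    and I2: "card I2 = m2"
      "\<And>q i. q \<in> A \<Longrightarrow> i < m2 \<Longrightarrow> frechet_derivative \<Phi> (at q) (w i q) \<in> coordinate_subspace I2"
    by (rule frobenius_chart[OF V1(1,2) smw injw ind br];
        (assumption | (rule that; assumption)))
  have oA: "open A" using diffeomorphism_smooth(3)[OF dA] .
  have fcont: "continuous_on W0 f" using Ck_on_imp_continuous_on[OF smooth_on_Ck[OF f]] .
  define W1 where "W1 = (W0 \<inter> f -` A) \<inter> A \<times> UNIV"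
  have W1: "open W1" "p0 \<in> W1" "W1 \<subseteq> W0" "f ` W1 \<subseteq> A" "fst ` W1 \<subseteq> A"
    unfolding W1_def using continuous_open_preimage[OF fcont W0(1) oA] oA p0 A(1)
    by (auto simp: p0_def intro!: open_Int open_Times)
  define g where "g = (\<lambda>p. \<Phi> (f p))"
  define Dg where "Dg p = frechet_derivative g (at p)" for p
  have smg: "smooth_on W1 g"
    unfolding g_def
    by (rule smooth_on_compose[OF smooth_on_subset[OF f W1(3)] diffeomorphism_smooth(1)[OF dA] W1(1) oA W1(4)])
  have Dg: "(g has_derivative Dg p) (at p)" if "p \<in> W1" for p
    unfolding Dg_def using smooth_on_has_derivative[OF smg that] .
  have linDg: "linear (Dg p)" if "p \<in> W1" for p using has_derivative_linear[OF Dg[OF that]] .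
  have Dg_eq: "Dg p h = frechet_derivative \<Phi> (at (f p)) (Df p h)"
    and injK: "inj (\<lambda>v. Dg p (0, v))" if p: "p \<in> W1" for p h
  proof -
    have fp: "f p \<in> A" "p \<in> W0" using W1 p by blast+
    note * = inj_partial_derivative_compose_diffeomorphism[OF dA fp(1) Df[OF fp(2)]]
    show "Dg p h = frechet_derivative \<Phi> (at (f p)) (Df p h)" unfolding Dg_def g_def by (rule *(1))
    show "inj (\<lambda>v. Dg p (0, v))"
      unfolding Dg_def g_def by (rule *(2)[OF rank[OF fp(2), folded Df_def]])
  qed
  have DgD: "Dg p d \<in> coordinate_subspace I2" if p: "p \<in> W1" and d: "d \<in> D p" for p d
  proof -
    have pW: "p \<in> W0" "f p \<in> A" using p W1 by blast+
    have "D p \<subseteq> {d. Dg p d \<in> coordinate_subspace I2}"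
      unfolding fr(3)[OF pW(1), symmetric]
    proof (rule span_minimal)
      show "subspace {d. Dg p d \<in> coordinate_subspace I2}"
        by (rule linear_subspace_linear_preimage[OF linDg[OF p] subspace_coordinate_subspace])
      show "(\<lambda>i. v i p) ` {..<m2} \<subseteq> {d. Dg p d \<in> coordinate_subspace I2}"
        using I2(2)[OF pW(2)] rel[OF _ pW(1)] by (auto simp: Dg_eq[OF p] Df_def)
    qed
    then show ?thesis using d by blast
  qed
  have linK: "linear (\<lambda>v. Dg p (0, v))" if "p \<in> W1" for p
    using linear_compose[OF _ linDg[OF that], of "\<lambda>v. (0, v)"] by (simp add: o_def linear_iff)
  define Du where "Du p = {v. (0, v) \<in> D p}" for p
  have Du: "subspace (Du p)" "dim (Du p) = m2" if p: "p \<in> W0" for p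
  proof -
    have lin: "linear (\<lambda>v. (0 :: real^'n, v :: real^'m))" by (simp add: linear_iff)
    have sD: "subspace (D p)" using fr(3)[OF p] subspace_span by metis
    show s: "subspace (Du p)" unfolding Du_def by (rule linear_subspace_linear_preimage[OF lin sD])
    have "D p = (\<lambda>v. (0, v)) ` Du p"
      using D_fst[OF p] unfolding Du_def by (auto simp: image_iff)
    moreover have "dim ((\<lambda>v. (0 :: real^'n, v)) ` Du p) = dim (Du p)"
      by (rule dim_image_eq[OF lin]) (auto simp: inj_on_def)
    moreover have "dim (D p) = m2"
      using fr[OF p] dim_span_eq_card_independent card_image by (metis card_lessThan)
    ultimately show "dim (Du p) = m2" by simp
  qed
  have KDu: "(\<lambda>v. Dg p (0, v)) ` Du p = coordinate_subspace I2" if p: "p \<in> W1" for p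
    by (rule linear_image_eq_if_dim[OF linK[OF p] injK[OF p] Du(1) subspace_coordinate_subspace])
      (use subsetD[OF W1(3) p] DgD[OF p] Du(2)[OF subsetD[OF W1(3) p]] I2(1) in
        \<open>auto simp: dim_coordinate_subspace Du_def\<close>)
  obtain B where B: "B \<subseteq> Du p0" "independent B" "Du p0 \<subseteq> span B" "card B = dim (Du p0)"
    using basis_exists by blast
  then have spanB: "span B = Du p0" using Du(1)[OF p0(1)] span_minimal by blast
  obtain J2 :: "'m set" and Q where J2: "card J2 = card B" and Q: "linear Q" "bij Q"
    "Q ` coordinate_subspace J2 = span B"
    by (rule coordinate_subspace_adapted_to[OF B(2)])
  have cardJ: "card J2 = m2" using J2 B(4) Du(2)[OF p0(1)] by simp
  obtain Q' where Q': "linear Q'" "Q' \<circ> Q = id"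
    using linear_injective_left_inverse[OF Q(1)] Q(2) bij_is_inj by blast
  obtain L where L: "linear L" "L \<circ> (\<lambda>v. Dg p0 (0, v)) = id"
    using linear_injective_left_inverse[OF linK[OF W1(2)] injK[OF W1(2)]] by blast
  \<comment> \<open>the left inverse of \<open>\<partial>\<^sub>u g\<close> at the equilibrium, in coordinates adapted to \<open>D\<close>\<close>
  define S where "S y = Q' (L y)" for y
  have linS: "linear S" unfolding S_def using linear_compose[OF L(1) Q'(1)] by (simp add: o_def)
  have SK: "S (Dg p0 (0, v)) = Q' v" for v
    using L(2) unfolding S_def by (metis comp_apply id_apply)
  have Q'Q: "Q' (Q v) = v" for v using Q'(2) by (metis comp_apply id_apply)
  have S_I2: "S e \<in> coordinate_subspace J2" if e: "e \<in> coordinate_subspace I2" for e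
  proof -
    from e obtain v where v: "v \<in> Du p0" "e = Dg p0 (0, v)"
      unfolding KDu[OF W1(2), symmetric] by (auto elim: imageE)
    from v(1) obtain d where "d \<in> coordinate_subspace J2" "v = Q d"
      unfolding spanB[symmetric] Q(3)[symmetric] by (auto elim: imageE)
    then show ?thesis using v(2) SK Q'Q by simp
  qed
  define \<Phi>u where "\<Phi>u = (\<lambda>p. S (g p))"
  define X where "X = extended_map \<Phi> \<Phi>u"
  have X_eq: "X = (\<lambda>p. (\<Phi> (fst p), S (g p)))"
    by (simp add: X_def extended_map_def \<Phi>u_def case_prod_beta fun_eq_iff)
  have DX: "(X has_derivative (\<lambda>d. (frechet_derivative \<Phi> (at (fst p)) (fst d), S (Dg p d)))) (at p)"
    if p: "p \<in> W1" for p
    unfolding X_def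
  proof (rule extended_map_derivative)
    have "fst p \<in> A" using p W1(5) by blast
    then show "(\<Phi> has_derivative frechet_derivative \<Phi> (at (fst p))) (at (fst p))"
      by (rule smooth_on_has_derivative[OF diffeomorphism_smooth(1)[OF dA]])
    show "(\<Phi>u has_derivative (\<lambda>d. S (Dg p d))) (at p)"
      unfolding \<Phi>u_def
      by (rule bounded_linear.has_derivative[OF linS[unfolded linear_conv_bounded_linear] Dg[OF p]])
  qed
  have smX: "smooth_on W1 X"
    unfolding smooth_on_def X_eq
  proof (intro allI Ck_on_Pair W1(1))
    show "Ck_on k W1 (\<lambda>p. \<Phi> (fst p))" for k
      by (rule Ck_on_compose[OF W1(1) oA Ck_on_fst[OF W1(1) Ck_on_id[OF W1(1)]]
            smooth_on_Ck[OF diffeomorphism_smooth(1)[OF dA]] W1(5)])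
    show "Ck_on k W1 (\<lambda>p. S (g p))" for k
      by (rule Ck_on_bounded_linear[OF linS[unfolded linear_conv_bounded_linear] W1(1) smooth_on_Ck[OF smg]])
  qed
  have \<Phi>_inj: "h = 0" if "q \<in> A" "frechet_derivative \<Phi> (at q) h = 0" for q h
    using diffeomorphism_derivative_inverse[OF dA that(1), of h] that(2)
      linear_0[OF has_derivative_linear[OF smooth_on_has_derivative[OF diffeomorphism_smooth(2)[OF dA]
        diffeomorphism_apply(1)[OF dA that(1)]]]] by simp
  have x0A: "fst p0 \<in> A" using W1(2,5) by blast
  have "inj (frechet_derivative X (at p0))"
  proof -
    have lin: "linear (frechet_derivative X (at p0))"
      using has_derivative_linear[OF smooth_on_has_derivative[OF smX W1(2)]] .
    have "d = 0" if "frechet_derivative X (at p0) d = 0" for d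
    proof -
      have *: "frechet_derivative \<Phi> (at (fst p0)) (fst d) = 0" "S (Dg p0 d) = 0"
        using that unfolding frechet_derivative_apply_eq[OF DX[OF W1(2)]] by (simp_all add: prod_eq_iff)
      have fd: "fst d = 0" using \<Phi>_inj[OF x0A *(1)] .
      then have d: "d = (0, snd d)" by (simp add: prod_eq_iff)
      have "Q' (snd d) = 0" using *(2) SK d by metis
      moreover obtain a where "snd d = Q a" using Q(2) by (metis bij_pointE)
      ultimately have "snd d = 0" using Q'Q linear_0[OF Q(1)] by metis
      then show ?thesis using d by (simp add: zero_prod_def)
    qed
    then show ?thesis using linear_injective_0[OF lin] by blast
  qed
  then obtain W R \<psi> where W: "p0 \<in> W" "W \<subseteq> W1" "0 < R" and dW: "diffeomorphism W (ball (X p0) R) X \<psi>"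
    by (rule smooth_inverse_function[OF W1(1,2) smX])
  have XW: "X ` W = ball (X p0) R" using diffeomorphism_smooth(5)[OF dW] .
  \<comment> \<open>the transformation maps \<open>D\<close> onto the \<open>u2\<close>-directions, so their preimages lie in \<open>D\<close>\<close>
  have key: "Dg (\<psi> P) (frechet_derivative \<psi> (at P) (0, d)) \<in> coordinate_subspace I2"
    if P: "P \<in> ball (X p0) R" and d: "d \<in> coordinate_subspace J2" for P d
  proof -
    define p where "p = \<psi> P"
    have p: "p \<in> W" "X p = P" using diffeomorphism_apply[OF diffeomorphism_sym[OF dW] P] by (simp_all add: p_def)
    have pW1: "p \<in> W1" and pW0: "p \<in> W0" using p W W1 by blast+
    have pA: "fst p \<in> A" using W1(5) pW1 by blast
    define \<delta> where "\<delta> = frechet_derivative \<psi> (at P) (0, d)"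
    have "frechet_derivative X (at p) \<delta> = (0, d)"
      using diffeomorphism_derivative_inverse[OF diffeomorphism_sym[OF dW] P] unfolding \<delta>_def p_def .
    then have *: "frechet_derivative \<Phi> (at (fst p)) (fst \<delta>) = 0" "S (Dg p \<delta>) = d"
      unfolding frechet_derivative_apply_eq[OF DX[OF pW1]] by simp_all
    have \<delta>: "\<delta> = (0, snd \<delta>)" using \<Phi>_inj[OF pA *(1)] by (simp add: prod_eq_iff)
    define T where "T v = S (Dg p (0, v))" for v
    have linT: "linear T" unfolding T_def using linear_compose[OF linK[OF pW1] linS] by (simp add: o_def)
    have injT: "inj T"
    proof (rule injI)
      fix a b assume ab: "T a = T b"
      have "frechet_derivative X (at p) (0, a) = frechet_derivative X (at p) (0, b)"
        unfolding frechet_derivative_apply_eq[OF DX[OF pW1]] using ab by (simp add: T_def)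
      then have "(0 :: real^'n, a) = (0, b)"
        using diffeomorphism_derivative_inverse[OF dW p(1)] by metis
      then show "a = b" by simp
    qed
    have "T ` Du p = coordinate_subspace J2"
    proof (rule linear_image_eq_if_dim[OF linT injT Du(1)[OF pW0] subspace_coordinate_subspace])
      show "T ` Du p \<subseteq> coordinate_subspace J2"
      proof (rule image_subsetI)
        fix v assume "v \<in> Du p"
        then have "(0, v) \<in> D p" by (simp add: Du_def)
        then show "T v \<in> coordinate_subspace J2" unfolding T_def by (intro S_I2 DgD[OF pW1])
      qed
      show "dim (coordinate_subspace J2) = dim (Du p)"
        unfolding dim_coordinate_subspace cardJ Du(2)[OF pW0] ..
    qed
    then have "d \<in> T ` Du p" using d by simp
    then obtain v where v: "v \<in> Du p" "T v = d" by (auto elim: imageE)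
    have "T (snd \<delta>) = d" using *(2) \<delta> unfolding T_def by metis
    then have "snd \<delta> = v" using v(2) injD[OF injT] by metis
    then have "\<delta> \<in> D p" using v(1) \<delta> unfolding Du_def by auto
    then show ?thesis using DgD[OF pW1] unfolding \<delta>_def p_def by blast
  qed
  have tri: "triangular_form I2 J2 (X ` W) (transformed_system f \<Phi> \<psi>)"
    unfolding XW
  proof (rule triangular_formI)
    fix x u u' assume B: "(x, u) \<in> ball (X p0) R" "(x, u') \<in> ball (X p0) R" and u: "u - u' \<in> coordinate_subspace J2"
    have "(\<lambda>P. g (\<psi> P)) (x, u) - (\<lambda>P. g (\<psi> P)) (x, u') \<in> coordinate_subspace I2"
    proof (rule constant_mod_coordinate_subspace[OF convex_ball B])
      fix P assume P: "P \<in> ball (X p0) R"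
      have "\<psi> P \<in> W1" using diffeomorphism_apply(1)[OF diffeomorphism_sym[OF dW] P] W(2) by blast
      then show "((\<lambda>P. g (\<psi> P)) has_derivative (\<lambda>h. Dg (\<psi> P) (frechet_derivative \<psi> (at P) h))) (at P)"
        by (intro has_derivative_compose[OF smooth_on_has_derivative[OF diffeomorphism_smooth(2)[OF dW] P] Dg])
      show "Dg (\<psi> P) (frechet_derivative \<psi> (at P) ((x, u) - (x, u'))) \<in> coordinate_subspace I2"
        using key[OF P u] by simp
    qed
    then show "transformed_system f \<Phi> \<psi> (x, u) - transformed_system f \<Phi> \<psi> (x, u') \<in> coordinate_subspace I2"
      by (simp add: transformed_system_def g_def)
  qed
  have "state_input_transformation f A W \<Phi> \<Phi>u \<psi>"
    unfolding state_input_transformation_def X_def[symmetric] XW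
    using W W1 dA dW by blast
  moreover have "W \<subseteq> W0" using W(2) W1(3) by blast
  ultimately show ?thesis
    using W(1) I2(1) cardJ tri unfolding p0_def X_def by blast
qed

theorem theorem4:
  fixes f :: "(real^'n) \<times> (real^'m) \<Rightarrow> real^'n"
    and x0 :: "real^'n" and u0 :: "real^'m"
    and \<Omega> :: "((real^'n) \<times> (real^'m)) set"
    and m2 :: nat
  assumes "open \<Omega>" and "(x0, u0) \<in> \<Omega>"
    and "f (x0, u0) = x0"
    and "smooth_on \<Omega> f"
    and "\<forall>p\<in>\<Omega>. map_rank (frechet_derivative f (at p)) = CARD('n)"
    and "\<forall>p\<in>\<Omega>. map_rank (\<lambda>v::real^'m. frechet_derivative f (at p) (0, v)) = CARD('m)"
  shows
    "(\<exists>A W \<Phi>x \<Phi>u \<Phi>hat I2 J2.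
        (x0, u0) \<in> W \<and> W \<subseteq> \<Omega> \<and>
        state_input_transformation f A W \<Phi>x \<Phi>u \<Phi>hat \<and>
        card I2 = m2 \<and> card J2 = m2 \<and>
        triangular_form I2 J2 (extended_map \<Phi>x \<Phi>u ` W) (transformed_system f \<Phi>x \<Phi>hat))
     \<longleftrightarrow>
     (\<exists>W V D.
        open W \<and> (x0, u0) \<in> W \<and> W \<subseteq> \<Omega> \<and> open V \<and> f ` W \<subseteq> V \<and>
        distribution_on W m2 D \<and>
        (\<forall>p\<in>W. D p \<subseteq> span_du) \<and>
        projectable_distribution f W V m2 D \<and>
        involutive_on W D)"
    (is "?L \<longleftrightarrow> ?R")
proof -
  have lin: "linear (frechet_derivative f (at p))" if "p \<in> \<Omega>" for p
    using has_derivative_linear[OF smooth_on_has_derivative[OF assms(4) that]] .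
  have surj: "surj (frechet_derivative f (at p))" if "p \<in> \<Omega>" for p
  proof (rule subspace_dim_equal)
    show "subspace (range (frechet_derivative f (at p)))"
      by (rule linear_subspace_image[OF lin[OF that] subspace_UNIV])
    show "dim (UNIV :: (real^'n) set) \<le> dim (range (frechet_derivative f (at p)))"
      using assms(5) that by (simp add: map_rank_def)
  qed simp_all
  have inj: "inj (\<lambda>v. frechet_derivative f (at p) (0, v))" if "p \<in> \<Omega>" for p
  proof (rule linear_full_rank_imp_inj)
    show "linear (\<lambda>v. frechet_derivative f (at p) (0, v))"
      using linear_compose[OF _ lin[OF that], of "\<lambda>v. (0, v)"] by (simp add: o_def linear_iff)
    show "dim (range (\<lambda>v. frechet_derivative f (at p) (0, v))) = DIM(real^'m)"
      using assms(6) that by (simp add: map_rank_def)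
  qed
  show ?thesis
  proof
    assume ?L
    then obtain A W \<Phi>x \<Phi>u \<Phi>hat I2 J2 where W: "(x0, u0) \<in> W" "W \<subseteq> \<Omega>"
      and *: "state_input_transformation f A W \<Phi>x \<Phi>u \<Phi>hat" "card I2 = m2" "card J2 = m2"
        "triangular_form I2 J2 (extended_map \<Phi>x \<Phi>u ` W) (transformed_system f \<Phi>x \<Phi>hat)" by blast
    have "inj (\<lambda>v. frechet_derivative f (at p) (0, v))" if "p \<in> W" for p using inj W(2) that by blast
    from normal_form_imp_distribution[OF W(1) smooth_on_subset[OF assms(4) W(2)] this *]
    obtain W' V D where h: "open W'" "(x0, u0) \<in> W'" "W' \<subseteq> W" "open V" "f ` W' \<subseteq> V" "distribution_on W' m2 D"
      "\<forall>p\<in>W'. D p \<subseteq> span_du" "projectable_distribution f W' V m2 D" "involutive_on W' D" by blast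
    show ?R by (intro exI[of _ W'] exI[of _ V] exI[of _ D] conjI) (rule h subset_trans[OF h(3) W(2)])+
  next
    assume ?R
    then obtain W V D where W: "open W" "(x0, u0) \<in> W" "W \<subseteq> \<Omega>" and V: "open V" "f ` W \<subseteq> V"
      and D: "\<forall>p\<in>W. D p \<subseteq> span_du" "projectable_distribution f W V m2 D" "involutive_on W D" by blast
    have "\<exists>A W' \<Phi>x \<Phi>u \<Phi>hat I2 J2. (x0, u0) \<in> W' \<and> W' \<subseteq> W \<and>
        state_input_transformation f A W' \<Phi>x \<Phi>u \<Phi>hat \<and> card I2 = m2 \<and> card J2 = m2 \<and>
        triangular_form I2 J2 (extended_map \<Phi>x \<Phi>u ` W') (transformed_system f \<Phi>x \<Phi>hat)"
      by (rule distribution_imp_normal_form[OF W(1,2) assms(3) smooth_on_subset[OF assms(4) W(3)] _ _ V _ D(2,3)])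
        (use surj inj W(3) D(1) in blast)+
    then obtain A W' \<Phi>x \<Phi>u \<Phi>hat I2 J2 where h: "(x0, u0) \<in> W'" "W' \<subseteq> W"
      "state_input_transformation f A W' \<Phi>x \<Phi>u \<Phi>hat" "card I2 = m2" "card J2 = m2"
      "triangular_form I2 J2 (extended_map \<Phi>x \<Phi>u ` W') (transformed_system f \<Phi>x \<Phi>hat)" by blast
    show ?L
      by (intro exI[of _ A] exI[of _ W'] exI[of _ \<Phi>x] exI[of _ \<Phi>u] exI[of _ \<Phi>hat] exI[of _ I2] exI[of _ J2] conjI)
        (rule h subset_trans[OF h(2) W(3)])+
  qed
qed

end
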